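(* Let $X=(X_t)_{t\in[0,T]}$ be a zero-mean continuous Gaussian process with $X_0=0$, whose law on $C_0([0,T])$ has full support and which has a covariance measure $\mu$. Let $h\in L_\mu$. Then $h\in Dom(\delta)$ and $$\int_0^Th\,\delta X_s=\int_0^Th\,dX_s,$$ i.e. the Skorohod integral of $h$ coincides with its Wiener integral.
   Context: Fix $T>0$. $C_0([0,T])$ is the space of continuous functions on $[0,T]$ vanishing at $0$; the probability space is $\Omega=C_0([0,T])$ with $X$ the canonical process and the (completed) $\sigma$-field generated by $X$. Let $R(s,t)=\mathrm{Cov}(X_s,X_t)$. For $I=]a_1,b_1]\times]a_2,b_2]\subset[0,T]^2$ put $\Delta_IR=R(b_1,b_2)+R(a_1,a_2)-R(a_1,b_2)-R(b_1,a_2)$. $X$ has covariance measure $\mu$ if $I\mapsto\Delta_IR$ extends to a signed ($\sigma$-finite) measure $\mu$ on $\mathcal{B}([0,T]^2)$; thus $\mu([0,s]\times[0,t])=R(s,t)$. $L_\mu$ is the space of Borel $\varphi:[0,T]\to\mathbb{R}$ with $\|\varphi\|_{|\mathcal H|}^2:=\int_{[0,T]^2}|\varphi(u)||\varphi(v)|\,d|\mu|(u,v)<\infty$, with semiscalar product $\langle\varphi,\phi\rangle_{\mathcal H}=\int_{[0,T]^2}\varphi(u)\phi(v)\,d\mu(u,v)$. The Wiener integral $\varphi\mapsto\int_0^T\varphi\,dX$ is the linear map $L_\mu\to L^2(\Omega)$, continuous for $\|\cdot\|_{\mathcal H}$, with $\int1_{[0,t]}dX=X_t$; it satisfies $E(\int_0^T\varphi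 dX)^2=\|\varphi\|_{\mathcal H}^2$. $Cyl$ is the set of random variables $F=f(\int\phi_1dX,\dots,\int\phi_ndX)$, $n\ge1$, $f\in C_b^\infty(\mathbb{R}^n)$, $\phi_i\in L_\mu$, and $DF=\sum_i\partial_if(\int\phi_1dX,\dots,\int\phi_ndX)\phi_i$. A process $u$ with $E\|u\|_{|\mathcal H|}^2<\infty$ belongs to $Dom(\delta)$ if there is a zero-mean $Z\in L^2(\Omega)$ with $E(FZ)=E\langle DF,u\rangle_{\mathcal H}$ for every $F\in Cyl$; such $Z$ is unique and the Skorohod integral is $\int_0^Tu\,\delta X:=Z$.
   Formalization: It is assumed that L_μ is a linear space, so that ⟨φ,ψ⟩_H converges absolutely for all φ,ψ in L_μ; this can fail for some covariance measures, and then the semiscalar product and the linear Wiener integral on L_μ are undefined. *)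

theory Defs
  imports "HOL-Probability.Probability"
begin

section \<open>Signed measures\<close>

text \<open>
  A signed measure is an extended-real-valued, countably additive set function on the
  measurable sets of \<^term>\<open>M\<close> that omits one of the two infinite values.
  Its values outside \<^term>\<open>sets M\<close> are irrelevant.
\<close>

definition signed_measure :: "'a measure \<Rightarrow> ('a set \<Rightarrow> ereal) \<Rightarrow> bool" where
  "signed_measure M \<mu> \<longleftrightarrow>
     \<mu> {} = 0 \<and>
     ((\<forall>A\<in>sets M. \<mu> A \<noteq> \<infinity>) \<or> (\<forall>A\<in>sets M. \<mu> A \<noteq> - \<infinity>)) \<and>
     (\<forall>A :: nat \<Rightarrow> 'a set. range A \<subseteq> sets M \<and> disjoint_family A \<longrightarrow>
        (\<lambda>i. \<mu> (A i)) sums \<mu> (\<Union>i. A i))"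

text \<open>Jordan decomposition \<open>\<mu> = \<mu>\<^sup>+ - \<mu>\<^sup>-\<close> and total variation \<open>|\<mu>| = \<mu>\<^sup>+ + \<mu>\<^sup>-\<close>.\<close>

definition pos_variation :: "'a measure \<Rightarrow> ('a set \<Rightarrow> ereal) \<Rightarrow> 'a measure" where
  "pos_variation M \<mu> =
     measure_of (space M) (sets M) (\<lambda>A. e2ennreal (SUP B \<in> {B \<in> sets M. B \<subseteq> A}. \<mu> B))"

definition neg_variation :: "'a measure \<Rightarrow> ('a set \<Rightarrow> ereal) \<Rightarrow> 'a measure" where
  "neg_variation M \<mu> = pos_variation M (\<lambda>A. - \<mu> A)"

definition total_variation :: "'a measure \<Rightarrow> ('a set \<Rightarrow> ereal) \<Rightarrow> 'a measure" where
  "total_variation M \<mu> = measure_of (space M) (sets M)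
     (\<lambda>A. emeasure (pos_variation M \<mu>) A + emeasure (neg_variation M \<mu>) A)"

definition signed_integral :: "'a measure \<Rightarrow> ('a set \<Rightarrow> ereal) \<Rightarrow> ('a \<Rightarrow> real) \<Rightarrow> real" where
  "signed_integral M \<mu> f =
     (\<integral>x. f x \<partial>(pos_variation M \<mu>)) - (\<integral>x. f x \<partial>(neg_variation M \<mu>))"


section \<open>Path space and Gaussian processes\<close>

text \<open>
  \<open>C\<^sub>0([0,T])\<close> with the supremum distance. Paths are functions on the reals that are
  \<^const>\<open>undefined\<close> outside \<open>[0,T]\<close>; the canonical process is evaluation,
  \<open>X\<^sub>t(\<omega>) = \<omega> t\<close>.
\<close>

definition C0_metric :: "real \<Rightarrow> (real \<Rightarrow> real) metric" where
  "C0_metric T = submetric (cfunspace (top_of_set {0..T}) euclidean_metric) {\<omega>. \<omega> 0 = 0}"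

definition C0 :: "real \<Rightarrow> (real \<Rightarrow> real) set" where
  "C0 T = mspace (C0_metric T)"

definition canonical_algebra :: "real \<Rightarrow> (real \<Rightarrow> real) measure" where
  "canonical_algebra T =
     sigma (C0 T) {(\<lambda>\<omega>. \<omega> t) -` B \<inter> C0 T |t B. t \<in> {0..T} \<and> B \<in> sets borel}"

definition full_support :: "real \<Rightarrow> (real \<Rightarrow> real) measure \<Rightarrow> bool" where
  "full_support T P \<longleftrightarrow>
     (\<forall>U. openin (mtopology_of (C0_metric T)) U \<and> U \<noteq> {} \<longrightarrow> emeasure P U > 0)"

text \<open>One-dimensional Gaussian laws, point masses (variance \<open>0\<close>) included.\<close>

definition gaussian_rv :: "'a measure \<Rightarrow> ('a \<Rightarrow> real) \<Rightarrow> bool" where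
  "gaussian_rv P Y \<longleftrightarrow> Y \<in> borel_measurable P \<and>
     (\<exists>m. (AE \<omega> in P. Y \<omega> = m) \<or>
          (\<exists>\<sigma>>0. distributed P lborel Y (\<lambda>x. ennreal (normal_density m \<sigma> x))))"

definition gaussian_process :: "'a measure \<Rightarrow> 't set \<Rightarrow> ('t \<Rightarrow> 'a \<Rightarrow> real) \<Rightarrow> bool" where
  "gaussian_process P I X \<longleftrightarrow>
     (\<forall>J c. finite J \<and> J \<subseteq> I \<longrightarrow> gaussian_rv P (\<lambda>\<omega>. \<Sum>t\<in>J. c t * X t \<omega>))"

definition covariance :: "'a measure \<Rightarrow> ('a \<Rightarrow> real) \<Rightarrow> ('a \<Rightarrow> real) \<Rightarrow> real" where
  "covariance P Y Z =
     (\<integral>\<omega>. (Y \<omega> - (\<integral>\<omega>'. Y \<omega>' \<partial>P)) * (Z \<omega> - (\<integral>\<omega>'. Z \<omega>' \<partial>P)) \<partial>P)"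


section \<open>Covariance measure\<close>

definition square_borel :: "real \<Rightarrow> (real \<times> real) measure" where
  "square_borel T = restrict_space borel ({0..T} \<times> {0..T})"

definition rect_increment :: "(real \<Rightarrow> real \<Rightarrow> real) \<Rightarrow> real \<Rightarrow> real \<Rightarrow> real \<Rightarrow> real \<Rightarrow> real" where
  "rect_increment R a1 b1 a2 b2 = R b1 b2 + R a1 a2 - R a1 b2 - R b1 a2"

text \<open>
  The half-open rectangles do not meet the axes, so the extension property alone says nothing
  about the mass of \<open>\<mu>\<close> there. The last clause fixes it (to \<open>0\<close>) by the identity
  \<open>\<mu>([0,s] \<times> [0,t]) = R(s,t)\<close>.
\<close>

definition has_covariance_measure ::
    "real \<Rightarrow> (real \<Rightarrow> real) measure \<Rightarrow> ((real \<times> real) set \<Rightarrow> ereal) \<Rightarrow> bool" where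
  "has_covariance_measure T P \<mu> \<longleftrightarrow>
     (let R = (\<lambda>s t. covariance P (\<lambda>\<omega>. \<omega> s) (\<lambda>\<omega>. \<omega> t)) in
       signed_measure (square_borel T) \<mu> \<and>
       sigma_finite_measure (total_variation (square_borel T) \<mu>) \<and>
       (\<forall>a1 b1 a2 b2. 0 \<le> a1 \<and> a1 \<le> b1 \<and> b1 \<le> T \<and> 0 \<le> a2 \<and> a2 \<le> b2 \<and> b2 \<le> T \<longrightarrow>
          \<mu> ({a1<..b1} \<times> {a2<..b2}) = ereal (rect_increment R a1 b1 a2 b2)) \<and>
       (\<forall>s\<in>{0..T}. \<forall>t\<in>{0..T}. \<mu> ({0..s} \<times> {0..t}) = ereal (R s t)))"


section \<open>The space \<open>L\<^sub>\<mu>\<close> and the Wiener integral\<close>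

definition abs_norm_sq :: "real \<Rightarrow> ((real \<times> real) set \<Rightarrow> ereal) \<Rightarrow> (real \<Rightarrow> real) \<Rightarrow> ennreal" where
  "abs_norm_sq T \<mu> \<phi> =
     (\<integral>\<^sup>+ p. ennreal (\<bar>\<phi> (fst p)\<bar> * \<bar>\<phi> (snd p)\<bar>) \<partial>(total_variation (square_borel T) \<mu>))"

definition L_mu :: "real \<Rightarrow> ((real \<times> real) set \<Rightarrow> ereal) \<Rightarrow> (real \<Rightarrow> real) set" where
  "L_mu T \<mu> =
     {\<phi> \<in> borel_measurable (restrict_space borel {0..T}). abs_norm_sq T \<mu> \<phi> < \<infinity>}"

definition inner_H ::
    "real \<Rightarrow> ((real \<times> real) set \<Rightarrow> ereal) \<Rightarrow> (real \<Rightarrow> real) \<Rightarrow> (real \<Rightarrow> real) \<Rightarrow> real" where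
  "inner_H T \<mu> \<phi> \<psi> = signed_integral (square_borel T) \<mu> (\<lambda>p. \<phi> (fst p) * \<psi> (snd p))"

definition norm_H :: "real \<Rightarrow> ((real \<times> real) set \<Rightarrow> ereal) \<Rightarrow> (real \<Rightarrow> real) \<Rightarrow> real" where
  "norm_H T \<mu> \<phi> = sqrt (inner_H T \<mu> \<phi> \<phi>)"

text \<open>
  Finiteness of \<open>|\<phi>|\<otimes>|\<phi>|\<close> and \<open>|\<psi>|\<otimes>|\<psi>|\<close> under \<open>|\<mu>|\<close> does not by itself control the mixed
  term \<open>|\<phi>|\<otimes>|\<psi>|\<close>, because \<open>|\<mu>|\<close> need not be positive definite. That \<^const>\<open>L_mu\<close> is a
  linear space says exactly that the mixed terms are finite, i.e. that \<^const>\<open>inner_H\<close> is given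
  by absolutely convergent integrals on \<^const>\<open>L_mu\<close>.
\<close>

definition L_mu_linear :: "real \<Rightarrow> ((real \<times> real) set \<Rightarrow> ereal) \<Rightarrow> bool" where
  "L_mu_linear T \<mu> \<longleftrightarrow>
     (\<forall>\<phi>\<in>L_mu T \<mu>. \<forall>\<psi>\<in>L_mu T \<mu>. \<forall>a b. (\<lambda>t. a * \<phi> t + b * \<psi> t) \<in> L_mu T \<mu>)"

definition L2 :: "'a measure \<Rightarrow> ('a \<Rightarrow> real) set" where
  "L2 P = {Z \<in> borel_measurable P. integrable P (\<lambda>\<omega>. (Z \<omega>)\<^sup>2)}"

definition is_wiener_integral ::
    "real \<Rightarrow> (real \<Rightarrow> real) measure \<Rightarrow> ((real \<times> real) set \<Rightarrow> ereal) \<Rightarrow>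
     ((real \<Rightarrow> real) \<Rightarrow> (real \<Rightarrow> real) \<Rightarrow> real) \<Rightarrow> bool" where
  "is_wiener_integral T P \<mu> I \<longleftrightarrow>
     (\<forall>\<phi>\<in>L_mu T \<mu>. I \<phi> \<in> L2 P) \<and>
     (\<forall>\<phi>\<in>L_mu T \<mu>. \<forall>\<psi>\<in>L_mu T \<mu>. \<forall>a b.
        AE \<omega> in P. I (\<lambda>t. a * \<phi> t + b * \<psi> t) \<omega> = a * I \<phi> \<omega> + b * I \<psi> \<omega>) \<and>
     (\<forall>\<phi>s \<phi>. (\<forall>n :: nat. \<phi>s n \<in> L_mu T \<mu>) \<and> \<phi> \<in> L_mu T \<mu> \<and>
        (\<lambda>n. norm_H T \<mu> (\<lambda>t. \<phi>s n t - \<phi> t)) \<longlonglongrightarrow> 0 \<longrightarrow>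
        (\<lambda>n. \<integral>\<omega>. (I (\<phi>s n) \<omega> - I \<phi> \<omega>)\<^sup>2 \<partial>P) \<longlonglongrightarrow> 0) \<and>
     (\<forall>t\<in>{0..T}. AE \<omega> in P. I (indicator {0..t}) \<omega> = \<omega> t)"

text \<open>Determined up to null sets: step functions are dense in \<^const>\<open>L_mu\<close> for \<^const>\<open>norm_H\<close>.\<close>

definition wiener_integral ::
    "real \<Rightarrow> (real \<Rightarrow> real) measure \<Rightarrow> ((real \<times> real) set \<Rightarrow> ereal) \<Rightarrow>
     (real \<Rightarrow> real) \<Rightarrow> (real \<Rightarrow> real) \<Rightarrow> real" where
  "wiener_integral T P \<mu> = (SOME I. is_wiener_integral T P \<mu> I)"


section \<open>Cylindrical functionals and the Skorohod integral\<close>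

text \<open>
  Functions on \<open>\<real>\<^sup>n\<close> are represented as functions of a sequence \<open>x :: nat \<Rightarrow> real\<close> that depend
  on \<open>x 0, \<dots>, x (n - 1)\<close> only.
\<close>

definition partial :: "nat \<Rightarrow> ((nat \<Rightarrow> real) \<Rightarrow> real) \<Rightarrow> (nat \<Rightarrow> real) \<Rightarrow> real" where
  "partial i f x = deriv (\<lambda>s. f (x(i := s))) (x i)"

definition Cb_infty :: "nat \<Rightarrow> ((nat \<Rightarrow> real) \<Rightarrow> real) set" where
  "Cb_infty n = {f.
     (\<forall>x y. (\<forall>i<n. x i = y i) \<longrightarrow> f x = f y) \<and>
     (\<forall>js. set js \<subseteq> {..<n} \<longrightarrow>
        (let g = foldr partial js f in
          continuous_on UNIV g \<and> bounded (range g) \<and>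
          (\<forall>i<n. \<forall>x. (\<lambda>s. g (x(i := s))) differentiable (at (x i)))))}"

definition cyl_rv ::
    "real \<Rightarrow> (real \<Rightarrow> real) measure \<Rightarrow> ((real \<times> real) set \<Rightarrow> ereal) \<Rightarrow>
     ((nat \<Rightarrow> real) \<Rightarrow> real) \<Rightarrow> (nat \<Rightarrow> real \<Rightarrow> real) \<Rightarrow> (real \<Rightarrow> real) \<Rightarrow> real" where
  "cyl_rv T P \<mu> f \<phi> \<omega> = f (\<lambda>i. wiener_integral T P \<mu> (\<phi> i) \<omega>)"

definition malliavin_deriv ::
    "real \<Rightarrow> (real \<Rightarrow> real) measure \<Rightarrow> ((real \<times> real) set \<Rightarrow> ereal) \<Rightarrow> nat \<Rightarrow>
     ((nat \<Rightarrow> real) \<Rightarrow> real) \<Rightarrow> (nat \<Rightarrow> real \<Rightarrow> real) \<Rightarrow> (real \<Rightarrow> real) \<Rightarrow> real \<Rightarrow> real" where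
  "malliavin_deriv T P \<mu> n f \<phi> \<omega> t =
     (\<Sum>i<n. partial i f (\<lambda>j. wiener_integral T P \<mu> (\<phi> j) \<omega>) * \<phi> i t)"

text \<open>
  \<open>Z\<close> is a Skorohod integral of the process \<open>u\<close>. The duality is required for every
  representation of every cylindrical functional.
\<close>

definition is_skorohod_integral ::
    "real \<Rightarrow> (real \<Rightarrow> real) measure \<Rightarrow> ((real \<times> real) set \<Rightarrow> ereal) \<Rightarrow>
     ((real \<Rightarrow> real) \<Rightarrow> real \<Rightarrow> real) \<Rightarrow> ((real \<Rightarrow> real) \<Rightarrow> real) \<Rightarrow> bool" where
  "is_skorohod_integral T P \<mu> u Z \<longleftrightarrow>
     Z \<in> L2 P \<and> (\<integral>\<omega>. Z \<omega> \<partial>P) = 0 \<and>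
     (\<forall>n\<ge>1. \<forall>f\<in>Cb_infty n. \<forall>\<phi>. (\<forall>i<n. \<phi> i \<in> L_mu T \<mu>) \<longrightarrow>
        integrable P (\<lambda>\<omega>. inner_H T \<mu> (malliavin_deriv T P \<mu> n f \<phi> \<omega>) (u \<omega>)) \<and>
        (\<integral>\<omega>. cyl_rv T P \<mu> f \<phi> \<omega> * Z \<omega> \<partial>P) =
        (\<integral>\<omega>. inner_H T \<mu> (malliavin_deriv T P \<mu> n f \<phi> \<omega>) (u \<omega>) \<partial>P))"

definition Dom_delta ::
    "real \<Rightarrow> (real \<Rightarrow> real) measure \<Rightarrow> ((real \<times> real) set \<Rightarrow> ereal) \<Rightarrow>
     ((real \<Rightarrow> real) \<Rightarrow> real \<Rightarrow> real) set" where
  "Dom_delta T P \<mu> = {u.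
     (\<lambda>(\<omega>, t). u \<omega> t) \<in> borel_measurable (P \<Otimes>\<^sub>M restrict_space borel {0..T}) \<and>
     (\<integral>\<^sup>+ \<omega>. abs_norm_sq T \<mu> (u \<omega>) \<partial>P) < \<infinity> \<and>
     (\<exists>Z. is_skorohod_integral T P \<mu> u Z)}"

text \<open>Determined up to null sets, since cylindrical functionals are dense in \<^const>\<open>L2\<close>.\<close>

definition skorohod_integral ::
    "real \<Rightarrow> (real \<Rightarrow> real) measure \<Rightarrow> ((real \<times> real) set \<Rightarrow> ereal) \<Rightarrow>
     ((real \<Rightarrow> real) \<Rightarrow> real \<Rightarrow> real) \<Rightarrow> (real \<Rightarrow> real) \<Rightarrow> real" where
  "skorohod_integral T P \<mu> u = (SOME Z. is_skorohod_integral T P \<mu> u Z)"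

end

theory Submission
  imports Defs
begin

text \<open>
  The Wiener integral is an isometry from \<open>L\<^sub>\<mu>\<close> into \<open>L\<^sup>2\<close>, and its range consists of jointly
  centred Gaussian variables. For a cylindrical \<open>F = f(\<integral>\<phi>\<^sub>1 dX, \<dots>, \<integral>\<phi>\<^sub>n dX)\<close> Gaussian integration by
  parts gives \<open>E(F \<integral>h dX) = \<Sum>\<^sub>i E(\<partial>\<^sub>i f) E(\<integral>\<phi>\<^sub>i dX \<integral>h dX) = \<Sum>\<^sub>i E(\<partial>\<^sub>i f) \<langle>\<phi>\<^sub>i, h\<rangle>\<close>, and the right-hand
  side is \<open>E\<langle>DF, h\<rangle>\<close>; so \<open>\<integral>h dX\<close> is a Skorohod integral of \<open>h\<close>. Any two Skorohod integrals of the
  same process agree, because their difference is orthogonal to all \<open>cos(\<Sum> c\<^sub>t X\<^sub>t + \<theta>)\<close>, and a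
  weight with vanishing Fourier transform vanishes on the \<open>\<sigma>\<close>-field generated by \<open>X\<close>.
\<close>

section \<open>Square-integrable random variables\<close>

text \<open>Both integrals in the statement are arbitrary choices, so each needs a witness and a
  proof that whatever was chosen agrees with it. For the Wiener integral the obstacle is the sign of
  \<mu>: \<open>inner_H\<close> is not visibly positive, and \<open>|\<mu>|\<close> admits no
  Cauchy-Schwarz inequality. Positivity is therefore imported from probability: the integral is
  built as a relation generated from the coordinates by operations that preserve
  \<open>E(Z Y) = inner_H T \<mu> \<phi> \<psi>\<close>, and only this identity shows that
  \<open>inner_H T \<mu> \<phi> \<phi>\<close> is nonnegative. Gaussianity is recorded as the value
  of the characteristic function at frequency 1 in terms of the second moment, because that form
  survives mean-square limits and includes zero variance, whereas densities do neither. Independence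
  and uniqueness then both come from one Fourier statement about signed weights. All of this
  presupposes finite variations; \<sigma>-finiteness alone would leave \<mu> as a difference of
  possibly infinite measures, and it is the finite value
  \<open>\<mu>([0,T] \<times> [0,T]) = R(T,T)\<close> that excludes this.\<close>

lemma L2_iff: "Z \<in> L2 P \<longleftrightarrow> Z \<in> borel_measurable P \<and> integrable P (\<lambda>\<omega>. (Z \<omega>)\<^sup>2)"
  by (simp add: L2_def)

lemma L2_mult_integrable:
  assumes "Z \<in> L2 P" "W \<in> L2 P"
  shows "integrable P (\<lambda>\<omega>. Z \<omega> * W \<omega>)"
proof (rule Bochner_Integration.integrable_bound)
  show "integrable P (\<lambda>\<omega>. (Z \<omega>)\<^sup>2 + (W \<omega>)\<^sup>2)" using assms by (auto simp: L2_iff)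
  show "(\<lambda>\<omega>. Z \<omega> * W \<omega>) \<in> borel_measurable P" using assms by (auto simp: L2_iff)
  have "\<bar>x * y\<bar> \<le> x\<^sup>2 + y\<^sup>2" for x y :: real
  proof -
    have "2 * \<bar>x\<bar> * \<bar>y\<bar> \<le> x\<^sup>2 + y\<^sup>2" using sum_squares_bound[of "\<bar>x\<bar>" "\<bar>y\<bar>"] by simp
    moreover have "0 \<le> \<bar>x\<bar> * \<bar>y\<bar>" by simp
    ultimately show ?thesis unfolding abs_mult by linarith
  qed
  then show "AE x in P. norm (Z x * W x) \<le> norm ((Z x)\<^sup>2 + (W x)\<^sup>2)"
    by (intro AE_I2) (simp add: abs_mult)
qed

lemma L2_linear:
  assumes "Z \<in> L2 P" "W \<in> L2 P"
  shows "(\<lambda>\<omega>. a * Z \<omega> + b * W \<omega>) \<in> L2 P"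
proof -
  have "(\<lambda>\<omega>. (a * Z \<omega> + b * W \<omega>)\<^sup>2) =
      (\<lambda>\<omega>. a\<^sup>2 * (Z \<omega>)\<^sup>2 + (2 * a * b) * (Z \<omega> * W \<omega>) + b\<^sup>2 * (W \<omega>)\<^sup>2)"
    by (auto simp: power2_eq_square algebra_simps)
  then show ?thesis
    using assms L2_mult_integrable[OF assms] by (auto simp: L2_iff)
qed

lemma L2_diff: "Z \<in> L2 P \<Longrightarrow> W \<in> L2 P \<Longrightarrow> (\<lambda>\<omega>. Z \<omega> - W \<omega>) \<in> L2 P"
  using L2_linear[of Z P W 1 "-1"] by simp

lemma L2_sum:
  assumes "\<And>i. i \<in> J \<Longrightarrow> Z i \<in> L2 P"
  shows "(\<lambda>\<omega>. \<Sum>i\<in>J. c i * Z i \<omega>) \<in> L2 P"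
  using assms
proof (induction J rule: infinite_finite_induct)
  case (insert i J)
  then have "(\<lambda>\<omega>. c i * Z i \<omega> + 1 * (\<Sum>i\<in>J. c i * Z i \<omega>)) \<in> L2 P"
    by (intro L2_linear) auto
  with insert.hyps show ?case by simp
qed (auto simp: L2_iff)

lemma L2_expectation_diff_sq_expand:
  assumes "Z \<in> L2 P" "W \<in> L2 P"
  shows "(\<integral>\<omega>. (Z \<omega> - W \<omega>)\<^sup>2 \<partial>P) =
    (\<integral>\<omega>. Z \<omega> * Z \<omega> \<partial>P) - 2 * (\<integral>\<omega>. Z \<omega> * W \<omega> \<partial>P) + (\<integral>\<omega>. W \<omega> * W \<omega> \<partial>P)"
proof -
  have "(\<lambda>\<omega>. (Z \<omega> - W \<omega>)\<^sup>2) = (\<lambda>\<omega>. Z \<omega> * Z \<omega> - 2 * (Z \<omega> * W \<omega>) + W \<omega> * W \<omega>)"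
    by (auto simp: power2_eq_square algebra_simps)
  then show ?thesis
    using L2_mult_integrable[of Z P W] L2_mult_integrable[of Z P Z] L2_mult_integrable[of W P W] assms
    by simp
qed

lemma L2_diff_zero_AE_eq:
  assumes "Z \<in> L2 P" "W \<in> L2 P" "(\<integral>\<omega>. (Z \<omega> - W \<omega>)\<^sup>2 \<partial>P) = 0"
  shows "AE \<omega> in P. Z \<omega> = W \<omega>"
proof -
  have "integrable P (\<lambda>\<omega>. (Z \<omega> - W \<omega>)\<^sup>2)"
    using L2_diff[OF assms(1,2)] by (simp add: L2_iff)
  then have "AE \<omega> in P. (Z \<omega> - W \<omega>)\<^sup>2 = 0"
    using assms(3) by (subst integral_nonneg_eq_0_iff_AE[symmetric]) auto
  then show ?thesis by eventually_elim simp
qed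

lemma L2_cauchy_schwarz:
  assumes "Z \<in> L2 P" "W \<in> L2 P"
  shows "(\<integral>\<omega>. \<bar>Z \<omega> * W \<omega>\<bar> \<partial>P) \<le> sqrt (\<integral>\<omega>. (Z \<omega>)\<^sup>2 \<partial>P) * sqrt (\<integral>\<omega>. (W \<omega>)\<^sup>2 \<partial>P)"
proof -
  have m[measurable]: "Z \<in> borel_measurable P" "W \<in> borel_measurable P"
    using assms by (auto simp: L2_iff)
  have i: "integrable P (\<lambda>\<omega>. \<bar>Z \<omega> * W \<omega>\<bar>)" using L2_mult_integrable[OF assms] by simp
  have "(\<integral>\<^sup>+\<omega>. ennreal \<bar>Z \<omega>\<bar> * ennreal \<bar>W \<omega>\<bar> \<partial>P)\<^sup>2
      \<le> (\<integral>\<^sup>+\<omega>. (ennreal \<bar>Z \<omega>\<bar>)\<^sup>2 \<partial>P) * (\<integral>\<^sup>+\<omega>. (ennreal \<bar>W \<omega>\<bar>)\<^sup>2 \<partial>P)"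
    by (rule Cauchy_Schwarz_nn_integral) auto
  also have "(\<integral>\<^sup>+\<omega>. (ennreal \<bar>Z \<omega>\<bar>)\<^sup>2 \<partial>P) = ennreal (\<integral>\<omega>. (Z \<omega>)\<^sup>2 \<partial>P)"
    using assms by (subst nn_integral_eq_integral[symmetric]) (auto simp: L2_iff ennreal_power)
  also have "(\<integral>\<^sup>+\<omega>. (ennreal \<bar>W \<omega>\<bar>)\<^sup>2 \<partial>P) = ennreal (\<integral>\<omega>. (W \<omega>)\<^sup>2 \<partial>P)"
    using assms by (subst nn_integral_eq_integral[symmetric]) (auto simp: L2_iff ennreal_power)
  also have "(\<integral>\<^sup>+\<omega>. ennreal \<bar>Z \<omega>\<bar> * ennreal \<bar>W \<omega>\<bar> \<partial>P) = ennreal (\<integral>\<omega>. \<bar>Z \<omega> * W \<omega>\<bar> \<partial>P)"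
    using i by (subst nn_integral_eq_integral[symmetric]) (auto simp: abs_mult ennreal_mult)
  finally have "(\<integral>\<omega>. \<bar>Z \<omega> * W \<omega>\<bar> \<partial>P)\<^sup>2 \<le> (\<integral>\<omega>. (Z \<omega>)\<^sup>2 \<partial>P) * (\<integral>\<omega>. (W \<omega>)\<^sup>2 \<partial>P)"
    by (simp add: ennreal_power ennreal_mult[symmetric] ennreal_le_iff)
  then show ?thesis
    by (simp add: real_le_rsqrt real_sqrt_mult[symmetric])
qed

lemma L2_tendsto_inner:
  assumes Z: "\<And>n. Z n \<in> L2 P" "Y \<in> L2 P" and W: "W \<in> L2 P"
    and lim: "(\<lambda>n. \<integral>\<omega>. (Z n \<omega> - Y \<omega>)\<^sup>2 \<partial>P) \<longlonglongrightarrow> 0"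
  shows "(\<lambda>n. \<integral>\<omega>. Z n \<omega> * W \<omega> \<partial>P) \<longlonglongrightarrow> (\<integral>\<omega>. Y \<omega> * W \<omega> \<partial>P)"
proof (rule LIM_zero_cancel, rule Lim_null_comparison)
  have "norm ((\<integral>\<omega>. Z n \<omega> * W \<omega> \<partial>P) - (\<integral>\<omega>. Y \<omega> * W \<omega> \<partial>P))
      \<le> sqrt (\<integral>\<omega>. (Z n \<omega> - Y \<omega>)\<^sup>2 \<partial>P) * sqrt (\<integral>\<omega>. (W \<omega>)\<^sup>2 \<partial>P)" for n
  proof -
    have "(\<integral>\<omega>. Z n \<omega> * W \<omega> \<partial>P) - (\<integral>\<omega>. Y \<omega> * W \<omega> \<partial>P) = (\<integral>\<omega>. (Z n \<omega> - Y \<omega>) * W \<omega> \<partial>P)"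
      using L2_mult_integrable[OF Z(1) W] L2_mult_integrable[OF Z(2) W]
      by (simp add: left_diff_distrib)
    then show ?thesis
      unfolding real_norm_def using L2_cauchy_schwarz[OF L2_diff[OF Z(1) Z(2)] W, of n]
        integral_abs_bound[of P "\<lambda>\<omega>. (Z n \<omega> - Y \<omega>) * W \<omega>"] by linarith
  qed
  then show "\<forall>\<^sub>F n in sequentially. norm ((\<integral>\<omega>. Z n \<omega> * W \<omega> \<partial>P) - (\<integral>\<omega>. Y \<omega> * W \<omega> \<partial>P))
      \<le> sqrt (\<integral>\<omega>. (Z n \<omega> - Y \<omega>)\<^sup>2 \<partial>P) * sqrt (\<integral>\<omega>. (W \<omega>)\<^sup>2 \<partial>P)" by simp
  show "(\<lambda>n. sqrt (\<integral>\<omega>. (Z n \<omega> - Y \<omega>)\<^sup>2 \<partial>P) * sqrt (\<integral>\<omega>. (W \<omega>)\<^sup>2 \<partial>P)) \<longlonglongrightarrow> 0"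
    using tendsto_mult_left_zero[OF tendsto_real_sqrt[OF lim, simplified]] by simp
qed

lemma (in prob_space) L2_integrable: "Z \<in> L2 M \<Longrightarrow> integrable M Z"
  by (auto simp: L2_iff intro: square_integrable_imp_integrable)

lemma (in prob_space) const_L2: "(\<lambda>_. c) \<in> L2 M"
  by (auto simp: L2_iff)

lemma (in prob_space) L2_expectation_abs_le:
  "Z \<in> L2 M \<Longrightarrow> (\<integral>\<omega>. \<bar>Z \<omega>\<bar> \<partial>M) \<le> sqrt (\<integral>\<omega>. (Z \<omega>)\<^sup>2 \<partial>M)"
  using L2_cauchy_schwarz[of Z M "\<lambda>_. 1"] const_L2[of 1] by (simp add: prob_space)

lemma (in prob_space) L2_tendsto_sq:
  assumes Z: "\<And>n. Z n \<in> L2 M" "Y \<in> L2 M"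
    and lim: "(\<lambda>n. \<integral>\<omega>. (Z n \<omega> - Y \<omega>)\<^sup>2 \<partial>M) \<longlonglongrightarrow> 0"
  shows "(\<lambda>n. \<integral>\<omega>. (Z n \<omega>)\<^sup>2 \<partial>M) \<longlonglongrightarrow> (\<integral>\<omega>. (Y \<omega>)\<^sup>2 \<partial>M)"
proof -
  have eq: "(\<integral>\<omega>. (Z n \<omega>)\<^sup>2 \<partial>M) =
      (\<integral>\<omega>. (Z n \<omega> - Y \<omega>)\<^sup>2 \<partial>M) + 2 * (\<integral>\<omega>. Z n \<omega> * Y \<omega> \<partial>M) - (\<integral>\<omega>. Y \<omega> * Y \<omega> \<partial>M)" for n
    using L2_expectation_diff_sq_expand[OF Z(1) Z(2), of n] by (simp add: power2_eq_square)
  have "(\<lambda>n. (\<integral>\<omega>. (Z n \<omega> - Y \<omega>)\<^sup>2 \<partial>M) + 2 * (\<integral>\<omega>. Z n \<omega> * Y \<omega> \<partial>M) - (\<integral>\<omega>. Y \<omega> * Y \<omega> \<partial>M))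
      \<longlonglongrightarrow> 0 + 2 * (\<integral>\<omega>. Y \<omega> * Y \<omega> \<partial>M) - (\<integral>\<omega>. Y \<omega> * Y \<omega> \<partial>M)"
    using L2_tendsto_inner[OF Z Z(2) lim] lim by (intro tendsto_intros)
  then show ?thesis unfolding eq by (simp add: power2_eq_square)
qed

text \<open>On a probability space a mean-square Cauchy sequence is Cauchy in mean, so a subsequence
  converges almost everywhere. Its limit is the candidate, and Fatou's lemma returns the mean-square
  estimate.\<close>

lemma (in prob_space) L2_complete:
  assumes Z: "\<And>n. Z n \<in> L2 M"
    and cauchy: "\<And>e. e > 0 \<Longrightarrow> \<exists>N. \<forall>i\<ge>N. \<forall>j\<ge>N. (\<integral>\<omega>. (Z i \<omega> - Z j \<omega>)\<^sup>2 \<partial>M) < e"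
  obtains Y where "Y \<in> L2 M" "(\<lambda>n. \<integral>\<omega>. (Z n \<omega> - Y \<omega>)\<^sup>2 \<partial>M) \<longlonglongrightarrow> 0"
proof -
  have [measurable]: "Z n \<in> borel_measurable M" for n using Z by (simp add: L2_iff)
  have "\<exists>N. \<forall>i\<ge>N. \<forall>j\<ge>N. (\<integral>\<omega>. norm (Z i \<omega> - Z j \<omega>) \<partial>M) < e" if "e > 0" for e
  proof -
    obtain N where N: "\<And>i j. i \<ge> N \<Longrightarrow> j \<ge> N \<Longrightarrow> (\<integral>\<omega>. (Z i \<omega> - Z j \<omega>)\<^sup>2 \<partial>M) < e\<^sup>2"
      using cauchy[of "e\<^sup>2"] \<open>e > 0\<close> by auto
    have "(\<integral>\<omega>. norm (Z i \<omega> - Z j \<omega>) \<partial>M) < e" if "i \<ge> N" "j \<ge> N" for i j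
    proof -
      have "(\<integral>\<omega>. norm (Z i \<omega> - Z j \<omega>) \<partial>M) \<le> sqrt (\<integral>\<omega>. (Z i \<omega> - Z j \<omega>)\<^sup>2 \<partial>M)"
        using L2_expectation_abs_le[OF L2_diff[OF Z Z]] by simp
      also have "\<dots> < sqrt (e\<^sup>2)" using N[OF that] by (rule real_sqrt_less_mono)
      finally show ?thesis using \<open>e > 0\<close> by simp
    qed
    then show ?thesis by blast
  qed
  from cauchy_L1_AE_cauchy_subseq[OF L2_integrable[OF Z] this]
  obtain r where r: "strict_mono r" "AE \<omega> in M. Cauchy (\<lambda>i. Z (r i) \<omega>)" by auto
  define Y where "Y \<omega> = lim (\<lambda>i. Z (r i) \<omega>)" for \<omega>
  have [measurable]: "Y \<in> borel_measurable M" unfolding Y_def by measurable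
  have conv: "AE \<omega> in M. (\<lambda>i. Z (r i) \<omega>) \<longlonglongrightarrow> Y \<omega>"
    using r(2) by eventually_elim (simp add: Y_def Cauchy_convergent_iff convergent_LIMSEQ_iff)
  \<comment> \<open>The second index of the Cauchy bound is sent to infinity along the subsequence.
    The integral is the nonnegative one because square integrability of \<open>Y\<close> is a
    consequence of this bound.\<close>
  have fatou: "(\<integral>\<^sup>+\<omega>. ennreal ((Z n \<omega> - Y \<omega>)\<^sup>2) \<partial>M) \<le> ennreal e"
    if "e > 0" and N: "\<And>i j. i \<ge> N \<Longrightarrow> j \<ge> N \<Longrightarrow> (\<integral>\<omega>. (Z i \<omega> - Z j \<omega>)\<^sup>2 \<partial>M) < e" and "n \<ge> N" for n N e
  proof -
    have "(\<integral>\<^sup>+\<omega>. ennreal ((Z n \<omega> - Y \<omega>)\<^sup>2) \<partial>M)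
        = (\<integral>\<^sup>+\<omega>. liminf (\<lambda>i. ennreal ((Z n \<omega> - Z (r i) \<omega>)\<^sup>2)) \<partial>M)"
    proof (rule nn_integral_cong_AE)
      show "AE \<omega> in M. ennreal ((Z n \<omega> - Y \<omega>)\<^sup>2) = liminf (\<lambda>i. ennreal ((Z n \<omega> - Z (r i) \<omega>)\<^sup>2))"
        using conv
      proof eventually_elim
        case (elim \<omega>)
        have "(\<lambda>i. ennreal ((Z n \<omega> - Z (r i) \<omega>)\<^sup>2)) \<longlonglongrightarrow> ennreal ((Z n \<omega> - Y \<omega>)\<^sup>2)"
          by (intro tendsto_intros elim)
        then show ?case by (simp add: lim_imp_Liminf[symmetric])
      qed
    qed
    also have "\<dots> \<le> liminf (\<lambda>i. \<integral>\<^sup>+\<omega>. ennreal ((Z n \<omega> - Z (r i) \<omega>)\<^sup>2) \<partial>M)"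
      by (rule nn_integral_liminf) simp
    also have "\<dots> \<le> liminf (\<lambda>i::nat. ennreal e)"
    proof (rule Liminf_mono)
      show "\<forall>\<^sub>F i in sequentially. (\<integral>\<^sup>+\<omega>. ennreal ((Z n \<omega> - Z (r i) \<omega>)\<^sup>2) \<partial>M) \<le> ennreal e"
        using eventually_ge_at_top[of N]
      proof eventually_elim
        case (elim i)
        then have "r i \<ge> N" using seq_suble[OF r(1), of i] by simp
        then have "(\<integral>\<omega>. (Z n \<omega> - Z (r i) \<omega>)\<^sup>2 \<partial>M) \<le> e" using N[OF \<open>n \<ge> N\<close>] by (simp add: less_imp_le)
        moreover have "integrable M (\<lambda>\<omega>. (Z n \<omega> - Z (r i) \<omega>)\<^sup>2)"
          using L2_diff[OF Z Z] by (simp add: L2_iff)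
        ultimately show ?case
          by (subst nn_integral_eq_integral) (auto intro: ennreal_leI)
      qed
    qed
    finally show ?thesis by (simp add: Liminf_const)
  qed
  have Y: "Y \<in> L2 M"
  proof -
    obtain N where N: "\<And>i j. i \<ge> N \<Longrightarrow> j \<ge> N \<Longrightarrow> (\<integral>\<omega>. (Z i \<omega> - Z j \<omega>)\<^sup>2 \<partial>M) < 1"
      using cauchy[of 1] by auto
    have "(\<integral>\<^sup>+\<omega>. ennreal ((Z N \<omega> - Y \<omega>)\<^sup>2) \<partial>M) \<le> ennreal 1"
      by (rule fatou[of 1 N N]) (use N in auto)
    then have "(\<integral>\<^sup>+\<omega>. ennreal ((Z N \<omega> - Y \<omega>)\<^sup>2) \<partial>M) < \<infinity>"
      by (rule le_less_trans) simp
    then have "(\<lambda>\<omega>. Z N \<omega> - Y \<omega>) \<in> L2 M"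
      by (auto simp: L2_iff intro!: integrableI_nonneg)
    from L2_diff[OF Z[of N] this] show ?thesis by simp
  qed
  have "(\<lambda>n. \<integral>\<omega>. (Z n \<omega> - Y \<omega>)\<^sup>2 \<partial>M) \<longlonglongrightarrow> 0"
  proof (rule LIMSEQ_I)
    fix e :: real assume "e > 0"
    obtain N where N: "\<And>i j. i \<ge> N \<Longrightarrow> j \<ge> N \<Longrightarrow> (\<integral>\<omega>. (Z i \<omega> - Z j \<omega>)\<^sup>2 \<partial>M) < e / 2"
      using cauchy[of "e / 2"] \<open>e > 0\<close> by auto
    have "norm ((\<integral>\<omega>. (Z n \<omega> - Y \<omega>)\<^sup>2 \<partial>M) - 0) < e" if "n \<ge> N" for n
    proof -
      have "integrable M (\<lambda>\<omega>. (Z n \<omega> - Y \<omega>)\<^sup>2)" using L2_diff[OF Z Y] by (simp add: L2_iff)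
      then have "ennreal (\<integral>\<omega>. (Z n \<omega> - Y \<omega>)\<^sup>2 \<partial>M) \<le> ennreal (e / 2)"
        using fatou[OF _ N that] \<open>e > 0\<close> by (subst nn_integral_eq_integral[symmetric]) auto
      then have "(\<integral>\<omega>. (Z n \<omega> - Y \<omega>)\<^sup>2 \<partial>M) \<le> e / 2" using \<open>e > 0\<close> by (simp add: ennreal_le_iff)
      then show ?thesis using \<open>e > 0\<close> by simp
    qed
    then show "\<exists>N. \<forall>n\<ge>N. norm ((\<integral>\<omega>. (Z n \<omega> - Y \<omega>)\<^sup>2 \<partial>M) - 0) < e" by blast
  qed
  with Y show ?thesis by (rule that)
qed

text \<open>The difference \<open>D = Z - Y\<close> itself serves as test variable:
  \<open>E(Z D)\<close> and \<open>E(Y D)\<close> are both the limit of \<open>E(Zs k D)\<close>,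
  hence \<open>E(D\<^sup>2) = 0\<close>.\<close>

lemma (in prob_space) L2_limit_unique:
  assumes "\<And>k::nat. Zs k \<in> L2 M" "Z \<in> L2 M" "Y \<in> L2 M"
    and "(\<lambda>k. \<integral>\<omega>. (Zs k \<omega> - Z \<omega>)\<^sup>2 \<partial>M) \<longlonglongrightarrow> 0" "(\<lambda>k. \<integral>\<omega>. (Zs k \<omega> - Y \<omega>)\<^sup>2 \<partial>M) \<longlonglongrightarrow> 0"
  shows "AE \<omega> in M. Z \<omega> = Y \<omega>"
proof (rule L2_diff_zero_AE_eq[OF assms(2,3)])
  let ?D = "\<lambda>\<omega>. Z \<omega> - Y \<omega>"
  have D: "?D \<in> L2 M" using assms(2,3) by (rule L2_diff)
  have "(\<integral>\<omega>. Z \<omega> * ?D \<omega> \<partial>M) = (\<integral>\<omega>. Y \<omega> * ?D \<omega> \<partial>M)"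
    using L2_tendsto_inner[OF assms(1,2) D assms(4)] L2_tendsto_inner[OF assms(1,3) D assms(5)]
    by (rule LIMSEQ_unique)
  then have "(\<integral>\<omega>. Z \<omega> * ?D \<omega> - Y \<omega> * ?D \<omega> \<partial>M) = 0"
    using L2_mult_integrable[OF assms(2) D] L2_mult_integrable[OF assms(3) D] by simp
  then show "(\<integral>\<omega>. (Z \<omega> - Y \<omega>)\<^sup>2 \<partial>M) = 0"
    by (simp add: power2_eq_square left_diff_distrib)
qed

section \<open>Uniqueness from characteristic functions\<close>

lemma integrable_bounded_mult:
  fixes f g :: "'a \<Rightarrow> real"
  assumes "integrable M f" "g \<in> borel_measurable M" "\<And>\<omega>. \<bar>g \<omega>\<bar> \<le> c"
  shows "integrable M (\<lambda>\<omega>. g \<omega> * f \<omega>)"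
proof (rule Bochner_Integration.integrable_bound)
  show "integrable M (\<lambda>\<omega>. c * f \<omega>)" "(\<lambda>\<omega>. g \<omega> * f \<omega>) \<in> borel_measurable M"
    using assms by auto
  show "AE \<omega> in M. norm (g \<omega> * f \<omega>) \<le> norm (c * f \<omega>)"
  proof (rule AE_I2)
    fix \<omega>
    have "\<bar>g \<omega>\<bar> \<le> \<bar>c\<bar>" using assms(3)[of \<omega>] by linarith
    then show "norm (g \<omega> * f \<omega>) \<le> norm (c * f \<omega>)" by (simp add: abs_mult mult_right_mono)
  qed
qed

text \<open>
  The positive and the negative part of \<open>v\<close>, as densities, give \<open>X\<close> the same characteristic function.
\<close>

lemma (in prob_space) indicator_integral_eq_0_of_char:
  fixes X v :: "'a \<Rightarrow> real"
  assumes X[measurable]: "X \<in> borel_measurable M" and v: "integrable M v"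
    and c: "\<And>s. (\<integral>\<omega>. cos (s * X \<omega>) * v \<omega> \<partial>M) = 0"
    and s: "\<And>s. (\<integral>\<omega>. sin (s * X \<omega>) * v \<omega> \<partial>M) = 0"
    and B[measurable]: "B \<in> sets borel"
  shows "(\<integral>\<omega>. indicator B (X \<omega>) * v \<omega> \<partial>M) = 0"
proof -
  have [measurable]: "v \<in> borel_measurable M" using v by auto
  define p n where "p \<omega> = max 0 (v \<omega>)" and "n \<omega> = max 0 (- v \<omega>)" for \<omega>
  have pn: "v \<omega> = p \<omega> - n \<omega>" "p \<omega> \<ge> 0" "n \<omega> \<ge> 0" for \<omega> by (auto simp: p_def n_def)
  have ip: "integrable M p" and in': "integrable M n" unfolding p_def n_def using v by auto
  have [measurable]: "p \<in> borel_measurable M" "n \<in> borel_measurable M" using ip in' by auto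
  define m where "m = (\<integral>\<omega>. p \<omega> \<partial>M)"
  \<comment> \<open>Frequency 0 shows that the two parts have the same mass \<open>m\<close>, so one
    constant normalises both to probability densities.\<close>
  have "(\<integral>\<omega>. v \<omega> \<partial>M) = 0" using c[of 0] by simp
  then have mn: "m = (\<integral>\<omega>. n \<omega> \<partial>M)" using ip in' by (simp add: pn(1) m_def)
  have m0: "m \<ge> 0" unfolding m_def by (simp add: pn)
  show ?thesis
  proof (cases "m = 0")
    \<comment> \<open>With zero mass there is nothing to normalise, but then \<open>v\<close>
      vanishes almost everywhere.\<close>
    case True
    have "AE \<omega> in M. p \<omega> = 0"
      using True m_def integral_nonneg_eq_0_iff_AE[OF ip] by (simp add: pn)
    moreover have "AE \<omega> in M. n \<omega> = 0"
      using True mn integral_nonneg_eq_0_iff_AE[OF in'] by (simp add: pn)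
    ultimately have "AE \<omega> in M. indicator B (X \<omega>) * v \<omega> = 0"
      by eventually_elim (simp add: pn(1))
    then show ?thesis by (rule integral_eq_zero_AE)
  next
    case False
    with m0 have "m > 0" by simp
    define D where "D f = distr (density M (\<lambda>\<omega>. ennreal (f \<omega> / m))) borel X" for f
    have D: "real_distribution (D f)" "char (D f) t = (\<integral>\<omega>. (f \<omega> / m) *\<^sub>R iexp (t * X \<omega>) \<partial>M)"
        "measure (D f) B = (\<integral>\<omega>. (f \<omega> / m) * indicator B (X \<omega>) \<partial>M)"
      if f: "integrable M f" "\<And>\<omega>. f \<omega> \<ge> 0" "(\<integral>\<omega>. f \<omega> \<partial>M) = m" for f :: "'a \<Rightarrow> real" and t
    proof -
      have [measurable]: "f \<in> borel_measurable M" using f by auto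
      have "(\<integral>\<^sup>+\<omega>. ennreal (f \<omega> / m) \<partial>M) = 1"
        using f \<open>m > 0\<close> by (subst nn_integral_eq_integral) auto
      then interpret d: prob_space "density M (\<lambda>\<omega>. ennreal (f \<omega> / m))"
        by (intro prob_spaceI) (simp add: emeasure_density cong: nn_integral_cong)
      show rd: "real_distribution (D f)" unfolding D_def by (rule d.real_distribution_distr) simp
      show "char (D f) t = (\<integral>\<omega>. (f \<omega> / m) *\<^sub>R iexp (t * X \<omega>) \<partial>M)"
        unfolding char_def D_def using f \<open>m > 0\<close>
        by (subst integral_distr, simp, simp, subst integral_density) auto
      have "measure (D f) B = (\<integral>x. indicator B x \<partial>(D f))" by (simp add: D_def)
      also have "\<dots> = (\<integral>\<omega>. (f \<omega> / m) * indicator B (X \<omega>) \<partial>M)"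
        unfolding D_def using f \<open>m > 0\<close>
        by (subst integral_distr, simp, simp, subst integral_density) auto
      finally show "measure (D f) B = (\<integral>\<omega>. (f \<omega> / m) * indicator B (X \<omega>) \<partial>M)" .
    qed
    have bi: "integrable M (\<lambda>\<omega>. g \<omega> * f \<omega>)"
      if "integrable M f" "g \<in> borel_measurable M" "\<And>\<omega>. \<bar>g \<omega>\<bar> \<le> 1" for f g :: "'a \<Rightarrow> real"
      by (rule Bochner_Integration.integrable_bound[OF that(1)])
        (use that in \<open>auto simp: abs_mult intro!: AE_I2 mult_left_le_one_le\<close>)
    have split: "(\<integral>\<omega>. (f \<omega> / m) *\<^sub>R iexp (t * X \<omega>) \<partial>M) =
        of_real ((\<integral>\<omega>. cos (t * X \<omega>) * f \<omega> \<partial>M) / m) + \<i> * of_real ((\<integral>\<omega>. sin (t * X \<omega>) * f \<omega> \<partial>M) / m)"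
      if f: "integrable M f" for f t
    proof -
      have "(\<lambda>\<omega>. (f \<omega> / m) *\<^sub>R iexp (t * X \<omega>)) =
         (\<lambda>\<omega>. of_real (cos (t * X \<omega>) * f \<omega> / m) + \<i> * of_real (sin (t * X \<omega>) * f \<omega> / m))"
        by (auto simp: complex_eq_iff Re_exp Im_exp)
      moreover have "integrable M (\<lambda>\<omega>. cos (t * X \<omega>) * f \<omega> / m)" "integrable M (\<lambda>\<omega>. sin (t * X \<omega>) * f \<omega> / m)"
        using bi[OF f, of "\<lambda>\<omega>. cos (t * X \<omega>)"] bi[OF f, of "\<lambda>\<omega>. sin (t * X \<omega>)"] by auto
      ultimately show ?thesis by (simp add: complex_of_real_integrable_eq del: of_real_mult of_real_divide)
    qed
    have "char (D p) t = char (D n) t" for t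
    proof -
      have "(\<integral>\<omega>. cos (t * X \<omega>) * p \<omega> \<partial>M) = (\<integral>\<omega>. cos (t * X \<omega>) * n \<omega> \<partial>M)"
        using c[of t] bi[OF ip, of "\<lambda>\<omega>. cos (t * X \<omega>)"] bi[OF in', of "\<lambda>\<omega>. cos (t * X \<omega>)"]
        by (simp add: pn(1) right_diff_distrib)
      moreover have "(\<integral>\<omega>. sin (t * X \<omega>) * p \<omega> \<partial>M) = (\<integral>\<omega>. sin (t * X \<omega>) * n \<omega> \<partial>M)"
        using s[of t] bi[OF ip, of "\<lambda>\<omega>. sin (t * X \<omega>)"] bi[OF in', of "\<lambda>\<omega>. sin (t * X \<omega>)"]
        by (simp add: pn(1) right_diff_distrib)
      ultimately show ?thesis
        using D(2)[OF ip pn(2)] D(2)[OF in' pn(3)] split[OF ip] split[OF in'] mn m_def by simp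
    qed
    then have "D p = D n"
      using D(1)[OF ip pn(2)] D(1)[OF in' pn(3)] mn m_def by (intro Levy_uniqueness) auto
    then have "measure (D p) B = measure (D n) B" by simp
    then have "(\<integral>\<omega>. (p \<omega> / m) * indicator B (X \<omega>) \<partial>M) = (\<integral>\<omega>. (n \<omega> / m) * indicator B (X \<omega>) \<partial>M)"
      unfolding D(3)[OF ip pn(2) m_def[symmetric]] D(3)[OF in' pn(3) mn[symmetric]] .
    then have "(\<integral>\<omega>. indicator B (X \<omega>) * p \<omega> \<partial>M) = (\<integral>\<omega>. indicator B (X \<omega>) * n \<omega> \<partial>M)"
      using \<open>m > 0\<close> by (simp add: mult.commute)
    then show ?thesis
      using bi[OF ip, of "\<lambda>\<omega>. indicator B (X \<omega>)"] bi[OF in', of "\<lambda>\<omega>. indicator B (X \<omega>)"]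
      by (simp add: pn(1) right_diff_distrib indicator_le_1)
  qed
qed

text \<open>One oscillating factor at a time is exchanged for an indicator, which is then absorbed
  into the weight; hence the induction over arbitrary \<open>v\<close>. Product-to-sum formulas
  express \<open>cos (s * X t)\<close> or \<open>sin (s * X t)\<close> times a trigonometric
  function of the remaining sum through \<open>cos\<close> and \<open>sin\<close> of sums and
  differences, where the hypotheses apply. The one-variable lemma then handles \<open>X t\<close>,
  and the new weight \<open>indicator (B t) (X t) * v\<close> meets the induction
  hypothesis.\<close>

lemma (in prob_space) prod_indicator_integral_eq_0_of_char:
  fixes X :: "'t \<Rightarrow> 'a \<Rightarrow> real" and v :: "'a \<Rightarrow> real"
  assumes "finite J" "\<And>t. t \<in> J \<Longrightarrow> X t \<in> borel_measurable M" "integrable M v"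
    and "\<And>c. (\<integral>\<omega>. cos (\<Sum>t\<in>J. c t * X t \<omega>) * v \<omega> \<partial>M) = 0"
    and "\<And>c. (\<integral>\<omega>. sin (\<Sum>t\<in>J. c t * X t \<omega>) * v \<omega> \<partial>M) = 0"
    and "\<And>t. t \<in> J \<Longrightarrow> B t \<in> sets borel"
  shows "(\<integral>\<omega>. (\<Prod>t\<in>J. indicator (B t) (X t \<omega>)) * v \<omega> \<partial>M) = 0"
  using assms
proof (induction J arbitrary: v)
  case empty
  then show ?case by simp
next
  case (insert t J)
  have [measurable]: "X t \<in> borel_measurable M" "B t \<in> sets borel" using insert.prems by auto
  have mJ: "(\<lambda>\<omega>. \<Sum>t\<in>J. c t * X t \<omega>) \<in> borel_measurable M" for c
    using insert.prems(1) by (intro borel_measurable_sum) auto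
  note [measurable] = mJ
  have upd: "(\<Sum>r\<in>insert t J. (d(t := s)) r * X r \<omega>) = s * X t \<omega> + (\<Sum>r\<in>J. d r * X r \<omega>)" for d s \<omega>
    using insert.hyps by (simp, intro sum.cong) auto
  have C: "(\<integral>\<omega>. cos (s * X t \<omega> + (\<Sum>r\<in>J. c r * X r \<omega>)) * v \<omega> \<partial>M) = 0"
      "(\<integral>\<omega>. cos (s * X t \<omega> - (\<Sum>r\<in>J. c r * X r \<omega>)) * v \<omega> \<partial>M) = 0"
      "(\<integral>\<omega>. sin (s * X t \<omega> + (\<Sum>r\<in>J. c r * X r \<omega>)) * v \<omega> \<partial>M) = 0"
      "(\<integral>\<omega>. sin (s * X t \<omega> - (\<Sum>r\<in>J. c r * X r \<omega>)) * v \<omega> \<partial>M) = 0" for s c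
    using insert.prems(3)[of "c(t := s)"] insert.prems(3)[of "(\<lambda>r. - c r)(t := s)"]
      insert.prems(4)[of "c(t := s)"] insert.prems(4)[of "(\<lambda>r. - c r)(t := s)"]
    unfolding upd by (simp_all add: sum_negf)
  have I: "integrable M (\<lambda>\<omega>. cos (g \<omega>) * v \<omega>)" "integrable M (\<lambda>\<omega>. sin (g \<omega>) * v \<omega>)"
    if "g \<in> borel_measurable M" for g
    using that by (auto intro!: integrable_bounded_mult[OF insert.prems(2), where c = 1])
  have v': "integrable M (\<lambda>\<omega>. indicator (B t) (X t \<omega>) * v \<omega>)"
    by (rule integrable_bounded_mult[OF insert.prems(2), where c = 1]) (auto simp: indicator_le_1)
  have one: "(\<integral>\<omega>. indicator (B t) (X t \<omega>) * (cos (\<Sum>r\<in>J. c r * X r \<omega>) * v \<omega>) \<partial>M) = 0"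
    "(\<integral>\<omega>. indicator (B t) (X t \<omega>) * (sin (\<Sum>r\<in>J. c r * X r \<omega>) * v \<omega>) \<partial>M) = 0" for c
  proof -
    let ?S = "\<lambda>\<omega>. \<Sum>r\<in>J. c r * X r \<omega>"
    have trig: "cos x * (cos y * w) = (cos (x + y) * w + cos (x - y) * w) / 2"
      "sin x * (cos y * w) = (sin (x + y) * w + sin (x - y) * w) / 2"
      "cos x * (sin y * w) = (sin (x + y) * w - sin (x - y) * w) / 2"
      "sin x * (sin y * w) = (cos (x - y) * w - cos (x + y) * w) / 2" for x y w :: real
      by (simp_all add: cos_add cos_diff sin_add sin_diff algebra_simps)
    have cc: "cos (s * X t \<omega>) * (cos (?S \<omega>) * v \<omega>) =
        (cos (s * X t \<omega> + ?S \<omega>) * v \<omega> + cos (s * X t \<omega> - ?S \<omega>) * v \<omega>) / 2"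
      and sc: "sin (s * X t \<omega>) * (cos (?S \<omega>) * v \<omega>) =
        (sin (s * X t \<omega> + ?S \<omega>) * v \<omega> + sin (s * X t \<omega> - ?S \<omega>) * v \<omega>) / 2"
      and cs: "cos (s * X t \<omega>) * (sin (?S \<omega>) * v \<omega>) =
        (sin (s * X t \<omega> + ?S \<omega>) * v \<omega> - sin (s * X t \<omega> - ?S \<omega>) * v \<omega>) / 2"
      and ss: "sin (s * X t \<omega>) * (sin (?S \<omega>) * v \<omega>) =
        (cos (s * X t \<omega> - ?S \<omega>) * v \<omega> - cos (s * X t \<omega> + ?S \<omega>) * v \<omega>) / 2" for s \<omega>
      by (rule trig)+
    show "(\<integral>\<omega>. indicator (B t) (X t \<omega>) * (cos (?S \<omega>) * v \<omega>) \<partial>M) = 0"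
      by (rule indicator_integral_eq_0_of_char, simp, intro I, simp)
        (unfold cc sc, simp_all add: C I)
    show "(\<integral>\<omega>. indicator (B t) (X t \<omega>) * (sin (?S \<omega>) * v \<omega>) \<partial>M) = 0"
      by (rule indicator_integral_eq_0_of_char, simp, intro I, simp)
        (unfold cs ss, simp_all add: C I)
  qed
  have "(\<integral>\<omega>. (\<Prod>t\<in>J. indicator (B t) (X t \<omega>)) * (indicator (B t) (X t \<omega>) * v \<omega>) \<partial>M) = 0"
    using one insert.prems(1,5) by (intro insert.IH v') (auto simp: mult.left_commute)
  then show ?case using insert.hyps by (simp add: mult_ac)
qed

text \<open>Dynkin's argument. The generating sets constrain a single \<open>X t\<close> and are not
  closed under intersection, so the \<pi>-system consists of the finite-dimensional cylinders, for
  which the product formula gives zero.\<close>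

lemma (in prob_space) set_integral_eq_0_of_char:
  fixes X :: "'t \<Rightarrow> 'a \<Rightarrow> real" and v :: "'a \<Rightarrow> real"
  assumes X: "\<And>t. t \<in> K \<Longrightarrow> X t \<in> borel_measurable M" and v: "integrable M v"
    and c: "\<And>J c. finite J \<Longrightarrow> J \<subseteq> K \<Longrightarrow> (\<integral>\<omega>. cos (\<Sum>t\<in>J. c t * X t \<omega>) * v \<omega> \<partial>M) = 0"
    and s: "\<And>J c. finite J \<Longrightarrow> J \<subseteq> K \<Longrightarrow> (\<integral>\<omega>. sin (\<Sum>t\<in>J. c t * X t \<omega>) * v \<omega> \<partial>M) = 0"
    and A: "A \<in> sigma_sets (space M) {X t -` B \<inter> space M | t B. t \<in> K \<and> B \<in> sets borel}"
  shows "(LINT \<omega>:A|M. v \<omega>) = 0"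
proof -
  let ?gen = "{X t -` B \<inter> space M | t B. t \<in> K \<and> B \<in> sets borel}"
  define cyl where "cyl J B = {\<omega> \<in> space M. \<forall>t\<in>J. X t \<omega> \<in> B t}" for J and B :: "'t \<Rightarrow> real set"
  define G where "G = {cyl J B | J B. finite J \<and> J \<subseteq> K \<and> (\<forall>t\<in>J. B t \<in> sets borel)}"
  have G_E: "\<exists>J B. A = cyl J B \<and> finite J \<and> J \<subseteq> K \<and> (\<forall>t\<in>J. B t \<in> sets borel)" if "A \<in> G" for A
    using that by (simp add: G_def)
  have G_sets: "G \<subseteq> sets M"
  proof
    fix A assume "A \<in> G"
    then obtain J B where JB: "A = cyl J B" "finite J" "J \<subseteq> K" "\<forall>t\<in>J. B t \<in> sets borel"
      using G_E by blast
    have "{\<omega> \<in> space M. X t \<omega> \<in> B t} \<in> sets M" if "t \<in> J" for t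
    proof -
      have "X t -` B t \<inter> space M \<in> sets M" using JB(3,4) that by (intro measurable_sets[OF X]) auto
      moreover have "X t -` B t \<inter> space M = {\<omega> \<in> space M. X t \<omega> \<in> B t}" by auto
      ultimately show ?thesis by simp
    qed
    then show "A \<in> sets M" unfolding JB(1) cyl_def using JB(2) by (rule sets.sets_Collect_finite_All)
  qed
  then have G_Pow: "G \<subseteq> Pow (space M)" using sets.sets_into_space by blast
  have sub: "sigma_sets (space M) G \<subseteq> sets M"
    using G_sets by (rule sets.sigma_sets_subset)
  have "?gen \<subseteq> G"
  proof
    fix A assume "A \<in> ?gen"
    then obtain t B where "A = X t -` B \<inter> space M" "t \<in> K" "B \<in> sets borel" by auto
    then have "A = cyl {t} (\<lambda>_. B)" "finite {t}" "{t} \<subseteq> K" "\<forall>t\<in>{t}. B \<in> sets borel"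
      by (auto simp: cyl_def)
    then show "A \<in> G" unfolding G_def by blast
  qed
  then have A': "A \<in> sigma_sets (space M) G"
    using A sigma_sets_mono'[of ?gen G] by blast
  have "Int_stable G"
  proof (rule Int_stableI)
    fix a b assume "a \<in> G" "b \<in> G"
    then obtain J B J' B' where *: "a = cyl J B" "finite J" "J \<subseteq> K" "\<forall>t\<in>J. B t \<in> sets borel"
      "b = cyl J' B'" "finite J'" "J' \<subseteq> K" "\<forall>t\<in>J'. B' t \<in> sets borel"
      using G_E[OF \<open>a \<in> G\<close>] G_E[OF \<open>b \<in> G\<close>] by blast
    \<comment> \<open>A constraint absent from one of the cylinders is padded with
      \<open>UNIV\<close>, so that both live over the common index set.\<close>
    let ?C = "\<lambda>t. (if t \<in> J then B t else UNIV) \<inter> (if t \<in> J' then B' t else UNIV)"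
    have "a \<inter> b = cyl (J \<union> J') ?C" using * by (auto simp: cyl_def)
    moreover have "finite (J \<union> J')" "J \<union> J' \<subseteq> K" "\<forall>t\<in>J \<union> J'. ?C t \<in> sets borel" using * by auto
    ultimately show "a \<inter> b \<in> G" unfolding G_def by blast
  qed
  have si: "set_integrable M C v" if "C \<in> sets M" for C
    unfolding set_integrable_def by (rule integrable_mult_indicator[OF that v])
  \<comment> \<open>The empty sum has cosine 1; this total integral is what closure under
    complements requires.\<close>
  have v0: "(LINT \<omega>|M. v \<omega>) = 0" using c[of "{}"] by simp
  show ?thesis
    using \<open>Int_stable G\<close> G_Pow A'
  proof (induction rule: sigma_sets_induct_disjoint)
    case (basic A)
    then obtain J B where JB: "A = cyl J B" "finite J" "J \<subseteq> K" "\<forall>t\<in>J. B t \<in> sets borel"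
      using G_E by blast
    have "(LINT \<omega>:A|M. v \<omega>) = (\<integral>\<omega>. (\<Prod>t\<in>J. indicator (B t) (X t \<omega>)) * v \<omega> \<partial>M)"
      unfolding set_lebesgue_integral_def using JB(2)
      by (intro Bochner_Integration.integral_cong)
        (auto simp: JB(1) cyl_def indicator_def prod.If_cases)
    also have "\<dots> = 0"
      using JB X v c s by (intro prod_indicator_integral_eq_0_of_char) (auto simp: subset_eq)
    finally show ?case .
  next
    case (compl A)
    then have "A \<in> sets M" using sub by blast
    then have "(LINT \<omega>:(space M - A) \<union> A|M. v \<omega>) = (LINT \<omega>:space M - A|M. v \<omega>) + (LINT \<omega>:A|M. v \<omega>)"
      by (intro set_integral_Un si) auto
    moreover have "(space M - A) \<union> A = space M" using sets.sets_into_space[OF \<open>A \<in> sets M\<close>] by auto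
    ultimately show ?case using compl v0 set_integral_space[OF v] by simp
  next
    case (union A)
    then have r: "A i \<in> sets M" for i using sub by blast
    then have "(LINT \<omega>:(\<Union>i. A i)|M. v \<omega>) = (\<Sum>i. (LINT \<omega>:(A i)|M. v \<omega>))"
      using union.hyps by (intro lebesgue_integral_countable_add si) (auto simp: disjoint_family_on_def)
    then show ?case using union by simp
  qed (simp add: set_lebesgue_integral_def)
qed

section \<open>Variations of a finite signed measure\<close>

text \<open>Truncation at 0 is monotone, and converting back by \<open>enn2ereal\<close> dominates
  the original value, so it commutes with suprema. This carries the extended-real supremum in
  \<open>pos_variation\<close> over to \<open>ennreal\<close>.\<close>

lemma e2ennreal_SUP:
  assumes "S \<noteq> {}"
  shows "e2ennreal (SUP B\<in>S. f B) = (SUP B\<in>S. e2ennreal (f B))"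
proof (rule antisym)
  have "f B \<le> enn2ereal (SUP B\<in>S. e2ennreal (f B))" if "B \<in> S" for B
  proof -
    have "f B \<le> enn2ereal (e2ennreal (f B))"
      by (metis e2ennreal_neg enn2ereal_e2ennreal enn2ereal_nonneg linear order.trans)
    also have "\<dots> \<le> enn2ereal (SUP B\<in>S. e2ennreal (f B))"
      using SUP_upper[OF that, of "\<lambda>B. e2ennreal (f B)"] by (simp add: less_eq_ennreal.rep_eq)
    finally show ?thesis .
  qed
  then have "(SUP B\<in>S. f B) \<le> enn2ereal (SUP B\<in>S. e2ennreal (f B))" by (rule SUP_least)
  from e2ennreal_mono[OF this] show "e2ennreal (SUP B\<in>S. f B) \<le> (SUP B\<in>S. e2ennreal (f B))"
    by simp
  show "(SUP B\<in>S. e2ennreal (f B)) \<le> e2ennreal (SUP B\<in>S. f B)"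
    by (intro SUP_least e2ennreal_mono SUP_upper)
qed

text \<open>A finite-valued signed measure, where subtraction and series are those of the reals. It
  is used for both \<open>m\<close> and \<open>- m\<close>, which yields the positive and the
  negative variation from one construction.\<close>

locale real_charge =
  fixes M :: "'a measure" and m :: "'a set \<Rightarrow> real"
  assumes charge_sums: "\<And>A. range A \<subseteq> sets M \<Longrightarrow> disjoint_family A \<Longrightarrow> (\<lambda>i::nat. m (A i)) sums m (\<Union>i. A i)"
begin

lemma charge_empty: "m {} = 0"
proof -
  have "(\<lambda>i::nat. m {}) sums m {}" using charge_sums[of "\<lambda>_. {}"] by (simp add: disjoint_family_on_def)
  then show ?thesis using summable_const_iff sums_summable by blast
qed

lemma charge_Un:
  assumes "A \<in> sets M" "B \<in> sets M" "A \<inter> B = {}"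
  shows "m (A \<union> B) = m A + m B"
proof -
  have "(\<lambda>i. m (binaryset A B i)) sums m (\<Union>i. binaryset A B i)"
    using assms by (intro charge_sums) (auto simp: range_binaryset_eq disjoint_family_on_def binaryset_def)
  moreover have "(\<lambda>i. m (binaryset A B i)) sums (m A + m B)"
    by (rule binaryset_sums) (rule charge_empty)
  ultimately show ?thesis by (simp add: UN_binaryset_eq sums_iff)
qed

text \<open>The positive variation of the charge. Coercion by \<open>ennreal\<close> replaces
  negative values by 0, which leaves the supremum intact because \<open>{}\<close> is among the
  competitors.\<close>

definition upper :: "'a set \<Rightarrow> ennreal" where
  "upper A = (SUP B\<in>{B \<in> sets M. B \<subseteq> A}. ennreal (m B))"

lemma le_upper: "B \<in> sets M \<Longrightarrow> B \<subseteq> A \<Longrightarrow> ennreal (m B) \<le> upper A"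
  unfolding upper_def by (intro SUP_upper) auto

lemma upper_mono: "A \<subseteq> A' \<Longrightarrow> upper A \<le> upper A'"
  unfolding upper_def by (intro SUP_subset_mono) auto

lemma upper_empty: "upper {} = 0"
proof -
  have "{B \<in> sets M. B \<subseteq> {}} = {{}}" by auto
  then show ?thesis unfolding upper_def by (simp add: charge_empty)
qed

text \<open>Competitors \<open>B\<close> for \<open>X\<close> and \<open>C\<close> for
  \<open>Y\<close> merge to the competitor \<open>B \<union> C\<close> for the union; one with
  negative charge contributes 0 after coercion and is simply dropped.\<close>

lemma upper_add_le:
  assumes "X \<inter> Y = {}"
  shows "upper X + upper Y \<le> upper (X \<union> Y)"
proof -
  have main: "ennreal (m B) + ennreal (m C) \<le> upper (X \<union> Y)"
    if "B \<in> sets M" "B \<subseteq> X" "C \<in> sets M" "C \<subseteq> Y" for B C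
  proof -
    consider "m B < 0" | "m C < 0" | "m B \<ge> 0" "m C \<ge> 0" by linarith
    then show ?thesis
    proof cases
      case 1
      then show ?thesis using le_upper[of C "X \<union> Y"] that by (auto simp: ennreal_neg)
    next
      case 2
      then show ?thesis using le_upper[of B "X \<union> Y"] that by (auto simp: ennreal_neg)
    next
      case 3
      have "m (B \<union> C) = m B + m C" using that assms by (intro charge_Un) auto
      then show ?thesis using le_upper[of "B \<union> C" "X \<union> Y"] that 3
        by (auto simp: ennreal_plus[symmetric] simp del: ennreal_plus)
    qed
  qed
  have ne: "{B \<in> sets M. B \<subseteq> X} \<noteq> {}" "{B \<in> sets M. B \<subseteq> Y} \<noteq> {}" by auto
  have "ennreal (m B) + upper Y \<le> upper (X \<union> Y)" if "B \<in> sets M" "B \<subseteq> X" for B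
    unfolding upper_def[of Y] ennreal_SUP_add_right[OF ne(2)] using main that by (intro SUP_least) auto
  then show ?thesis
    unfolding upper_def[of X] ennreal_SUP_add_left[OF ne(1), symmetric] by (intro SUP_least) auto
qed

text \<open>Superadditivity on finite unions gives one inequality. For the other, a competitor
  \<open>B\<close> for the union is cut into the pieces \<open>B \<inter> A i\<close>, each of which
  competes for \<open>A i\<close>.\<close>

lemma upper_countably_additive: "countably_additive (sets M) upper"
  unfolding countably_additive_def
proof safe
  fix A :: "nat \<Rightarrow> 'a set"
  assume A: "range A \<subseteq> sets M" "disjoint_family A" "(\<Union>i. A i) \<in> sets M"
  show "(\<Sum>i. upper (A i)) = upper (\<Union>i. A i)"
  proof (rule antisym)
    have "(\<Sum>i<N. upper (A i)) \<le> upper (\<Union>i<N. A i)" for N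
    proof (induction N)
      case (Suc N)
      have "(\<Sum>i<Suc N. upper (A i)) \<le> upper (\<Union>i<N. A i) + upper (A N)"
        using Suc by (simp add: add_right_mono)
      also have "\<dots> \<le> upper ((\<Union>i<N. A i) \<union> A N)"
      proof (rule upper_add_le)
        have "A i \<inter> A N = {}" if "i < N" for i
          using A(2) that unfolding disjoint_family_on_def by (metis UNIV_I less_irrefl)
        then show "(\<Union>i<N. A i) \<inter> A N = {}" by blast
      qed
      also have "(\<Union>i<N. A i) \<union> A N = (\<Union>i<Suc N. A i)" by (auto simp: less_Suc_eq)
      finally show ?case .
    qed (simp add: upper_empty)
    also have "upper (\<Union>i<N. A i) \<le> upper (\<Union>i. A i)" for N by (intro upper_mono) auto
    finally have "(\<Sum>i<N. upper (A i)) \<le> upper (\<Union>i. A i)" for N .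
    then show "(\<Sum>i. upper (A i)) \<le> upper (\<Union>i. A i)"
      by (simp add: suminf_eq_SUP SUP_least)
    show "upper (\<Union>i. A i) \<le> (\<Sum>i. upper (A i))"
      unfolding upper_def[of "\<Union>i. A i"]
    proof (rule SUP_least)
      fix B assume "B \<in> {B \<in> sets M. B \<subseteq> (\<Union>i. A i)}"
      then have B: "B \<in> sets M" "B = (\<Union>i. B \<inter> A i)" by auto
      have "(\<lambda>i. m (B \<inter> A i)) sums m (\<Union>i. B \<inter> A i)"
        using A B(1) by (intro charge_sums) (auto simp: disjoint_family_on_def)
      then have "(\<lambda>N. \<Sum>i<N. m (B \<inter> A i)) \<longlonglongrightarrow> m B"
        using B(2) by (simp add: sums_def)
      then have "(\<lambda>N. ennreal (\<Sum>i<N. m (B \<inter> A i))) \<longlonglongrightarrow> ennreal (m B)"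
        by (rule tendsto_ennrealI)
      moreover have "ennreal (\<Sum>i<N. m (B \<inter> A i)) \<le> (\<Sum>i. upper (A i))" for N
      proof -
        \<comment> \<open>Pieces may have negative charge, and \<open>ennreal\<close> is additive
          only on nonnegative reals, so the sum is first enlarged to the sum of positive
          parts.\<close>
        have "ennreal (\<Sum>i<N. m (B \<inter> A i)) \<le> ennreal (\<Sum>i<N. max 0 (m (B \<inter> A i)))"
          by (intro ennreal_leI sum_mono) auto
        also have "\<dots> = (\<Sum>i<N. ennreal (max 0 (m (B \<inter> A i))))"
          by (rule sum_ennreal[symmetric]) simp
        also have "\<dots> = (\<Sum>i<N. ennreal (m (B \<inter> A i)))"
          by (intro sum.cong) (auto simp: max_def ennreal_neg)
        also have "\<dots> \<le> (\<Sum>i<N. upper (A i))"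
          using A B by (intro sum_mono le_upper) auto
        also have "\<dots> \<le> (\<Sum>i. upper (A i))" by (rule sum_le_suminf) auto
        finally show ?thesis .
      qed
      ultimately show "ennreal (m B) \<le> (\<Sum>i. upper (A i))"
        by (intro LIMSEQ_le_const2) auto
    qed
  qed
qed

text \<open>
  Subsets of the \<open>A i\<close> that carry at least half of \<open>upper (A i)\<close> have a union of finite charge.
\<close>

lemma upper_finite:
  assumes A: "range A \<subseteq> sets M" "disjoint_family A" "(\<Union>i. A i) = space M"
    and fin: "\<And>i::nat. upper (A i) < \<infinity>"
  shows "upper (space M) < \<infinity>"
proof -
  have "\<exists>B\<in>sets M. B \<subseteq> A i \<and> m B \<ge> 0 \<and> upper (A i) \<le> 2 * ennreal (m B)" for i
  proof (cases "upper (A i) = 0")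
    case True
    then show ?thesis by (intro bexI[of _ "{}"]) (auto simp: charge_empty)
  next
    case False
    \<comment> \<open>Since \<open>u\<close> is positive and finite, \<open>u / 2\<close> lies
      strictly below the supremum and some competitor exceeds it.\<close>
    then obtain u where u: "upper (A i) = ennreal u" "u > 0"
      using fin[of i] by (cases "upper (A i)") (auto simp: less_le)
    have "ennreal (u / 2) < ennreal u" using u by (intro ennreal_lessI) auto
    also have "ennreal u = (SUP B\<in>{B \<in> sets M. B \<subseteq> A i}. ennreal (m B))"
      by (simp only: u(1)[symmetric] upper_def)
    finally obtain B where B: "B \<in> sets M" "B \<subseteq> A i" "ennreal (u / 2) < ennreal (m B)"
      unfolding less_SUP_iff by auto
    then have "u / 2 < m B" using u by (simp add: ennreal_less_iff)
    then have "upper (A i) \<le> ennreal (2 * m B)" "m B > 0"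
      unfolding u(1) using u(2) by (auto intro: ennreal_leI)
    then have "upper (A i) \<le> 2 * ennreal (m B)" "m B \<ge> 0"
      by (auto simp: ennreal_mult)
    then show ?thesis using B by (intro bexI[of _ B]) auto
  qed
  then obtain B where B: "\<And>i. B i \<in> sets M" "\<And>i. B i \<subseteq> A i" "\<And>i. m (B i) \<ge> 0"
    "\<And>i. upper (A i) \<le> 2 * ennreal (m (B i))" by metis
  have "(\<lambda>i. m (B i)) sums m (\<Union>i. B i)"
  proof (rule charge_sums)
    show "range B \<subseteq> sets M" using B(1) by auto
    show "disjoint_family B"
      using A(2) B(2) unfolding disjoint_family_on_def by (metis Int_mono UNIV_I subset_empty)
  qed
  then have "(\<Sum>i. ennreal (m (B i))) = ennreal (m (\<Union>i. B i))"
    using B(3) by (intro suminf_ennreal_eq)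
  have "upper (space M) = (\<Sum>i. upper (A i))"
    using A upper_countably_additive by (simp add: countably_additive_def)
  also have "\<dots> \<le> (\<Sum>i. 2 * ennreal (m (B i)))" by (intro suminf_le B) auto
  also have "\<dots> = 2 * ennreal (m (\<Union>i. B i))"
    using \<open>(\<Sum>i. ennreal (m (B i))) = ennreal (m (\<Union>i. B i))\<close> by (simp add: ennreal_suminf_cmult)
  also have "\<dots> < \<infinity>" by (simp add: ennreal_mult_less_top)
  finally show ?thesis .
qed

end

section \<open>Variation measures and the Jordan decomposition\<close>

lemma emeasure_pos_variation:
  assumes "real_charge M m" and \<mu>: "\<And>A. A \<in> sets M \<Longrightarrow> \<mu> A = ereal (m A)" and A: "A \<in> sets M"
  shows "emeasure (pos_variation M \<mu>) A = real_charge.upper M m A"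
proof -
  interpret real_charge M m by fact
  have eq: "e2ennreal (SUP B\<in>{B \<in> sets M. B \<subseteq> A}. \<mu> B) = upper A" for A
  proof -
    have "{B \<in> sets M. B \<subseteq> A} \<noteq> {}" by auto
    moreover have "(SUP B\<in>{B \<in> sets M. B \<subseteq> A}. e2ennreal (\<mu> B)) = upper A"
      unfolding upper_def by (intro SUP_cong) (auto simp: \<mu>)
    ultimately show ?thesis by (simp add: e2ennreal_SUP)
  qed
  have "emeasure (measure_of (space M) (sets M) upper) A = upper A"
    by (rule emeasure_measure_of)
      (auto simp: A positive_def upper_empty sets.space_closed sets.sets_measure_of_eq
        intro: upper_countably_additive dest: sets.sets_into_space)
  then show ?thesis unfolding pos_variation_def eq .
qed

lemma sets_pos_variation [simp, measurable_cong]: "sets (pos_variation M \<mu>) = sets M"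
  unfolding pos_variation_def by simp

lemma sets_neg_variation [simp, measurable_cong]: "sets (neg_variation M \<mu>) = sets M"
  unfolding neg_variation_def by simp

lemma sets_total_variation [simp, measurable_cong]: "sets (total_variation M \<mu>) = sets M"
  unfolding total_variation_def by simp

lemma emeasure_total_variation:
  assumes "A \<in> sets M"
  shows "emeasure (total_variation M \<mu>) A =
    emeasure (pos_variation M \<mu>) A + emeasure (neg_variation M \<mu>) A"
proof (rule emeasure_measure_of[OF total_variation_def])
  show "countably_additive (sets (total_variation M \<mu>))
      (\<lambda>A. emeasure (pos_variation M \<mu>) A + emeasure (neg_variation M \<mu>) A)"
    unfolding countably_additive_def
  proof safe
    fix A :: "nat \<Rightarrow> 'a set"
    assume A: "range A \<subseteq> sets (total_variation M \<mu>)" "disjoint_family A"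
    then have "(\<Sum>i. emeasure (pos_variation M \<mu>) (A i)) = emeasure (pos_variation M \<mu>) (\<Union>i. A i)"
      "(\<Sum>i. emeasure (neg_variation M \<mu>) (A i)) = emeasure (neg_variation M \<mu>) (\<Union>i. A i)"
      by (auto intro!: suminf_emeasure)
    then show "(\<Sum>i. emeasure (pos_variation M \<mu>) (A i) + emeasure (neg_variation M \<mu>) (A i)) =
      emeasure (pos_variation M \<mu>) (\<Union>i. A i) + emeasure (neg_variation M \<mu>) (\<Union>i. A i)"
      by (subst suminf_add[symmetric]) auto
  qed
qed (use assms in \<open>auto simp: positive_def dest: sets.sets_into_space\<close>)

text \<open>Finiteness on the whole space makes \<mu> real-valued, and \<sigma>-finiteness cuts the
  space into pieces of finite variation, to which \<open>upper_finite\<close> applies. The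
  decomposition identity comes from complementation in \<open>A\<close>: since
  \<open>m A = m B + m (A - B)\<close>, the map \<open>B \<mapsto> A - B\<close> exchanges the
  suprema that define the two variations.\<close>

lemma finite_signed_measure_decomposition:
  assumes sm: "signed_measure M \<mu>" and fin: "\<bar>\<mu> (space M)\<bar> \<noteq> \<infinity>"
    and sf: "sigma_finite_measure (total_variation M \<mu>)"
  shows "finite_measure (pos_variation M \<mu>)" "finite_measure (neg_variation M \<mu>)"
    and "A \<in> sets M \<Longrightarrow> \<mu> A = ereal (measure (pos_variation M \<mu>) A - measure (neg_variation M \<mu>) A)"
proof -
  have sums: "(\<lambda>i::nat. \<mu> (A i)) sums \<mu> (\<Union>i. A i)" if "range A \<subseteq> sets M" "disjoint_family A" for A
    using sm that by (auto simp: signed_measure_def)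
  have add: "\<mu> (A \<union> B) = \<mu> A + \<mu> B" if "A \<in> sets M" "B \<in> sets M" "A \<inter> B = {}" for A B
  proof -
    have "(\<lambda>i. \<mu> (binaryset A B i)) sums \<mu> (\<Union>i. binaryset A B i)"
      using that by (intro sums) (auto simp: range_binaryset_eq disjoint_family_on_def binaryset_def)
    moreover have "(\<lambda>i. \<mu> (binaryset A B i)) sums (\<mu> A + \<mu> B)"
      using sm by (intro binaryset_sums) (simp add: signed_measure_def)
    ultimately show ?thesis by (simp add: UN_binaryset_eq sums_iff)
  qed
  define m where "m A = real_of_ereal (\<mu> A)" for A
  have m: "\<mu> A = ereal (m A)" if "A \<in> sets M" for A
  proof -
    have "\<mu> (space M) = \<mu> A + \<mu> (space M - A)"
      using that add[of A "space M - A"] sets.sets_into_space[OF that] by (simp add: Un_absorb1)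
    \<comment> \<open>An infinite summand makes a sum in \<open>ereal\<close> infinite, even with a
      summand of the opposite sign, so the finite total forces both terms to be finite.\<close>
    then have "\<bar>\<mu> A\<bar> \<noteq> \<infinity>"
      using fin by (cases "\<mu> A"; cases "\<mu> (space M - A)") auto
    then show ?thesis by (simp add: m_def ereal_real)
  qed
  interpret p: real_charge M m
  proof
    fix A :: "nat \<Rightarrow> 'a set" assume A: "range A \<subseteq> sets M" "disjoint_family A"
    then have "A i \<in> sets M" "(\<Union>i. A i) \<in> sets M" for i by auto
    then show "(\<lambda>i. m (A i)) sums m (\<Union>i. A i)"
      using sums[OF A] by (simp add: m sums_ereal)
  qed
  interpret n: real_charge M "\<lambda>A. - m A"
    by standard (intro sums_minus p.charge_sums)
  have pe: "emeasure (pos_variation M \<mu>) A = p.upper A" if "A \<in> sets M" for A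
    using emeasure_pos_variation[OF p.real_charge_axioms m that] by simp
  have ne: "emeasure (neg_variation M \<mu>) A = n.upper A" if "A \<in> sets M" for A
    unfolding neg_variation_def using m that
    by (intro emeasure_pos_variation n.real_charge_axioms) auto
  obtain S :: "nat \<Rightarrow> 'a set" where S: "range S \<subseteq> sets M" "(\<Union>i. S i) = space M"
      "\<And>i. emeasure (total_variation M \<mu>) (S i) \<noteq> \<infinity>" "disjoint_family S"
    using sigma_finite_measure.sigma_finite_disjoint[OF sf]
    by (metis sets_total_variation sets_eq_imp_space_eq)
  have S': "p.upper (S i) < \<infinity>" "n.upper (S i) < \<infinity>" for i
  proof -
    have "S i \<in> sets M" using S by auto
    then have "p.upper (S i) + n.upper (S i) < \<infinity>"
      using S(3)[of i] pe ne by (simp add: emeasure_total_variation less_top)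
    then show "p.upper (S i) < \<infinity>" "n.upper (S i) < \<infinity>" by auto
  qed
  have pf: "p.upper (space M) < \<infinity>" by (rule p.upper_finite[OF S(1,4,2) S'(1)])
  have nf: "n.upper (space M) < \<infinity>" by (rule n.upper_finite[OF S(1,4,2) S'(2)])
  have [simp]: "space (pos_variation M \<mu>) = space M" "space (neg_variation M \<mu>) = space M"
    by (rule sets_eq_imp_space_eq, simp)+
  show fp: "finite_measure (pos_variation M \<mu>)"
    by (rule finite_measureI) (use pf in \<open>simp add: pe less_top\<close>)
  show fn: "finite_measure (neg_variation M \<mu>)"
    by (rule finite_measureI) (use nf in \<open>simp add: ne less_top\<close>)
  assume A: "A \<in> sets M"
  let ?p = "measure (pos_variation M \<mu>)" and ?n = "measure (neg_variation M \<mu>)"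
  have P: "p.upper B = ennreal (?p B)" "n.upper B = ennreal (?n B)" if "B \<in> sets M" for B
    using pe[OF that] ne[OF that] finite_measure.emeasure_eq_measure[OF fp] finite_measure.emeasure_eq_measure[OF fn]
    by auto
  have le: "m B \<le> ?p A" "- m B \<le> ?n A" if "B \<in> sets M" "B \<subseteq> A" for B
    using p.le_upper[OF that] n.le_upper[OF that] by (auto simp: P[OF A] ennreal_le_iff)
  have diff: "m A = m B + m (A - B)" if "B \<in> sets M" "B \<subseteq> A" for B
    using p.charge_Un[of B "A - B"] that A by (simp add: Un_absorb1)
  \<comment> \<open>For every competitor, \<open>m B = m A - m (A - B)\<close>, and
    \<open>- m (A - B)\<close> is bounded by the negative variation of \<open>A\<close>.\<close>
  have "p.upper A \<le> ennreal (m A + ?n A)"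
    unfolding p.upper_def
  proof (rule SUP_least)
    fix B assume "B \<in> {B \<in> sets M. B \<subseteq> A}"
    then show "ennreal (m B) \<le> ennreal (m A + ?n A)"
      using le(2)[of "A - B"] diff[of B] A by (intro ennreal_leI) auto
  qed
  moreover have "m A + ?n A \<ge> 0" using le(2)[of A] A by simp
  ultimately have 1: "?p A \<le> m A + ?n A" by (simp add: P[OF A] ennreal_le_iff)
  have "n.upper A \<le> ennreal (?p A - m A)"
    unfolding n.upper_def
  proof (rule SUP_least)
    fix B assume "B \<in> {B \<in> sets M. B \<subseteq> A}"
    then show "ennreal (- m B) \<le> ennreal (?p A - m A)"
      using le(1)[of "A - B"] diff[of B] A by (intro ennreal_leI) auto
  qed
  moreover have "?p A - m A \<ge> 0" using le(1)[of A] A by simp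
  ultimately have 2: "?n A \<le> ?p A - m A" by (simp add: P[OF A] ennreal_le_iff)
  show "\<mu> A = ereal (?p A - ?n A)" using 1 2 m[OF A] by simp
qed

section \<open>Gaussian integration by parts in one variable\<close>

lemma normal_density_tendsto_0:
  assumes "\<sigma> > 0"
  shows "(normal_density 0 \<sigma> \<longlongrightarrow> 0) at_top" "(normal_density 0 \<sigma> \<longlongrightarrow> 0) at_bot"
proof -
  have "filterlim (\<lambda>x::real. (1 / (2 * \<sigma>\<^sup>2)) * x\<^sup>2) at_top at_top"
    using assms by (intro filterlim_tendsto_pos_mult_at_top[OF tendsto_const] filterlim_pow_at_top filterlim_ident) auto
  then have "filterlim (\<lambda>x::real. - ((1 / (2 * \<sigma>\<^sup>2)) * x\<^sup>2)) at_bot at_top"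
    by (simp add: filterlim_uminus_at_bot)
  then have "((\<lambda>x. exp (- ((1 / (2 * \<sigma>\<^sup>2)) * x\<^sup>2))) \<longlongrightarrow> 0) at_top"
    by (rule filterlim_compose[OF exp_at_bot])
  then have "((\<lambda>x. 1 / sqrt (2 * pi * \<sigma>\<^sup>2) * exp (- ((1 / (2 * \<sigma>\<^sup>2)) * x\<^sup>2))) \<longlongrightarrow> 0) at_top"
    by (rule tendsto_mult_right_zero)
  then show t: "(normal_density 0 \<sigma> \<longlongrightarrow> 0) at_top"
    by (simp add: normal_density_def[abs_def])
  have "(\<lambda>x. normal_density 0 \<sigma> (- x)) = normal_density 0 \<sigma>"
    by (simp add: normal_density_def fun_eq_iff)
  then show "(normal_density 0 \<sigma> \<longlongrightarrow> 0) at_bot"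
    using t by (simp add: filterlim_at_bot_mirror)
qed

text \<open>The normal density \<open>n\<close> satisfies
  \<open>n' = - x / \<sigma>\<^sup>2 * n\<close>, so the integrand is the derivative of
  \<open>- \<sigma>\<^sup>2 * g * n\<close>. Boundedness of \<open>g\<close> removes the boundary
  terms, and together with that of \<open>g'\<close> it gives integrability.\<close>

lemma normal_density_stein:
  fixes g g' :: "real \<Rightarrow> real"
  assumes \<sigma>: "\<sigma> > 0" and g: "\<And>x. (g has_real_derivative g' x) (at x)" and g': "continuous_on UNIV g'"
    and bg: "\<And>x. \<bar>g x\<bar> \<le> C" and bg': "\<And>x. \<bar>g' x\<bar> \<le> C'"
  shows "(\<integral>x. normal_density 0 \<sigma> x * (g x * x - \<sigma>\<^sup>2 * g' x) \<partial>lborel) = 0"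
proof -
  let ?n = "normal_density 0 \<sigma>"
  define F where "F x = - (\<sigma>\<^sup>2) * (g x * ?n x)" for x
  define f where "f x = ?n x * (g x * x - \<sigma>\<^sup>2 * g' x)" for x
  have n': "(?n has_real_derivative (- x / \<sigma>\<^sup>2 * ?n x)) (at x)" for x
    unfolding normal_density_def using \<sigma> by (auto intro!: derivative_eq_intros simp: field_simps power2_eq_square)
  have cg: "continuous_on UNIV g" using g by (meson DERIV_isCont continuous_at_imp_continuous_on)
  have cn: "continuous_on UNIV ?n" using n' by (meson DERIV_isCont continuous_at_imp_continuous_on)
  have [measurable]: "g \<in> borel_measurable borel" "g' \<in> borel_measurable borel"
    using cg g' by (auto intro: borel_measurable_continuous_onI)
  have F: "(F has_real_derivative f x) (at x)" for x
    unfolding F_def f_def using \<sigma>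
    by (auto intro!: derivative_eq_intros g n' simp: field_simps power2_eq_square)
  have "continuous_on UNIV f" unfolding f_def by (intro continuous_intros cg cn g')
  then have cf: "isCont f x" for x by (simp add: continuous_on_eq_continuous_at)
  have "integrable lborel (\<lambda>x. g x * (?n x * x) - g' x * (\<sigma>\<^sup>2 * ?n x))"
    using \<sigma> by (intro Bochner_Integration.integrable_diff integrable_bounded_mult[OF _ _ bg]
        integrable_bounded_mult[OF _ _ bg'] integrable_normal_moment_nz_1) auto
  moreover have "(\<lambda>x. g x * (?n x * x) - g' x * (\<sigma>\<^sup>2 * ?n x)) = f"
    by (auto simp: f_def algebra_simps)
  ultimately have int: "integrable lborel f" by simp
  have lim: "(F \<longlongrightarrow> 0) A" if "(?n \<longlongrightarrow> 0) A" for A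
  proof -
    have "((\<lambda>x. g x * ?n x) \<longlongrightarrow> 0) A"
    proof (rule Lim_null_comparison)
      show "\<forall>\<^sub>F x in A. norm (g x * ?n x) \<le> C * ?n x"
        using bg by (intro always_eventually allI) (auto simp: abs_mult intro!: mult_right_mono)
      show "((\<lambda>x. C * ?n x) \<longlongrightarrow> 0) A" using that by (rule tendsto_mult_right_zero)
    qed
    then show ?thesis unfolding F_def by (rule tendsto_mult_right_zero)
  qed
  have "(LBINT x=-\<infinity>..\<infinity>. f x) = 0 - 0"
  proof (rule interval_integral_FTC_integrable)
    show "(F has_vector_derivative f x) (at x)" for x
      using F by (simp add: has_real_derivative_iff_has_vector_derivative)
    show "set_integrable lborel (einterval (- \<infinity>) \<infinity>) f"
      using int by (simp add: set_integrable_def einterval_def)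
    show "((F \<circ> real_of_ereal) \<longlongrightarrow> 0) (at_right (- \<infinity>))" "((F \<circ> real_of_ereal) \<longlongrightarrow> 0) (at_left \<infinity>)"
      unfolding ereal_tendsto_simps using normal_density_tendsto_0[OF \<sigma>] by (auto intro: lim)
  qed (auto intro: cf)
  then show ?thesis
    by (simp add: interval_lebesgue_integral_def einterval_def set_lebesgue_integral_def f_def)
qed

section \<open>Smooth functions of finitely many coordinates\<close>

text \<open>Only coordinatewise derivatives on the sequence space are given, so the chain rule is
  assembled by putting one coordinate after another onto the line, each time through a function of
  two real variables.\<close>

lemma has_real_derivative_along_line:
  fixes f :: "(nat \<Rightarrow> real) \<Rightarrow> real"
  assumes d: "\<And>i x. i < n \<Longrightarrow> ((\<lambda>s. f (x(i := s))) has_real_derivative d i x) (at (x i))"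
    and cd: "\<And>i. i < n \<Longrightarrow> continuous_on UNIV (d i)"
    and dep: "\<And>x y. (\<forall>i<n. x i = y i) \<Longrightarrow> f x = f y"
    and ddep: "\<And>i x y. i < n \<Longrightarrow> (\<forall>i<n. x i = y i) \<Longrightarrow> d i x = d i y"
  shows "((\<lambda>s. f (\<lambda>i. a i * s + y i)) has_real_derivative
    (\<Sum>i<n. a i * d i (\<lambda>i. a i * s + y i))) (at s)"
proof -
  \<comment> \<open>The first \<open>k\<close> coordinates run along the line and the others are
    frozen at \<open>z\<close>. The induction keeps \<open>z\<close> arbitrary because its step
    varies coordinate \<open>k\<close> of \<open>z\<close>.\<close>
  define p where "p k z s i = (if i < k then a i * s + y i else z i)" for k z s and i :: nat
  have main: "((\<lambda>s. f (p k z s)) has_real_derivative (\<Sum>i<k. a i * d i (p k z s))) (at s)"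
    if "k \<le> n" for k z s
    using that
  proof (induction k arbitrary: z s)
    case 0
    then show ?case by (simp add: p_def)
  next
    case (Suc k)
    then have k: "k < n" by simp
    define r where "r = a k * s + y k"
    have upd: "(p k z s')(k := t) = p k (z(k := t)) s'" for s' t
      by (auto simp: p_def fun_eq_iff)
    have upd2: "p (Suc k) z s' = (p k z s')(k := a k * s' + y k)" for s'
      by (auto simp: p_def fun_eq_iff less_Suc_eq)
    have cont: "continuous_on UNIV (\<lambda>(s', t). d k ((p k z s')(k := t)))"
    proof -
      have "continuous_on UNIV (\<lambda>q::real \<times> real. (p k z (fst q))(k := snd q))"
      proof (rule continuous_on_coordinatewise_then_product)
        show "continuous_on UNIV (\<lambda>q::real \<times> real. ((p k z (fst q))(k := snd q)) i)" for i
          by (cases "i = k"; cases "i < k") (auto simp: p_def intro!: continuous_intros)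
      qed
      then have "continuous_on UNIV (\<lambda>q::real \<times> real. d k ((p k z (fst q))(k := snd q)))"
        by (rule continuous_on_compose2[OF cd[OF k]]) auto
      then show ?thesis by (simp add: case_prod_beta')
    qed
    \<comment> \<open>Here \<open>s'\<close> drives the coordinates already on the line and
      \<open>t\<close> drives coordinate \<open>k\<close>. Joint differentiability needs the partial
      derivative in \<open>s'\<close> at the point only (the induction hypothesis) and a continuous
      one in \<open>t\<close>. Composition with \<open>s' \<mapsto> (s', a k * s' + y k)\<close>
      then completes the step.\<close>
    have "((\<lambda>(s', t). f ((p k z s')(k := t))) has_derivative
        (\<lambda>(tx, ty). (\<Sum>i<k. a i * d i (p k (z(k := r)) s)) * tx + blinfun_mult_right (d k ((p k z s)(k := r))) ty))
        (at (s, r) within UNIV \<times> UNIV)"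
    proof (rule has_derivative_partialsI)
      show "((\<lambda>s'. f ((p k z s')(k := r))) has_derivative (*) (\<Sum>i<k. a i * d i (p k (z(k := r)) s))) (at s)"
        using Suc.IH[of "z(k := r)" s] k unfolding upd by (simp add: has_field_derivative_def del: fun_upd_apply)
      show "((\<lambda>t. f ((p k z s')(k := t))) has_derivative
          blinfun_apply (blinfun_mult_right (d k ((p k z s')(k := t))))) (at t)" for s' t
        using d[OF k, of "(p k z s')(k := t)"] by (simp add: has_field_derivative_def)
      have "isCont (\<lambda>(s', t). d k ((p k z s')(k := t))) (s, r)"
        using cont by (simp add: continuous_on_eq_continuous_at)
      then have "isCont (\<lambda>q. blinfun_mult_right ((\<lambda>(s', t). d k ((p k z s')(k := t))) q)) (s, r)"
        by (rule bounded_linear.continuous[OF bounded_linear_blinfun_mult_right])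
      then show "continuous (at (s, r) within UNIV \<times> UNIV)
          (\<lambda>(s', t). blinfun_mult_right (d k ((p k z s')(k := t))))"
        by (simp add: case_prod_beta')
    qed auto
    then have D: "((\<lambda>(s', t). f ((p k z s')(k := t))) has_derivative
        (\<lambda>(tx, ty). (\<Sum>i<k. a i * d i (p k (z(k := r)) s)) * tx + d k ((p k z s)(k := r)) * ty)) (at (s, r))"
      by simp
    have L: "((\<lambda>s'. (s', a k * s' + y k)) has_derivative (\<lambda>h. (h, a k * h))) (at s)"
      by (auto intro!: derivative_eq_intros)
    have "((\<lambda>s'. (\<lambda>(s', t). f ((p k z s')(k := t))) (s', a k * s' + y k)) has_derivative
        (\<lambda>h. (\<lambda>(tx, ty). (\<Sum>i<k. a i * d i (p k (z(k := r)) s)) * tx + d k ((p k z s)(k := r)) * ty) (h, a k * h))) (at s)"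
      by (rule has_derivative_compose[OF L]) (use D in \<open>simp add: r_def del: fun_upd_apply\<close>)
    then have "((\<lambda>s'. f (p (Suc k) z s')) has_derivative
        (\<lambda>h. (\<Sum>i<k. a i * d i (p k (z(k := r)) s)) * h + d k ((p k z s)(k := r)) * (a k * h))) (at s)"
      by (simp add: upd2 del: fun_upd_apply)
    moreover have "p k (z(k := r)) s = p (Suc k) z s" "(p k z s)(k := r) = p (Suc k) z s"
      by (simp_all add: upd2 upd[symmetric] r_def del: fun_upd_apply)
    moreover have "(\<lambda>h. S * h + e * (a k * h)) = (*) (S + a k * e)" for S e
      by (auto simp: algebra_simps)
    ultimately show ?case
      by (simp add: has_field_derivative_def)
  qed
  \<comment> \<open>Coordinates from \<open>n\<close> on influence neither \<open>f\<close> nor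
    \<open>d i\<close>, so freezing them at 0 is harmless.\<close>
  have eq: "f (\<lambda>i. a i * s' + y i) = f (p n (\<lambda>_. 0) s')"
    "i < n \<Longrightarrow> d i (\<lambda>i. a i * s' + y i) = d i (p n (\<lambda>_. 0) s')" for s' i
    by (auto intro!: dep ddep simp: p_def)
  show ?thesis using main[of n "\<lambda>_. 0" s] by (simp add: eq)
qed

lemma Cb_inftyD:
  assumes "f \<in> Cb_infty n"
  shows "\<And>x y. (\<forall>i<n. x i = y i) \<Longrightarrow> f x = f y"
    and "continuous_on UNIV f" "bounded (range f)"
    and "\<And>i. i < n \<Longrightarrow> continuous_on UNIV (partial i f)"
    and "\<And>i. i < n \<Longrightarrow> bounded (range (partial i f))"
    and "\<And>i x. i < n \<Longrightarrow> ((\<lambda>s. f (x(i := s))) has_real_derivative partial i f x) (at (x i))"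
proof -
  have *: "continuous_on UNIV g \<and> bounded (range g) \<and>
      (\<forall>i<n. \<forall>x. (\<lambda>s. g (x(i := s))) differentiable (at (x i)))"
    if "set js \<subseteq> {..<n}" "g = foldr partial js f" for js g
    using assms that unfolding Cb_infty_def Let_def by blast
  show "\<And>x y. (\<forall>i<n. x i = y i) \<Longrightarrow> f x = f y" using assms unfolding Cb_infty_def by blast
  show "continuous_on UNIV f" "bounded (range f)" using *[of "[]" f] by auto
  show "continuous_on UNIV (partial i f)" "bounded (range (partial i f))" if "i < n" for i
    using *[of "[i]" "partial i f"] that by auto
  show "((\<lambda>s. f (x(i := s))) has_real_derivative partial i f x) (at (x i))" if "i < n" for i x
    unfolding partial_def DERIV_deriv_iff_real_differentiable using *[of "[]" f] that by auto
qed

lemma partial_cong: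
  assumes "\<And>x y. (\<forall>i<n. x i = y i) \<Longrightarrow> f x = f y" "\<forall>i<n. x i = y i" "i < n"
  shows "partial i f x = partial i f y"
proof -
  have "(\<lambda>s. f (x(i := s))) = (\<lambda>s. f (y(i := s)))" using assms by (auto intro!: ext assms(1))
  then show ?thesis using assms by (simp add: partial_def)
qed

lemma borel_measurable_of_coordinates:
  fixes f :: "(nat \<Rightarrow> real) \<Rightarrow> real"
  assumes f: "\<And>x y. (\<forall>i<n. x i = y i) \<Longrightarrow> f x = f y" "continuous_on UNIV f"
    and G: "\<And>i. i < n \<Longrightarrow> G i \<in> borel_measurable M"
  shows "(\<lambda>\<omega>. f (\<lambda>i. G i \<omega>)) \<in> borel_measurable M"
proof -
  \<comment> \<open>Measurability is known for indices below \<open>n\<close> only; the other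
    coordinates, which \<open>f\<close> ignores, are replaced by 0 to obtain a measurable map into
    the product space.\<close>
  let ?G = "\<lambda>\<omega> i. if i < n then G i \<omega> else 0"
  have "?G \<in> M \<rightarrow>\<^sub>M (PiM UNIV (\<lambda>_. borel))"
  proof (rule measurable_PiM_single')
    show "(\<lambda>\<omega>. if i < n then G i \<omega> else 0) \<in> borel_measurable M" for i
      using G by (cases "i < n") auto
  qed simp
  moreover have "f \<in> borel_measurable (PiM UNIV (\<lambda>_. borel))"
    using borel_measurable_continuous_onI[OF f(2)] by (simp add: measurable_cong_sets[OF sets_PiM_equal_borel refl])
  ultimately have "(\<lambda>\<omega>. f (?G \<omega>)) \<in> borel_measurable M" by (rule measurable_compose)
  moreover have "f (?G \<omega>) = f (\<lambda>i. G i \<omega>)" for \<omega> by (rule f(1)) simp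
  ultimately show ?thesis by simp
qed

text \<open>A derivative in coordinate \<open>i\<close> multiplies the amplitude by
  \<open>c i\<close> and shifts the phase by \<open>pi / 2\<close>, so the family
  \<open>K * cos (... + \<theta>)\<close> is closed under \<open>partial\<close> and one shape
  covers all iterated derivatives. A free phase also makes sines available.\<close>

lemma cos_linear_Cb_infty: "(\<lambda>x. cos ((\<Sum>i<n. c i * x i) + \<theta>)) \<in> Cb_infty n"
proof -
  define g where "g K \<theta> x = K * cos ((\<Sum>i<n. c i * x i) + \<theta>)" for K \<theta> :: real and x
  have lin: "((\<lambda>s. \<Sum>j<n. c j * (x(i := s)) j) has_real_derivative c i) (at s0)" if "i < n" for i x s0
  proof -
    have "(\<lambda>s. \<Sum>j<n. c j * (x(i := s)) j) = (\<lambda>s. c i * s + (\<Sum>j\<in>{..<n} - {i}. c j * x j))"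
      using that by (auto simp: sum.remove intro!: ext sum.cong)
    then show ?thesis by (auto intro!: derivative_eq_intros)
  qed
  have dg: "((\<lambda>s. g K \<theta> (x(i := s))) has_real_derivative g (K * c i) (\<theta> + pi / 2) x) (at (x i))"
    if "i < n" for i x K \<theta>
  proof -
    have "cos (t + (\<theta> + pi / 2)) = - sin (t + \<theta>)" for t
      by (metis add.assoc cos_add cos_pi_half sin_pi_half mult_zero_right mult_1_right diff_0)
    then have "g (K * c i) (\<theta> + pi / 2) x = K * (- sin ((\<Sum>j<n. c j * (x(i := x i)) j) + \<theta>) * (c i + 0))"
      by (simp add: g_def)
    moreover have "((\<lambda>s. K * cos ((\<Sum>j<n. c j * (x(i := s)) j) + \<theta>)) has_real_derivative
        K * (- sin ((\<Sum>j<n. c j * (x(i := x i)) j) + \<theta>) * (c i + 0))) (at (x i))"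
      by (intro DERIV_cmult DERIV_chain2[OF DERIV_cos] DERIV_add lin[OF that] DERIV_const)
    ultimately show ?thesis by (simp only: g_def)
  qed
  have pg: "partial i (g K \<theta>) = g (K * c i) (\<theta> + pi / 2)" if "i < n" for i K \<theta>
    using DERIV_imp_deriv[OF dg[OF that]] by (auto simp: partial_def)
  have fold: "\<exists>K \<theta>'. foldr partial js (g 1 \<theta>) = g K \<theta>'" if "set js \<subseteq> {..<n}" for js
    using that
  proof (induction js)
    case (Cons i js)
    then obtain K \<theta>' where "foldr partial js (g 1 \<theta>) = g K \<theta>'" by auto
    with Cons.prems show ?case by (auto simp: pg)
  qed auto
  have cont: "continuous_on UNIV (g K \<theta>)" for K \<theta>
    unfolding g_def by (intro continuous_intros continuous_on_product_coordinates)
  have bdd: "bounded (range (g K \<theta>))" for K \<theta>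
    by (rule boundedI[of _ "\<bar>K\<bar>"]) (auto simp: g_def abs_mult intro!: mult_left_le)
  have "g 1 \<theta> \<in> Cb_infty n"
    unfolding Cb_infty_def Let_def
  proof (intro CollectI conjI allI impI)
    fix js assume js: "set js \<subseteq> {..<n}"
    then obtain K \<theta>' where K: "foldr partial js (g 1 \<theta>) = g K \<theta>'" using fold by blast
    show "continuous_on UNIV (foldr partial js (g 1 \<theta>))" unfolding K by (rule cont)
    show "bounded (range (foldr partial js (g 1 \<theta>)))" unfolding K by (rule bdd)
    show "(\<lambda>s. foldr partial js (g 1 \<theta>) (x(i := s))) differentiable at (x i)" if "i < n" for i x
      unfolding K using dg[OF that] real_differentiable_def by blast
  qed (auto simp: g_def intro!: arg_cong[where f = cos] sum.cong)
  moreover have "g 1 \<theta> = (\<lambda>x. cos ((\<Sum>i<n. c i * x i) + \<theta>))" by (simp add: g_def fun_eq_iff)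
  ultimately show ?thesis by simp
qed

section \<open>Gaussian integration by parts\<close>

lemma (in prob_space) integrable_cos: "X \<in> borel_measurable M \<Longrightarrow> integrable M (\<lambda>\<omega>. cos (X \<omega> :: real))"
  by (rule integrable_const_bound[where B = 1]) auto

lemma (in prob_space) integrable_sin: "X \<in> borel_measurable M \<Longrightarrow> integrable M (\<lambda>\<omega>. sin (X \<omega> :: real))"
  by (rule integrable_const_bound[where B = 1]) auto

lemma (in prob_space) char_distr_eq:
  assumes [measurable]: "X \<in> borel_measurable M"
  shows "char (distr M borel X) t =
    of_real (\<integral>\<omega>. cos (t * X \<omega>) \<partial>M) + \<i> * of_real (\<integral>\<omega>. sin (t * X \<omega>) \<partial>M)"
proof -
  have "char (distr M borel X) t = (\<integral>\<omega>. iexp (t * X \<omega>) \<partial>M)"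
    unfolding char_def by (subst integral_distr) auto
  also have "(\<lambda>\<omega>. iexp (t * X \<omega>)) = (\<lambda>\<omega>. of_real (cos (t * X \<omega>)) + \<i> * of_real (sin (t * X \<omega>)))"
    by (auto simp: complex_eq_iff Re_exp Im_exp)
  also have "(\<integral>\<omega>. of_real (cos (t * X \<omega>)) + \<i> * of_real (sin (t * X \<omega>)) \<partial>M) =
      of_real (\<integral>\<omega>. cos (t * X \<omega>) \<partial>M) + \<i> * of_real (\<integral>\<omega>. sin (t * X \<omega>) \<partial>M)"
    using integrable_cos[of "\<lambda>\<omega>. t * X \<omega>"] integrable_sin[of "\<lambda>\<omega>. t * X \<omega>"]
    by (simp add: complex_of_real_integrable_eq)
  finally show ?thesis .
qed

lemma (in prob_space) std_normal_of_char:
  assumes [measurable]: "X \<in> borel_measurable M"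
    and c: "\<And>t. (\<integral>\<omega>. cos (t * X \<omega>) \<partial>M) = exp (- t\<^sup>2 / 2)" and s: "\<And>t. (\<integral>\<omega>. sin (t * X \<omega>) \<partial>M) = 0"
  shows "distributed M lborel X std_normal_density"
proof -
  have "distr M borel X = std_normal_distribution"
    by (rule Levy_uniqueness) (auto simp: char_distr_eq c s char_std_normal_distribution real_dist_normal_dist)
  then show ?thesis
    unfolding distributed_def by (auto simp: distr_cong[of M M borel lborel])
qed

text \<open>The characteristic function of a centred Gaussian variable at frequency 1, split into
  real and imaginary part. On a single variable this is weak; required of all linear combinations,
  it determines their joint law.\<close>

definition centred_gaussian_cf :: "'a measure \<Rightarrow> ('a \<Rightarrow> real) \<Rightarrow> bool" where
  "centred_gaussian_cf P Z \<longleftrightarrow>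
     (\<integral>\<omega>. cos (Z \<omega>) \<partial>P) = exp (- (\<integral>\<omega>. (Z \<omega>)\<^sup>2 \<partial>P) / 2) \<and> (\<integral>\<omega>. sin (Z \<omega>) \<partial>P) = 0"

lemma centred_gaussian_cf_cong:
  assumes "AE \<omega> in P. Z \<omega> = Y \<omega>" "Z \<in> borel_measurable P" "Y \<in> borel_measurable P"
  shows "centred_gaussian_cf P Z \<longleftrightarrow> centred_gaussian_cf P Y"
proof -
  note [measurable] = assms(2,3)
  have "(\<integral>\<omega>. cos (Z \<omega>) \<partial>P) = (\<integral>\<omega>. cos (Y \<omega>) \<partial>P)" "(\<integral>\<omega>. sin (Z \<omega>) \<partial>P) = (\<integral>\<omega>. sin (Y \<omega>) \<partial>P)"
    "(\<integral>\<omega>. (Z \<omega>)\<^sup>2 \<partial>P) = (\<integral>\<omega>. (Y \<omega>)\<^sup>2 \<partial>P)"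
    using assms(1) by (intro integral_cong_AE; auto)+
  then show ?thesis by (simp add: centred_gaussian_cf_def)
qed

text \<open>Cosine and sine are bounded and 1-Lipschitz, so their expectations move by at most the
  mean distance, which the mean-square distance dominates; second moments converge as well.\<close>

lemma (in prob_space) centred_gaussian_cf_tendsto:
  assumes Z: "\<And>k. Zs k \<in> L2 M" "Z \<in> L2 M"
    and lim: "(\<lambda>k. \<integral>\<omega>. (Zs k \<omega> - Z \<omega>)\<^sup>2 \<partial>M) \<longlonglongrightarrow> 0"
    and cf: "\<And>k. centred_gaussian_cf M (Zs k)"
  shows "centred_gaussian_cf M Z"
proof -
  have [measurable]: "Zs k \<in> borel_measurable M" "Z \<in> borel_measurable M" for k
    using Z by (auto simp: L2_iff)
  have conv: "(\<lambda>k. \<integral>\<omega>. g (Zs k \<omega>) \<partial>M) \<longlonglongrightarrow> (\<integral>\<omega>. g (Z \<omega>) \<partial>M)"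
    if g: "\<And>x y. \<bar>g x - g y\<bar> \<le> \<bar>x - y\<bar>" "\<And>x. \<bar>g x\<bar> \<le> 1" "g \<in> borel_measurable borel" for g :: "real \<Rightarrow> real"
  proof (rule LIM_zero_cancel, rule Lim_null_comparison)
    note [measurable] = g(3)
    have "norm ((\<integral>\<omega>. g (Zs k \<omega>) \<partial>M) - (\<integral>\<omega>. g (Z \<omega>) \<partial>M)) \<le> sqrt (\<integral>\<omega>. (Zs k \<omega> - Z \<omega>)\<^sup>2 \<partial>M)" for k
    proof -
      have i: "integrable M (\<lambda>\<omega>. g (Zs k \<omega>))" "integrable M (\<lambda>\<omega>. g (Z \<omega>))"
        using g(2) by (auto intro!: integrable_const_bound[where B = 1])
      then have "(\<integral>\<omega>. g (Zs k \<omega>) \<partial>M) - (\<integral>\<omega>. g (Z \<omega>) \<partial>M) = (\<integral>\<omega>. g (Zs k \<omega>) - g (Z \<omega>) \<partial>M)" by simp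
      also have "norm \<dots> \<le> (\<integral>\<omega>. \<bar>g (Zs k \<omega>) - g (Z \<omega>)\<bar> \<partial>M)"
        using integral_norm_bound[of M "\<lambda>\<omega>. g (Zs k \<omega>) - g (Z \<omega>)"] by simp
      also have "\<dots> \<le> (\<integral>\<omega>. \<bar>Zs k \<omega> - Z \<omega>\<bar> \<partial>M)"
        using i L2_integrable[OF L2_diff[OF Z]] g(1) by (intro integral_mono) auto
      also have "\<dots> \<le> sqrt (\<integral>\<omega>. (Zs k \<omega> - Z \<omega>)\<^sup>2 \<partial>M)"
        by (rule L2_expectation_abs_le[OF L2_diff[OF Z]])
      finally show ?thesis .
    qed
    then show "\<forall>\<^sub>F k in sequentially. norm ((\<integral>\<omega>. g (Zs k \<omega>) \<partial>M) - (\<integral>\<omega>. g (Z \<omega>) \<partial>M))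
        \<le> sqrt (\<integral>\<omega>. (Zs k \<omega> - Z \<omega>)\<^sup>2 \<partial>M)" by simp
    show "(\<lambda>k. sqrt (\<integral>\<omega>. (Zs k \<omega> - Z \<omega>)\<^sup>2 \<partial>M)) \<longlonglongrightarrow> 0"
      using tendsto_real_sqrt[OF lim] by simp
  qed
  have lip: "\<bar>cos x - cos y\<bar> \<le> \<bar>x - y\<bar>" "\<bar>sin x - sin y\<bar> \<le> \<bar>x - y\<bar>" for x y :: real
  proof -
    have "norm (cos x - cos y) \<le> 1 * norm (x - y)"
      by (rule field_differentiable_bound[of UNIV cos "\<lambda>x. - sin x"]) (auto intro!: derivative_eq_intros)
    then show "\<bar>cos x - cos y\<bar> \<le> \<bar>x - y\<bar>" by simp
    have "norm (sin x - sin y) \<le> 1 * norm (x - y)"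
      by (rule field_differentiable_bound[of UNIV sin cos]) (auto intro!: derivative_eq_intros)
    then show "\<bar>sin x - sin y\<bar> \<le> \<bar>x - y\<bar>" by simp
  qed
  have "(\<lambda>k. \<integral>\<omega>. cos (Zs k \<omega>) \<partial>M) \<longlonglongrightarrow> (\<integral>\<omega>. cos (Z \<omega>) \<partial>M)"
    "(\<lambda>k. \<integral>\<omega>. sin (Zs k \<omega>) \<partial>M) \<longlonglongrightarrow> (\<integral>\<omega>. sin (Z \<omega>) \<partial>M)"
    by (intro conv lip; simp)+
  moreover have "(\<lambda>k. exp (- (\<integral>\<omega>. (Zs k \<omega>)\<^sup>2 \<partial>M) / 2)) \<longlonglongrightarrow> exp (- (\<integral>\<omega>. (Z \<omega>)\<^sup>2 \<partial>M) / 2)"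
    by (intro tendsto_intros L2_tendsto_sq[OF Z lim]) auto
  ultimately show ?thesis
    using cf unfolding centred_gaussian_cf_def by (simp add: LIMSEQ_unique LIMSEQ_const_iff)
qed

lemma (in prob_space) gaussian_rv_centred_cf:
  assumes "gaussian_rv M S" "expectation S = 0"
  shows "S \<in> L2 M" "centred_gaussian_cf M S"
proof -
  have S[measurable]: "S \<in> borel_measurable M" using assms(1) by (simp add: gaussian_rv_def)
  consider m where "AE \<omega> in M. S \<omega> = m"
    | m \<sigma> where "\<sigma> > 0" "distributed M lborel S (\<lambda>x. ennreal (normal_density m \<sigma> x))"
    using assms(1) by (auto simp: gaussian_rv_def)
  then have "S \<in> L2 M \<and> centred_gaussian_cf M S"
  proof cases
    case 1
    have "expectation S = (\<integral>\<omega>. m \<partial>M)" using 1 by (intro integral_cong_AE) auto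
    then have "m = 0" using assms(2) by (simp add: prob_space)
    with 1 have AE0: "AE \<omega> in M. S \<omega> = 0" by simp
    have "integrable M (\<lambda>\<omega>. (S \<omega>)\<^sup>2) \<longleftrightarrow> integrable M (\<lambda>\<omega>. 0 :: real)"
      using AE0 by (intro integrable_cong_AE) auto
    moreover have "centred_gaussian_cf M (\<lambda>_. 0)" by (simp add: centred_gaussian_cf_def prob_space)
    ultimately show ?thesis
      using centred_gaussian_cf_cong[OF AE0] by (auto simp: L2_iff)
  next
    case 2
    have "expectation S = (\<integral>x. normal_density m \<sigma> x * x \<partial>lborel)"
      using distributed_integral[OF 2(2), of "\<lambda>x. x"] by simp
    then have m: "m = 0" using assms(2) 2(1) by (simp add: integral_normal_moment_nz_1)
    have i: "integrable M (\<lambda>\<omega>. (S \<omega>)\<^sup>2)"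
      using distributed_integrable[OF 2(2), of "\<lambda>x. x\<^sup>2"] integrable_normal_moment[OF 2(1), of m 2] m
      by simp
    have v: "(\<integral>\<omega>. (S \<omega>)\<^sup>2 \<partial>M) = \<sigma>\<^sup>2"
      using distributed_integral[OF 2(2), of "\<lambda>x. x\<^sup>2"] integral_normal_moment_even[OF 2(1), of m 1] m 2(1)
      by (simp add: fact_2)
    have "distributed M lborel (\<lambda>\<omega>. S \<omega> / \<sigma>) std_normal_density"
      using normal_standard_normal_convert[of \<sigma> S m] 2 m by simp
    then have "distr M borel (\<lambda>\<omega>. S \<omega> / \<sigma>) = std_normal_distribution"
      unfolding distributed_def using distr_cong[of M M borel lborel "\<lambda>\<omega>. S \<omega> / \<sigma>"] by simp
    \<comment> \<open>Frequency \<sigma> for the standardised variable is frequency 1 for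
      \<open>S\<close>.\<close>
    then have "char (distr M borel (\<lambda>\<omega>. S \<omega> / \<sigma>)) \<sigma> = of_real (exp (- \<sigma>\<^sup>2 / 2))"
      by (simp add: char_std_normal_distribution)
    then have "of_real (\<integral>\<omega>. cos (S \<omega>) \<partial>M) + \<i> * of_real (\<integral>\<omega>. sin (S \<omega>) \<partial>M) = of_real (exp (- \<sigma>\<^sup>2 / 2))"
      using 2(1) by (simp add: char_distr_eq)
    then have "(\<integral>\<omega>. cos (S \<omega>) \<partial>M) = exp (- \<sigma>\<^sup>2 / 2)" "(\<integral>\<omega>. sin (S \<omega>) \<partial>M) = 0"
      by (auto simp: complex_eq_iff)
    then show ?thesis using i v by (simp add: centred_gaussian_cf_def L2_iff)
  qed
  then show "S \<in> L2 M" "centred_gaussian_cf M S" by auto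
qed

text \<open>
  With \<open>a i = E(G i H) / E(H\<^sup>2)\<close> the variables \<open>Y i = G i - a i H\<close> are uncorrelated with \<open>H\<close>, hence
  independent of it, and for fixed \<open>Y\<close> the formula is the one-dimensional one for
  \<open>x \<mapsto> f (a x + Y)\<close>.
\<close>

lemma (in prob_space) gaussian_integration_by_parts:
  assumes G: "\<And>i. i < n \<Longrightarrow> G i \<in> L2 M" and H: "H \<in> L2 M"
    and cf: "\<And>c s. centred_gaussian_cf M (\<lambda>\<omega>. (\<Sum>i<n. c i * G i \<omega>) + s * H \<omega>)"
    and f: "f \<in> Cb_infty n"
  shows "(\<integral>\<omega>. f (\<lambda>i. G i \<omega>) * H \<omega> \<partial>M) =
    (\<Sum>i<n. (\<integral>\<omega>. partial i f (\<lambda>j. G j \<omega>) \<partial>M) * (\<integral>\<omega>. G i \<omega> * H \<omega> \<partial>M))"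
proof (cases "(\<integral>\<omega>. (H \<omega>)\<^sup>2 \<partial>M) = 0")
  case True
  \<comment> \<open>In the degenerate case the projection onto \<open>H\<close> is undefined, but
    both sides are 0 because each contains the factor \<open>H\<close> under an expectation.\<close>
  have AE0: "AE \<omega> in M. H \<omega> = 0"
    using L2_diff_zero_AE_eq[OF H const_L2[of 0]] True by simp
  have "(\<integral>\<omega>. g \<omega> * H \<omega> \<partial>M) = 0" for g
  proof (rule integral_eq_zero_AE)
    show "AE \<omega> in M. g \<omega> * H \<omega> = 0" using AE0 by eventually_elim simp
  qed
  then show ?thesis by simp
next
  case False
  have [measurable]: "H \<in> borel_measurable M" using H by (simp add: L2_iff)
  define \<sigma> where "\<sigma> = sqrt (\<integral>\<omega>. (H \<omega>)\<^sup>2 \<partial>M)"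
  have "(\<integral>\<omega>. (H \<omega>)\<^sup>2 \<partial>M) \<ge> 0" by simp
  then have "(\<integral>\<omega>. (H \<omega>)\<^sup>2 \<partial>M) > 0" using False by linarith
  then have \<sigma>: "\<sigma> > 0" "(\<integral>\<omega>. (H \<omega>)\<^sup>2 \<partial>M) = \<sigma>\<^sup>2" by (auto simp: \<sigma>_def)
  \<comment> \<open>\<open>a i\<close> is the regression coefficient of \<open>G i\<close> on
    \<open>H\<close>. Both \<open>a i\<close> and \<open>Y i\<close> are 0 from \<open>n\<close> on,
    which makes the whole sequence \<open>Y\<close> measurable without information on
    \<open>G i\<close> there.\<close>
  define a where "a i = (if i < n then (\<integral>\<omega>. G i \<omega> * H \<omega> \<partial>M) / \<sigma>\<^sup>2 else 0)" for i
  define Y where "Y i \<omega> = (if i < n then G i \<omega> - a i * H \<omega> else 0)" for i \<omega>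
  define N where "N = (PiM UNIV (\<lambda>_. borel) :: (nat \<Rightarrow> real) measure)"
  have sN: "sets N = sets borel" unfolding N_def by (rule sets_PiM_equal_borel)
  have Y: "Y i \<in> L2 M" for i
    using L2_linear[OF G[of i] H, of 1 "- a i"] const_L2[of 0] by (cases "i < n") (simp_all add: Y_def[abs_def])
  have Ym[measurable]: "Y i \<in> borel_measurable M" for i using Y[of i] by (simp add: L2_iff)
  have YH: "(\<integral>\<omega>. Y i \<omega> * H \<omega> \<partial>M) = 0" for i
  proof (cases "i < n")
    case True
    then have "(\<lambda>\<omega>. Y i \<omega> * H \<omega>) = (\<lambda>\<omega>. G i \<omega> * H \<omega> - a i * (H \<omega>)\<^sup>2)"
      by (auto simp: Y_def algebra_simps power2_eq_square)
    then show ?thesis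
      using True L2_mult_integrable[OF G[OF True] H] H \<sigma> by (simp add: L2_iff a_def)
  qed (simp add: Y_def)
  define S where "S c \<omega> = (\<Sum>i<n. c i * Y i \<omega>)" for c \<omega>
  have S: "S c \<in> L2 M" for c unfolding S_def[abs_def] by (rule L2_sum) (rule Y)
  have [measurable]: "S c \<in> borel_measurable M" for c using S[of c] by (simp add: L2_iff)
  have SH: "(\<integral>\<omega>. S c \<omega> * H \<omega> \<partial>M) = 0" for c
  proof -
    have "(\<lambda>\<omega>. S c \<omega> * H \<omega>) = (\<lambda>\<omega>. \<Sum>i<n. c i * (Y i \<omega> * H \<omega>))"
      by (simp add: S_def[abs_def] sum_distrib_right mult.assoc)
    then show ?thesis using YH L2_mult_integrable[OF Y H] by simp
  qed
  define q where "q c = (\<integral>\<omega>. (S c \<omega>)\<^sup>2 \<partial>M)" for c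
  \<comment> \<open>Because \<open>S c\<close> and \<open>H\<close> are uncorrelated, their
    variances add and the joint characteristic function becomes a product.\<close>
  have CF: "(\<integral>\<omega>. cos (S c \<omega> + s * H \<omega>) \<partial>M) = exp (- (q c + s\<^sup>2 * \<sigma>\<^sup>2) / 2)"
    "(\<integral>\<omega>. sin (S c \<omega> + s * H \<omega>) \<partial>M) = 0" for c s
  proof -
    have "(\<lambda>\<omega>. (S c \<omega> + s * H \<omega>)\<^sup>2) = (\<lambda>\<omega>. (S c \<omega>)\<^sup>2 + 2 * s * (S c \<omega> * H \<omega>) + s\<^sup>2 * (H \<omega>)\<^sup>2)"
      by (auto simp: power2_eq_square algebra_simps)
    then have "(\<integral>\<omega>. (S c \<omega> + s * H \<omega>)\<^sup>2 \<partial>M) = q c + s\<^sup>2 * \<sigma>\<^sup>2"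
      using S[of c] H L2_mult_integrable[OF S H, of c] SH[of c] \<sigma> by (simp add: L2_iff q_def)
    moreover have "centred_gaussian_cf M (\<lambda>\<omega>. S c \<omega> + s * H \<omega>)"
    proof -
      \<comment> \<open>Expanding \<open>Y i\<close> shifts only the coefficient of
        \<open>H\<close>, so the combination is of the form covered by \<open>cf\<close>.\<close>
      have "S c \<omega> + s * H \<omega> = (\<Sum>i<n. c i * G i \<omega>) + (s - (\<Sum>i<n. c i * a i)) * H \<omega>" for \<omega>
        by (simp add: S_def Y_def algebra_simps sum_subtractf sum_distrib_left)
      then show ?thesis using cf[of c] by simp
    qed
    ultimately show "(\<integral>\<omega>. cos (S c \<omega> + s * H \<omega>) \<partial>M) = exp (- (q c + s\<^sup>2 * \<sigma>\<^sup>2) / 2)"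
      "(\<integral>\<omega>. sin (S c \<omega> + s * H \<omega>) \<partial>M) = 0"
      by (simp_all add: centred_gaussian_cf_def)
  qed
  have CFm: "(\<integral>\<omega>. cos (S c \<omega> - s * H \<omega>) \<partial>M) = exp (- (q c + s\<^sup>2 * \<sigma>\<^sup>2) / 2)"
    "(\<integral>\<omega>. sin (S c \<omega> - s * H \<omega>) \<partial>M) = 0" for c s
    using CF[of c "- s"] by simp_all
  have CF0: "(\<integral>\<omega>. cos (S c \<omega>) \<partial>M) = exp (- q c / 2)" "(\<integral>\<omega>. sin (S c \<omega>) \<partial>M) = 0" for c
    using CF[of c 0] by simp_all
  have S0: "S (\<lambda>_. 0) = (\<lambda>_. 0)" by (simp add: S_def[abs_def])
  have q0: "q (\<lambda>_. 0) = 0" by (simp add: q_def S0)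
  have CH: "(\<integral>\<omega>. cos (s * H \<omega>) \<partial>M) = exp (- (s\<^sup>2 * \<sigma>\<^sup>2) / 2)" "(\<integral>\<omega>. sin (s * H \<omega>) \<partial>M) = 0" for s
    using CF[of "\<lambda>_. 0" s] by (simp_all add: S0 q0)
  note ints = integrable_cos integrable_sin
  \<comment> \<open>The weight \<open>cos (S c)\<close> minus its mean has vanishing Fourier
    transform in \<open>H\<close>, by the product form just obtained; \<open>sin (S c)\<close> has
    mean 0 already.\<close>
  have BH: "(\<integral>\<omega>. indicator B (H \<omega>) * (cos (S c \<omega>) - exp (- q c / 2)) \<partial>M) = 0"
    "(\<integral>\<omega>. indicator B (H \<omega>) * sin (S c \<omega>) \<partial>M) = 0" if "B \<in> sets borel" for B c
  proof -
    have trig: "cos (s * H \<omega>) * cos (S c \<omega>) = (cos (S c \<omega> + s * H \<omega>) + cos (S c \<omega> - s * H \<omega>)) / 2"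
      "sin (s * H \<omega>) * cos (S c \<omega>) = (sin (S c \<omega> + s * H \<omega>) - sin (S c \<omega> - s * H \<omega>)) / 2"
      "cos (s * H \<omega>) * sin (S c \<omega>) = (sin (S c \<omega> + s * H \<omega>) + sin (S c \<omega> - s * H \<omega>)) / 2"
      "sin (s * H \<omega>) * sin (S c \<omega>) = (cos (S c \<omega> - s * H \<omega>) - cos (S c \<omega> + s * H \<omega>)) / 2" for s \<omega>
      by (simp_all add: cos_add cos_diff sin_add sin_diff)
    show "(\<integral>\<omega>. indicator B (H \<omega>) * (cos (S c \<omega>) - exp (- q c / 2)) \<partial>M) = 0"
    proof (rule indicator_integral_eq_0_of_char[OF _ _ _ _ that])
      show "integrable M (\<lambda>\<omega>. cos (S c \<omega>) - exp (- q c / 2))" by (intro Bochner_Integration.integrable_diff ints) auto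
      show "(\<integral>\<omega>. cos (s * H \<omega>) * (cos (S c \<omega>) - exp (- q c / 2)) \<partial>M) = 0" for s
        unfolding right_diff_distrib trig
        by (simp add: ints CF CFm CH exp_add[symmetric] add_divide_distrib[symmetric])
      show "(\<integral>\<omega>. sin (s * H \<omega>) * (cos (S c \<omega>) - exp (- q c / 2)) \<partial>M) = 0" for s
        unfolding right_diff_distrib trig by (simp add: ints CF CFm CH)
    qed simp
    show "(\<integral>\<omega>. indicator B (H \<omega>) * sin (S c \<omega>) \<partial>M) = 0"
      by (rule indicator_integral_eq_0_of_char[OF _ _ _ _ that])
        (simp_all add: ints trig CF CFm)
  qed
  \<comment> \<open>The roles are exchanged: the weight is now the centred indicator of an event of
    \<open>H\<close>, tested against linear combinations of \<open>Y\<close>. This reaches every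
    event generated by \<open>Y\<close>.\<close>
  have indep: "(LINT \<omega>:A|M. indicator B (H \<omega>) - prob (H -` B \<inter> space M)) = 0"
    if B: "B \<in> sets borel" and A: "A \<in> sigma_sets (space M) {Y i -` C \<inter> space M | i C. i \<in> UNIV \<and> C \<in> sets borel}" for A B
  proof (rule set_integral_eq_0_of_char[OF _ _ _ _ A])
    let ?v = "\<lambda>\<omega>. indicator B (H \<omega>) - prob (H -` B \<inter> space M)"
    have iB: "integrable M (\<lambda>\<omega>. indicator B (H \<omega>) :: real)"
      using B by (intro integrable_const_bound[where B = 1]) (auto simp: indicator_def)
    have PB: "(\<integral>\<omega>. indicator B (H \<omega>) \<partial>M) = prob (H -` B \<inter> space M)"
    proof -
      have "(\<integral>\<omega>. indicat_real B (H \<omega>) \<partial>M) = (\<integral>\<omega>. indicat_real (H -` B \<inter> space M) \<omega> \<partial>M)"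
        by (intro Bochner_Integration.integral_cong) (auto simp: indicator_def)
      then show ?thesis by simp
    qed
    show "integrable M ?v" using iB by simp
    have red: "(\<Sum>i\<in>J. c i * Y i \<omega>) = S (\<lambda>i. if i \<in> J then c i else 0) \<omega>" if "finite J" for J c \<omega>
    proof -
      have "(\<Sum>i\<in>J. c i * Y i \<omega>) = (\<Sum>i\<in>J \<inter> {..<n}. c i * Y i \<omega>)"
        using that by (intro sum.mono_neutral_right) (auto simp: Y_def)
      also have "\<dots> = S (\<lambda>i. if i \<in> J then c i else 0) \<omega>"
        unfolding S_def by (intro sum.mono_neutral_cong_left) (auto simp: that)
      finally show ?thesis .
    qed
    have "(\<integral>\<omega>. cos (S c \<omega>) * ?v \<omega> \<partial>M) = 0" "(\<integral>\<omega>. sin (S c \<omega>) * ?v \<omega> \<partial>M) = 0" for c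
    proof -
      have iBc: "integrable M (\<lambda>\<omega>. indicator B (H \<omega>) * cos (S c \<omega>))" "integrable M (\<lambda>\<omega>. indicator B (H \<omega>) * sin (S c \<omega>))"
        using B by (intro integrable_bounded_mult[where c = 1] ints; simp add: indicator_def)+
      have "(\<integral>\<omega>. indicator B (H \<omega>) * cos (S c \<omega>) \<partial>M) = prob (H -` B \<inter> space M) * exp (- q c / 2)"
        using BH(1)[OF B, of c] iBc iB by (simp add: right_diff_distrib PB)
      moreover have "(\<integral>\<omega>. cos (S c \<omega>) * ?v \<omega> \<partial>M) =
          (\<integral>\<omega>. indicator B (H \<omega>) * cos (S c \<omega>) - prob (H -` B \<inter> space M) * cos (S c \<omega>) \<partial>M)"
        by (intro Bochner_Integration.integral_cong) (auto simp: algebra_simps)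
      ultimately show "(\<integral>\<omega>. cos (S c \<omega>) * ?v \<omega> \<partial>M) = 0"
        using iBc by (simp add: ints CF0)
      have "(\<integral>\<omega>. sin (S c \<omega>) * ?v \<omega> \<partial>M) =
          (\<integral>\<omega>. indicator B (H \<omega>) * sin (S c \<omega>) - prob (H -` B \<inter> space M) * sin (S c \<omega>) \<partial>M)"
        by (intro Bochner_Integration.integral_cong) (auto simp: algebra_simps)
      then show "(\<integral>\<omega>. sin (S c \<omega>) * ?v \<omega> \<partial>M) = 0"
        using iBc BH(2)[OF B, of c] by (simp add: ints CF0)
    qed
    then show "(\<integral>\<omega>. cos (\<Sum>t\<in>J. c t * Y t \<omega>) * ?v \<omega> \<partial>M) = 0"
      "(\<integral>\<omega>. sin (\<Sum>t\<in>J. c t * Y t \<omega>) * ?v \<omega> \<partial>M) = 0" if "finite J" for J c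
      by (simp_all add: red[OF that])
  qed simp
  have Yv[measurable]: "(\<lambda>\<omega> i. Y i \<omega>) \<in> M \<rightarrow>\<^sub>M N"
    unfolding N_def by (rule measurable_PiM_single') auto
  \<comment> \<open>Independence in the form that Fubini's theorem needs.\<close>
  have law: "distr M borel H \<Otimes>\<^sub>M distr M N (\<lambda>\<omega> i. Y i \<omega>) = distr M (borel \<Otimes>\<^sub>M N) (\<lambda>\<omega>. (H \<omega>, \<lambda>i. Y i \<omega>))"
  proof (rule pair_measure_eqI)
    show "sigma_finite_measure (distr M borel H)" "sigma_finite_measure (distr M N (\<lambda>\<omega> i. Y i \<omega>))"
      by (auto intro!: prob_space_imp_sigma_finite prob_space_distr)
    show "sets (distr M borel H \<Otimes>\<^sub>M distr M N (\<lambda>\<omega> i. Y i \<omega>)) = sets (distr M (borel \<Otimes>\<^sub>M N) (\<lambda>\<omega>. (H \<omega>, \<lambda>i. Y i \<omega>)))"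
      by simp
    fix B C assume "B \<in> sets (distr M borel H)" "C \<in> sets (distr M N (\<lambda>\<omega> i. Y i \<omega>))"
    then have B[measurable]: "B \<in> sets borel" and C[measurable]: "C \<in> sets N" by auto
    let ?A = "(\<lambda>\<omega> i. Y i \<omega>) -` C \<inter> space M" and ?D = "H -` B \<inter> space M"
    let ?gen = "{Y i -` C \<inter> space M | i C. i \<in> UNIV \<and> C \<in> sets borel}"
    have A: "?A \<in> sets M" "?D \<in> sets M" using measurable_sets[OF Yv C] by auto
    have gp: "?gen \<subseteq> Pow (space M)" by auto
    \<comment> \<open>Measurability for the \<sigma>-field generated by the coordinates of
      \<open>Y\<close> places the event \<open>Y \<in> C\<close> within the scope of
      \<open>indep\<close>.\<close>
    have "(\<lambda>\<omega> i. Y i \<omega>) \<in> sigma (space M) ?gen \<rightarrow>\<^sub>M N"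
      unfolding N_def
    proof (rule measurable_PiM_single')
      show "Y i \<in> borel_measurable (sigma (space M) ?gen)" for i
      proof (rule measurableI)
        fix D :: "real set" assume "D \<in> sets borel"
        then have "Y i -` D \<inter> space M \<in> sigma_sets (space M) ?gen"
          by (intro sigma_sets.Basic) blast
        then show "Y i -` D \<inter> space (sigma (space M) ?gen) \<in> sets (sigma (space M) ?gen)"
          by (simp only: space_measure_of[OF gp] sets_measure_of[OF gp])
      qed simp
    qed simp
    from measurable_sets[OF this C] have "?A \<in> sigma_sets (space M) ?gen"
      by (simp only: space_measure_of[OF gp] sets_measure_of[OF gp])
    from indep[OF B this] have "(\<integral>\<omega>. indicator ?A \<omega> * (indicator B (H \<omega>) - prob ?D) \<partial>M) = 0"
      by (simp add: set_lebesgue_integral_def)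
    moreover have "(\<integral>\<omega>. indicator ?A \<omega> * (indicator B (H \<omega>) - prob ?D) \<partial>M)
        = (\<integral>\<omega>. indicator (?D \<inter> ?A) \<omega> - prob ?D * indicator ?A \<omega> \<partial>M)"
      by (intro Bochner_Integration.integral_cong) (auto simp: indicator_def)
    moreover have "\<dots> = prob (?D \<inter> ?A) - prob ?D * prob ?A"
      using A by (subst Bochner_Integration.integral_diff) (auto simp: less_top[symmetric])
    ultimately have "prob (?D \<inter> ?A) = prob ?D * prob ?A" by simp
    moreover have "(\<lambda>\<omega>. (H \<omega>, \<lambda>i. Y i \<omega>)) -` (B \<times> C) \<inter> space M = ?D \<inter> ?A" by auto
    ultimately show "emeasure (distr M borel H) B * emeasure (distr M N (\<lambda>\<omega> i. Y i \<omega>)) C =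
        emeasure (distr M (borel \<Otimes>\<^sub>M N) (\<lambda>\<omega>. (H \<omega>, \<lambda>i. Y i \<omega>))) (B \<times> C)"
      by (simp add: emeasure_distr emeasure_eq_measure ennreal_mult)
  qed
  have "(\<integral>\<omega>. cos (t * (H \<omega> / \<sigma>)) \<partial>M) = exp (- t\<^sup>2 / 2)" "(\<integral>\<omega>. sin (t * (H \<omega> / \<sigma>)) \<partial>M) = 0" for t
    using CH[of "t / \<sigma>"] \<sigma>(1) by (simp_all add: power_divide)
  then have "distributed M lborel (\<lambda>\<omega>. H \<omega> / \<sigma>) std_normal_density"
    by (intro std_normal_of_char) auto
  then have Hn: "distributed M lborel H (normal_density 0 \<sigma>)"
    using normal_standard_normal_convert[of \<sigma> H 0] \<sigma> by simp
  note fD = Cb_inftyD[OF f]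
  obtain C where C: "\<And>x. \<bar>f x\<bar> \<le> C" using fD(3) by (auto simp: bounded_iff)
  have "\<exists>C. \<forall>x. \<bar>partial i f x\<bar> \<le> C" if "i < n" for i using fD(5)[OF that] by (auto simp: bounded_iff)
  then obtain C' where C': "\<And>i x. i < n \<Longrightarrow> \<bar>partial i f x\<bar> \<le> C' i" by metis
  have pc: "partial i f x = partial i f y" if "i < n" "\<forall>j<n. x j = y j" for i x y
    by (rule partial_cong[OF fD(1) that(2,1)])
  have fm[measurable]: "f \<in> borel_measurable N"
    using borel_measurable_continuous_onI[OF fD(2)] by (simp add: measurable_cong_sets[OF sN refl])
  have pm: "partial i f \<in> borel_measurable N" if "i < n" for i
    using borel_measurable_continuous_onI[OF fD(4)[OF that]] by (simp add: measurable_cong_sets[OF sN refl])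
  define L where "L x y = (\<lambda>i. a i * x + y i)" for x :: real and y :: "nat \<Rightarrow> real"
  \<comment> \<open>For fixed \<open>y\<close> this is the integrand of Stein's identity for
    \<open>x \<mapsto> f (L x y)\<close>, whose derivative is the sum of
    \<open>a i * partial i f\<close>. At \<open>x = H\<close> and \<open>y = Y\<close>, the point
    \<open>L x y\<close> has the coordinates \<open>G i\<close> below \<open>n\<close>.\<close>
  define F where "F x y = f (L x y) * x - \<sigma>\<^sup>2 * (\<Sum>i<n. a i * partial i f (L x y))" for x y
  have comp: "(\<lambda>y. y i) \<in> borel_measurable N" for i unfolding N_def by simp
  have Lm: "(\<lambda>p. L (fst p) (snd p)) \<in> borel \<Otimes>\<^sub>M N \<rightarrow>\<^sub>M N"
    unfolding L_def using comp
    by (subst (2) N_def) (rule measurable_PiM_single', auto intro!: borel_measurable_add borel_measurable_times measurable_compose[OF measurable_snd])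
  have Fm: "(\<lambda>p. F (fst p) (snd p)) \<in> borel_measurable (borel \<Otimes>\<^sub>M N)"
    unfolding F_def using measurable_compose[OF Lm fm] measurable_compose[OF Lm pm]
    by (intro borel_measurable_diff borel_measurable_times borel_measurable_sum) auto
  have LG: "f (L (H \<omega>) (\<lambda>i. Y i \<omega>)) = f (\<lambda>i. G i \<omega>)"
    "i < n \<Longrightarrow> partial i f (L (H \<omega>) (\<lambda>i. Y i \<omega>)) = partial i f (\<lambda>i. G i \<omega>)" for \<omega> i
    by (auto intro!: fD(1) pc simp: L_def Y_def)
  have HYm: "(\<lambda>\<omega>. (H \<omega>, \<lambda>i. Y i \<omega>)) \<in> M \<rightarrow>\<^sub>M borel \<Otimes>\<^sub>M N" by measurable
  have LGm: "(\<lambda>\<omega>. L (H \<omega>) (\<lambda>i. Y i \<omega>)) \<in> M \<rightarrow>\<^sub>M N"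
    using measurable_compose[OF HYm Lm] by simp
  have i1: "integrable M (\<lambda>\<omega>. f (\<lambda>i. G i \<omega>) * H \<omega>)"
    using measurable_compose[OF LGm fm] C L2_integrable[OF H]
    by (intro integrable_bounded_mult[where c = C]) (auto simp: LG)
  have i2: "integrable M (\<lambda>\<omega>. partial i f (\<lambda>i. G i \<omega>))" if "i < n" for i
    using measurable_compose[OF LGm pm[OF that]] C'[OF that]
    by (intro integrable_const_bound[where B = "C' i"]) (auto simp: LG(2)[OF that])
  have FHY: "F (H \<omega>) (\<lambda>i. Y i \<omega>) = f (\<lambda>i. G i \<omega>) * H \<omega> - \<sigma>\<^sup>2 * (\<Sum>i<n. a i * partial i f (\<lambda>i. G i \<omega>))" for \<omega>
    by (simp add: F_def LG)
  have iF: "integrable M (\<lambda>\<omega>. F (H \<omega>) (\<lambda>i. Y i \<omega>))"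
    unfolding FHY
    by (intro Bochner_Integration.integrable_diff i1 integrable_mult_right Bochner_Integration.integrable_sum i2) simp
  have inner: "(\<integral>x. F x y \<partial>distr M borel H) = 0" for y
  proof -
    have m: "(\<lambda>x. F x y) \<in> borel_measurable borel"
    proof -
      have "y \<in> space N" by (simp add: N_def space_PiM)
      then show ?thesis using measurable_compose[OF measurable_Pair2'[of y N borel] Fm] by simp
    qed
    then have "(\<integral>x. F x y \<partial>distr M borel H) = (\<integral>\<omega>. F (H \<omega>) y \<partial>M)" by (intro integral_distr) auto
    also have "\<dots> = (\<integral>x. normal_density 0 \<sigma> x * F x y \<partial>lborel)"
      using m by (intro distributed_integral[OF Hn, symmetric]) auto
    also have "\<dots> = 0"
      unfolding F_def
    proof (rule normal_density_stein[OF \<sigma>(1)])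
      show "((\<lambda>x. f (L x y)) has_real_derivative (\<Sum>i<n. a i * partial i f (L x y))) (at x)" for x
        unfolding L_def by (rule has_real_derivative_along_line[OF fD(6,4,1)]) (auto intro: pc)
      have "continuous_on UNIV (\<lambda>x. L x y)"
        by (rule continuous_on_coordinatewise_then_product) (auto simp: L_def intro!: continuous_intros)
      then show "continuous_on UNIV (\<lambda>x. \<Sum>i<n. a i * partial i f (L x y))"
        by (intro continuous_on_sum continuous_on_mult continuous_on_const continuous_on_compose2[OF fD(4)]) auto
      show "\<bar>f (L x y)\<bar> \<le> C" for x by (rule C)
      show "\<bar>\<Sum>i<n. a i * partial i f (L x y)\<bar> \<le> (\<Sum>i<n. \<bar>a i\<bar> * C' i)" for x
        by (rule order_trans[OF sum_abs], rule sum_mono) (auto simp: abs_mult intro!: mult_left_mono C')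
    qed
    finally show ?thesis .
  qed
  interpret pair_prob_space "distr M borel H" "distr M N (\<lambda>\<omega> i. Y i \<omega>)"
    by (simp add: pair_prob_space_def pair_sigma_finite_def prob_space_distr prob_space_imp_sigma_finite)
  have "(\<integral>\<omega>. F (H \<omega>) (\<lambda>i. Y i \<omega>) \<partial>M) =
      (\<integral>p. F (fst p) (snd p) \<partial>distr M (borel \<Otimes>\<^sub>M N) (\<lambda>\<omega>. (H \<omega>, \<lambda>i. Y i \<omega>)))"
    by (subst integral_distr[OF HYm Fm]) simp
  also have "\<dots> = (\<integral>y. (\<integral>x. F x y \<partial>distr M borel H) \<partial>distr M N (\<lambda>\<omega> i. Y i \<omega>))"
  proof -
    have "integrable (distr M (borel \<Otimes>\<^sub>M N) (\<lambda>\<omega>. (H \<omega>, \<lambda>i. Y i \<omega>))) (\<lambda>p. F (fst p) (snd p))"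
      using iF by (subst integrable_distr_eq[OF HYm Fm]) simp
    then show ?thesis unfolding law[symmetric]
      by (subst integral_snd) (auto simp: case_prod_beta')
  qed
  finally have "(\<integral>\<omega>. F (H \<omega>) (\<lambda>i. Y i \<omega>) \<partial>M) = 0" by (simp add: inner)
  then have "(\<integral>\<omega>. f (\<lambda>i. G i \<omega>) * H \<omega> \<partial>M) = \<sigma>\<^sup>2 * (\<Sum>i<n. a i * (\<integral>\<omega>. partial i f (\<lambda>i. G i \<omega>) \<partial>M))"
  proof -
    assume eq0: "(\<integral>\<omega>. F (H \<omega>) (\<lambda>i. Y i \<omega>) \<partial>M) = 0"
    have ia: "integrable M (\<lambda>\<omega>. a i * partial i f (\<lambda>i. G i \<omega>))" if "i < n" for i
      using i2[OF that] by (rule integrable_mult_right)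
    have iS: "integrable M (\<lambda>\<omega>. \<sigma>\<^sup>2 * (\<Sum>i<n. a i * partial i f (\<lambda>i. G i \<omega>)))"
      by (intro integrable_mult_right[OF Bochner_Integration.integrable_sum] ia) simp
    have "(\<integral>\<omega>. \<sigma>\<^sup>2 * (\<Sum>i<n. a i * partial i f (\<lambda>i. G i \<omega>)) \<partial>M) =
        \<sigma>\<^sup>2 * (\<Sum>i<n. \<integral>\<omega>. a i * partial i f (\<lambda>i. G i \<omega>) \<partial>M)"
      by (subst Bochner_Integration.integral_sum[symmetric]) (auto intro: i2)
    then show ?thesis
      using eq0 Bochner_Integration.integral_diff[OF i1 iS] by (simp add: FHY)
  qed
  \<comment> \<open>By the choice of \<open>a\<close>,
    \<open>\<sigma>\<^sup>2 * a i = E(G i H)\<close>.\<close>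
  also have "\<dots> = (\<Sum>i<n. (\<integral>\<omega>. partial i f (\<lambda>j. G j \<omega>) \<partial>M) * (\<integral>\<omega>. G i \<omega> * H \<omega> \<partial>M))"
    unfolding sum_distrib_left using \<sigma>(1) by (intro sum.cong) (auto simp: a_def)
  finally show ?thesis .
qed

section \<open>The inner product on \<open>L\<^sub>\<mu>\<close> and the Wiener integral\<close>

text \<open>The hypotheses in the integrated form in which they are used.
  \<open>inner_indicator\<close> is the only assumption that links \<mu> to the law
  \<open>P\<close>.\<close>

locale covariance_measure = prob_space P
  for P :: "(real \<Rightarrow> real) measure" and T :: real and \<mu> :: "(real \<times> real) set \<Rightarrow> ereal" +
  assumes T_pos: "T > 0"
    and finite_pos: "finite_measure (pos_variation (square_borel T) \<mu>)"
    and finite_neg: "finite_measure (neg_variation (square_borel T) \<mu>)"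
    and linear: "L_mu_linear T \<mu>"
    and coordinate_L2: "t \<in> {0..T} \<Longrightarrow> (\<lambda>\<omega>. \<omega> t) \<in> L2 P"
    and coordinate_mean: "t \<in> {0..T} \<Longrightarrow> (\<integral>\<omega>. \<omega> t \<partial>P) = 0"
    and inner_indicator: "s \<in> {0..T} \<Longrightarrow> t \<in> {0..T} \<Longrightarrow>
      inner_H T \<mu> (indicator {0..s}) (indicator {0..t}) = (\<integral>\<omega>. \<omega> s * \<omega> t \<partial>P)"
    and coordinate_cf: "finite J \<Longrightarrow> J \<subseteq> {0..T} \<Longrightarrow> centred_gaussian_cf P (\<lambda>\<omega>. \<Sum>t\<in>J. c t * \<omega> t)"
begin

section \<open>The bilinear form on \<open>L_mu\<close>\<close>

abbreviation "BT \<equiv> restrict_space borel {0..T} :: real measure"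
abbreviation "Lm \<equiv> L_mu T \<mu>"
abbreviation "ip \<equiv> inner_H T \<mu>"
abbreviation "pos \<equiv> pos_variation (square_borel T) \<mu>"
abbreviation "neg \<equiv> neg_variation (square_borel T) \<mu>"
abbreviation "tot \<equiv> total_variation (square_borel T) \<mu>"

lemma space_square [simp]:
  "space pos = {0..T} \<times> {0..T}" "space neg = {0..T} \<times> {0..T}" "space tot = {0..T} \<times> {0..T}"
proof -
  have "space (square_borel T) = {0..T} \<times> {0..T}"
    by (simp add: square_borel_def space_restrict_space)
  moreover have "space pos = space (square_borel T)" "space neg = space (square_borel T)"
      "space tot = space (square_borel T)"
    by (rule sets_eq_imp_space_eq, simp)+
  ultimately show "space pos = {0..T} \<times> {0..T}" "space neg = {0..T} \<times> {0..T}"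
      "space tot = {0..T} \<times> {0..T}"
    by simp_all
qed

lemma tensor_measurable [measurable]:
  fixes \<phi> \<psi> :: "real \<Rightarrow> real"
  assumes [measurable]: "\<phi> \<in> borel_measurable BT" "\<psi> \<in> borel_measurable BT"
  shows "(\<lambda>p. \<phi> (fst p) * \<psi> (snd p)) \<in> borel_measurable (square_borel T)"
proof -
  have fst: "fst \<in> square_borel T \<rightarrow>\<^sub>M BT" and snd: "snd \<in> square_borel T \<rightarrow>\<^sub>M BT"
    unfolding square_borel_def
    by (auto intro!: measurable_restrict_space3 borel_measurable_continuous_onI continuous_intros)
  show ?thesis
    using measurable_compose[OF fst assms(1)] measurable_compose[OF snd assms(2)]
    by (rule borel_measurable_times)
qed

lemma L_mu_measurable: "\<phi> \<in> Lm \<Longrightarrow> \<phi> \<in> borel_measurable BT"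
  by (simp add: L_mu_def)

lemma L_mu_comb: "\<phi> \<in> Lm \<Longrightarrow> \<psi> \<in> Lm \<Longrightarrow> (\<lambda>t. a * \<phi> t + b * \<psi> t) \<in> Lm"
  using linear by (auto simp: L_mu_linear_def)

text \<open>Solidity of the space, the source of membership for absolute values, positive parts and
  monotone approximants.\<close>

lemma L_mu_mono:
  assumes "\<phi> \<in> Lm" "\<psi> \<in> borel_measurable BT" "\<And>t. t \<in> {0..T} \<Longrightarrow> \<bar>\<psi> t\<bar> \<le> \<bar>\<phi> t\<bar>"
  shows "\<psi> \<in> Lm"
proof -
  have "abs_norm_sq T \<mu> \<psi> \<le> abs_norm_sq T \<mu> \<phi>"
    unfolding abs_norm_sq_def using assms(3)
    by (intro nn_integral_mono ennreal_leI mult_mono) auto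
  then show ?thesis using assms by (auto simp: L_mu_def intro: le_less_trans)
qed

lemma L_mu_abs: "\<phi> \<in> Lm \<Longrightarrow> (\<lambda>t. \<bar>\<phi> t\<bar>) \<in> Lm"
  by (rule L_mu_mono[of \<phi>]) (auto dest: L_mu_measurable)

lemma tot_finite: "emeasure tot ({0..T} \<times> {0..T}) < \<infinity>"
proof -
  interpret p: finite_measure pos by (rule finite_pos)
  interpret n: finite_measure neg by (rule finite_neg)
  have "{0..T} \<times> {0..T} \<in> sets (square_borel T)"
    using sets.top[of tot] by simp
  then show ?thesis
    by (simp add: emeasure_total_variation p.emeasure_eq_measure n.emeasure_eq_measure)
qed

lemma L_mu_bounded:
  assumes "\<phi> \<in> borel_measurable BT" "\<And>t. t \<in> {0..T} \<Longrightarrow> \<bar>\<phi> t\<bar> \<le> C"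
  shows "\<phi> \<in> Lm"
proof (rule L_mu_mono)
  have "abs_norm_sq T \<mu> (\<lambda>_. C) < \<infinity>"
    unfolding abs_norm_sq_def using tot_finite by (simp add: ennreal_mult_less_top)
  then show "(\<lambda>_. C) \<in> Lm" by (simp add: L_mu_def)
  show "\<bar>\<phi> t\<bar> \<le> \<bar>C\<bar>" if "t \<in> {0..T}" for t using assms(2)[OF that] by simp
qed fact

lemma const_L_mu: "(\<lambda>_. c) \<in> Lm"
  by (rule L_mu_bounded[where C = "\<bar>c\<bar>"]) auto

text \<open>Linearity of the space stands in for a Cauchy-Schwarz inequality:
  \<open>|\<phi>| + |\<psi>|\<close> belongs to it, and the tensor square of this sum dominates the
  mixed product.\<close>

lemma tensor_nn_integral:
  assumes "\<phi> \<in> Lm" "\<psi> \<in> Lm"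
  shows "(\<integral>\<^sup>+ p. ennreal \<bar>\<phi> (fst p) * \<psi> (snd p)\<bar> \<partial>tot) < \<infinity>"
proof -
  have "(\<lambda>t. 1 * \<bar>\<phi> t\<bar> + 1 * \<bar>\<psi> t\<bar>) \<in> Lm" using assms by (intro L_mu_comb L_mu_abs)
  then have "abs_norm_sq T \<mu> (\<lambda>t. \<bar>\<phi> t\<bar> + \<bar>\<psi> t\<bar>) < \<infinity>" by (simp add: L_mu_def)
  moreover have "(\<integral>\<^sup>+ p. ennreal \<bar>\<phi> (fst p) * \<psi> (snd p)\<bar> \<partial>tot) \<le> abs_norm_sq T \<mu> (\<lambda>t. \<bar>\<phi> t\<bar> + \<bar>\<psi> t\<bar>)"
    unfolding abs_norm_sq_def
    by (intro nn_integral_mono ennreal_leI) (auto simp: abs_mult intro!: mult_mono)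
  ultimately show ?thesis by (rule le_less_trans[rotated])
qed

lemma tensor_integrable:
  assumes "\<phi> \<in> Lm" "\<psi> \<in> Lm"
  shows "integrable pos (\<lambda>p. \<phi> (fst p) * \<psi> (snd p))" "integrable neg (\<lambda>p. \<phi> (fst p) * \<psi> (snd p))"
proof -
  have [measurable]: "\<phi> \<in> borel_measurable BT" "\<psi> \<in> borel_measurable BT"
    using assms by (auto dest: L_mu_measurable)
  have "pos \<le> tot" "neg \<le> tot"
    by (auto simp: le_measure le_fun_def emeasure_total_variation emeasure_notin_sets)
  then have "nn_integral pos f \<le> nn_integral tot f" "nn_integral neg f \<le> nn_integral tot f" for f
    by (auto intro!: nn_integral_mono_measure)
  note * = le_less_trans[OF this(1) tensor_nn_integral[OF assms]]
    le_less_trans[OF this(2) tensor_nn_integral[OF assms]]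
  show "integrable pos (\<lambda>p. \<phi> (fst p) * \<psi> (snd p))" "integrable neg (\<lambda>p. \<phi> (fst p) * \<psi> (snd p))"
    using * by (auto intro!: integrableI_bounded)
qed

lemma ip_eq: "ip \<phi> \<psi> = (\<integral>p. \<phi> (fst p) * \<psi> (snd p) \<partial>pos) - (\<integral>p. \<phi> (fst p) * \<psi> (snd p) \<partial>neg)"
  by (simp add: inner_H_def signed_integral_def)

lemma ip_comb_left:
  assumes "\<phi> \<in> Lm" "\<psi> \<in> Lm" "\<xi> \<in> Lm"
  shows "ip (\<lambda>t. a * \<phi> t + b * \<psi> t) \<xi> = a * ip \<phi> \<xi> + b * ip \<psi> \<xi>"
proof -
  have "(\<lambda>p. (a * \<phi> (fst p) + b * \<psi> (fst p)) * \<xi> (snd p)) =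
      (\<lambda>p. a * (\<phi> (fst p) * \<xi> (snd p)) + b * (\<psi> (fst p) * \<xi> (snd p)))"
    by (auto simp: algebra_simps)
  then show ?thesis
    using tensor_integrable[OF assms(1,3)] tensor_integrable[OF assms(2,3)]
    by (simp add: ip_eq algebra_simps)
qed

lemma ip_comb_right:
  assumes "\<phi> \<in> Lm" "\<psi> \<in> Lm" "\<xi> \<in> Lm"
  shows "ip \<xi> (\<lambda>t. a * \<phi> t + b * \<psi> t) = a * ip \<xi> \<phi> + b * ip \<xi> \<psi>"
proof -
  have "(\<lambda>p. \<xi> (fst p) * (a * \<phi> (snd p) + b * \<psi> (snd p))) =
      (\<lambda>p. a * (\<xi> (fst p) * \<phi> (snd p)) + b * (\<xi> (fst p) * \<psi> (snd p)))"
    by (auto simp: algebra_simps)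
  then show ?thesis
    using tensor_integrable[OF assms(3,1)] tensor_integrable[OF assms(3,2)]
    by (simp add: ip_eq algebra_simps)
qed

text \<open>Dominated convergence under each of the two variations. Dominated pointwise limits are
  the convenient mode of convergence here, since they pass through the form before anything is known
  about its sign.\<close>

lemma ip_tendsto:
  assumes \<phi>s: "\<And>k::nat. \<phi>s k \<in> borel_measurable BT" and \<psi>s: "\<And>k. \<psi>s k \<in> borel_measurable BT"
    and \<phi>: "\<phi> \<in> borel_measurable BT" and \<psi>: "\<psi> \<in> borel_measurable BT"
    and dom: "\<eta> \<in> Lm" "\<And>k t. t \<in> {0..T} \<Longrightarrow> \<bar>\<phi>s k t\<bar> \<le> \<eta> t"
      "\<zeta> \<in> Lm" "\<And>k t. t \<in> {0..T} \<Longrightarrow> \<bar>\<psi>s k t\<bar> \<le> \<zeta> t"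
    and lim: "\<And>t. t \<in> {0..T} \<Longrightarrow> (\<lambda>k. \<phi>s k t) \<longlonglongrightarrow> \<phi> t"
      "\<And>t. t \<in> {0..T} \<Longrightarrow> (\<lambda>k. \<psi>s k t) \<longlonglongrightarrow> \<psi> t"
  shows "(\<lambda>k. ip (\<phi>s k) (\<psi>s k)) \<longlonglongrightarrow> ip \<phi> \<psi>"
  unfolding ip_eq
proof (rule tendsto_diff)
  note [measurable] = assms(1-4)
  have bd: "\<bar>\<phi>s k s * \<psi>s k t\<bar> \<le> \<eta> s * \<zeta> t" if "s \<in> {0..T}" "t \<in> {0..T}" for k s t
    unfolding abs_mult using dom(2)[OF that(1), of k] dom(4)[OF that(2), of k] by (intro mult_mono) auto
  show "(\<lambda>k. \<integral>p. \<phi>s k (fst p) * \<psi>s k (snd p) \<partial>pos) \<longlonglongrightarrow> (\<integral>p. \<phi> (fst p) * \<psi> (snd p) \<partial>pos)"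
    by (rule integral_dominated_convergence[where w = "\<lambda>p. \<eta> (fst p) * \<zeta> (snd p)"])
      (auto intro!: tensor_integrable dom AE_I2 tendsto_mult lim bd)
  show "(\<lambda>k. \<integral>p. \<phi>s k (fst p) * \<psi>s k (snd p) \<partial>neg) \<longlonglongrightarrow> (\<integral>p. \<phi> (fst p) * \<psi> (snd p) \<partial>neg)"
    by (rule integral_dominated_convergence[where w = "\<lambda>p. \<eta> (fst p) * \<zeta> (snd p)"])
      (auto intro!: tensor_integrable dom AE_I2 tendsto_mult lim bd)
qed

text \<open>
  The graph of the Wiener integral, as the smallest linear relation that contains
  \<open>1\<^bsub>[0,t]\<^esub> \<mapsto> X\<^sub>t\<close> and is closed under dominated pointwise limits on one side and
  mean-square limits on the other. Induction over it replaces the density of step functions.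
\<close>

inductive wiener_rel :: "(real \<Rightarrow> real) \<Rightarrow> ((real \<Rightarrow> real) \<Rightarrow> real) \<Rightarrow> bool" where
  base: "t \<in> {0..T} \<Longrightarrow> wiener_rel (indicator {0..t}) (\<lambda>\<omega>. \<omega> t)"
| comb: "wiener_rel \<phi> Z \<Longrightarrow> wiener_rel \<psi> Y \<Longrightarrow>
    wiener_rel (\<lambda>t. a * \<phi> t + b * \<psi> t) (\<lambda>\<omega>. a * Z \<omega> + b * Y \<omega>)"
| lim: "(\<And>k::nat. wiener_rel (\<phi>s k) (Zs k)) \<Longrightarrow> \<phi> \<in> Lm \<Longrightarrow> \<eta> \<in> Lm \<Longrightarrow>
    (\<And>k t. t \<in> {0..T} \<Longrightarrow> \<bar>\<phi>s k t\<bar> \<le> \<eta> t) \<Longrightarrow>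
    (\<And>t. t \<in> {0..T} \<Longrightarrow> (\<lambda>k. \<phi>s k t) \<longlonglongrightarrow> \<phi> t) \<Longrightarrow>
    Z \<in> L2 P \<Longrightarrow> (\<lambda>k. \<integral>\<omega>. (Zs k \<omega> - Z \<omega>)\<^sup>2 \<partial>P) \<longlonglongrightarrow> 0 \<Longrightarrow> wiener_rel \<phi> Z"

lemma indicator_L_mu: "A \<in> sets borel \<Longrightarrow> indicator A \<in> Lm"
  by (rule L_mu_bounded[where C = 1], intro measurable_restrict_space1 borel_measurable_indicator)
    (auto simp: indicator_def)

lemma wiener_rel_mem: "wiener_rel \<phi> Z \<Longrightarrow> \<phi> \<in> Lm \<and> Z \<in> L2 P"
  by (induction rule: wiener_rel.induct) (auto intro: indicator_L_mu coordinate_L2 L_mu_comb L2_linear)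

lemma wiener_rel_L_mu: "wiener_rel \<phi> Z \<Longrightarrow> \<phi> \<in> Lm"
  and wiener_rel_L2: "wiener_rel \<phi> Z \<Longrightarrow> Z \<in> L2 P"
  using wiener_rel_mem by auto

section \<open>The graph of the Wiener integral is isometric\<close>

lemma expectation_comb:
  assumes "Z \<in> L2 P" "Y \<in> L2 P" "U \<in> L2 P"
  shows "(\<integral>\<omega>. (a * Z \<omega> + b * Y \<omega>) * U \<omega> \<partial>P) = a * (\<integral>\<omega>. Z \<omega> * U \<omega> \<partial>P) + b * (\<integral>\<omega>. Y \<omega> * U \<omega> \<partial>P)"
proof -
  have "(\<lambda>\<omega>. (a * Z \<omega> + b * Y \<omega>) * U \<omega>) = (\<lambda>\<omega>. a * (Z \<omega> * U \<omega>) + b * (Y \<omega> * U \<omega>))"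
    by (auto simp: algebra_simps)
  then show ?thesis using L2_mult_integrable[OF assms(1,3)] L2_mult_integrable[OF assms(2,3)] by simp
qed

text \<open>The identity is bilinear, and induction treats one argument at a time; with the first
  one fixed as an indicator this serves as base case for the induction in the first
  argument.\<close>

lemma wiener_rel_isometry_base:
  assumes "wiener_rel \<psi> Y" "s \<in> {0..T}"
  shows "(\<integral>\<omega>. Y \<omega> * \<omega> s \<partial>P) = ip (indicator {0..s}) \<psi>"
  using assms
proof (induction rule: wiener_rel.induct)
  case (base t)
  then show ?case using inner_indicator[of s t] by (simp add: mult.commute)
next
  case (comb \<phi> Z \<psi> Y a b)
  then show ?case
    using ip_comb_right[of \<phi> \<psi> "indicator {0..s}" a b] indicator_L_mu[of "{0..s}"]
      expectation_comb[of Z Y "\<lambda>\<omega>. \<omega> s" a b] coordinate_L2[of s]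
    by (simp add: wiener_rel_L_mu wiener_rel_L2)
next
  case (lim \<phi>s Zs \<phi> \<eta> Z)
  have i: "indicator {0..s} \<in> Lm" by (rule indicator_L_mu) simp
  have "(\<lambda>k. ip (indicator {0..s}) (\<phi>s k)) \<longlonglongrightarrow> ip (indicator {0..s}) \<phi>"
    by (rule ip_tendsto[where \<eta> = "indicator {0..s}" and \<zeta> = \<eta>])
      (use i lim in \<open>auto intro: L_mu_measurable wiener_rel_L_mu\<close>)
  moreover have "(\<lambda>k. \<integral>\<omega>. Zs k \<omega> * \<omega> s \<partial>P) \<longlonglongrightarrow> (\<integral>\<omega>. Z \<omega> * \<omega> s \<partial>P)"
    by (rule L2_tendsto_inner) (use lim coordinate_L2 in \<open>auto intro: wiener_rel_L2\<close>)
  ultimately show ?case using lim by (simp add: LIMSEQ_unique)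
qed

lemma wiener_rel_isometry:
  assumes "wiener_rel \<phi> Z" "wiener_rel \<psi> Y"
  shows "(\<integral>\<omega>. Z \<omega> * Y \<omega> \<partial>P) = ip \<phi> \<psi>"
  using assms
proof (induction rule: wiener_rel.induct)
  case (base t)
  then show ?case using wiener_rel_isometry_base[of \<psi> Y t] by (simp add: mult.commute)
next
  case (comb \<phi> Z \<phi>' Z' a b)
  then show ?case
    using ip_comb_left[of \<phi> \<phi>' \<psi> a b] expectation_comb[of Z Z' Y a b]
    by (simp add: wiener_rel_L_mu wiener_rel_L2)
next
  case (lim \<phi>s Zs \<phi> \<eta> Z)
  have "(\<lambda>k. ip (\<phi>s k) \<psi>) \<longlonglongrightarrow> ip \<phi> \<psi>"
    by (rule ip_tendsto[where \<eta> = \<eta> and \<zeta> = "\<lambda>t. \<bar>\<psi> t\<bar>"])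
      (use lim in \<open>auto intro: L_mu_measurable wiener_rel_L_mu L_mu_abs\<close>)
  moreover have "(\<lambda>k. \<integral>\<omega>. Zs k \<omega> * Y \<omega> \<partial>P) \<longlonglongrightarrow> (\<integral>\<omega>. Z \<omega> * Y \<omega> \<partial>P)"
    by (rule L2_tendsto_inner) (use lim in \<open>auto intro: wiener_rel_L2\<close>)
  ultimately show ?case using lim by (simp add: LIMSEQ_unique)
qed

lemma wiener_rel_diff:
  "wiener_rel \<phi> Z \<Longrightarrow> wiener_rel \<psi> Y \<Longrightarrow> wiener_rel (\<lambda>t. \<phi> t - \<psi> t) (\<lambda>\<omega>. Z \<omega> - Y \<omega>)"
  using wiener_rel.comb[of \<phi> Z \<psi> Y 1 "-1"] by simp

lemma wiener_rel_diff_sq: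
  assumes "wiener_rel \<phi> Z" "wiener_rel \<psi> Y"
  shows "(\<integral>\<omega>. (Z \<omega> - Y \<omega>)\<^sup>2 \<partial>P) = ip (\<lambda>t. \<phi> t - \<psi> t) (\<lambda>t. \<phi> t - \<psi> t)"
  using wiener_rel_isometry[OF wiener_rel_diff[OF assms] wiener_rel_diff[OF assms]]
  by (simp add: power2_eq_square)

text \<open>By the isometry the squared distance equals the form at
  \<open>\<phi> - \<phi> = 0\<close>. Hence the relation is a function up to null sets.\<close>

lemma wiener_rel_unique:
  assumes "wiener_rel \<phi> Z" "wiener_rel \<phi> Y"
  shows "AE \<omega> in P. Z \<omega> = Y \<omega>"
  using wiener_rel_diff_sq[OF assms] assms
  by (intro L2_diff_zero_AE_eq) (auto simp: ip_eq dest: wiener_rel_L2)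

section \<open>The graph is defined on all of \<open>L_mu\<close>\<close>

lemma ip_diff_tendsto_0:
  assumes \<phi>s: "\<And>k::nat. \<phi>s k \<in> Lm" "\<And>k. \<psi>s k \<in> Lm"
    and dom: "\<eta> \<in> Lm" "\<And>k t. t \<in> {0..T} \<Longrightarrow> \<bar>\<phi>s k t\<bar> \<le> \<eta> t" "\<And>k t. t \<in> {0..T} \<Longrightarrow> \<bar>\<psi>s k t\<bar> \<le> \<eta> t"
    and lim: "\<And>t. t \<in> {0..T} \<Longrightarrow> (\<lambda>k. \<phi>s k t) \<longlonglongrightarrow> \<phi> t"
      "\<And>t. t \<in> {0..T} \<Longrightarrow> (\<lambda>k. \<psi>s k t) \<longlonglongrightarrow> \<phi> t"
  shows "(\<lambda>k. ip (\<lambda>t. \<phi>s k t - \<psi>s k t) (\<lambda>t. \<phi>s k t - \<psi>s k t)) \<longlonglongrightarrow> 0"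
proof -
  have d: "\<bar>\<phi>s k t - \<psi>s k t\<bar> \<le> 1 * \<eta> t + 1 * \<eta> t" if "t \<in> {0..T}" for k t
    using dom(2,3)[OF that, of k] by linarith
  have l: "(\<lambda>k. \<phi>s k t - \<psi>s k t) \<longlonglongrightarrow> 0" if "t \<in> {0..T}" for t
    using tendsto_diff[OF lim(1)[OF that] lim(2)[OF that]] by simp
  have m: "(\<lambda>t. \<phi>s k t - \<psi>s k t) \<in> borel_measurable BT" for k
    using \<phi>s[THEN L_mu_measurable] by auto
  have "(\<lambda>k. ip (\<lambda>t. \<phi>s k t - \<psi>s k t) (\<lambda>t. \<phi>s k t - \<psi>s k t)) \<longlonglongrightarrow> ip (\<lambda>_. 0) (\<lambda>_. 0)"
    by (rule ip_tendsto[OF m m _ _ L_mu_comb[OF dom(1) dom(1)] d L_mu_comb[OF dom(1) dom(1)] d l l]) auto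
  then show ?thesis by (simp add: ip_eq)
qed

text \<open>If the \<open>Zs\<close> were not Cauchy, two index sequences tending to infinity would
  keep a fixed mean-square distance; by the isometry that distance is the form at a difference of
  two dominated sequences with the same pointwise limit, which tends to 0. Completeness then
  supplies the limit.\<close>

lemma wiener_rel_limit_exists:
  assumes rel: "\<And>k::nat. wiener_rel (\<phi>s k) (Zs k)" and \<phi>: "\<phi> \<in> Lm"
    and dom: "\<eta> \<in> Lm" "\<And>k t. t \<in> {0..T} \<Longrightarrow> \<bar>\<phi>s k t\<bar> \<le> \<eta> t"
    and lim: "\<And>t. t \<in> {0..T} \<Longrightarrow> (\<lambda>k. \<phi>s k t) \<longlonglongrightarrow> \<phi> t"
  shows "\<exists>Z. wiener_rel \<phi> Z"
proof -
  have "\<exists>N. \<forall>i\<ge>N. \<forall>j\<ge>N. (\<integral>\<omega>. (Zs i \<omega> - Zs j \<omega>)\<^sup>2 \<partial>P) < e" if "e > 0" for e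
  proof (rule ccontr)
    assume "\<not> ?thesis"
    then have "\<forall>N. \<exists>i\<ge>N. \<exists>j\<ge>N. (\<integral>\<omega>. (Zs i \<omega> - Zs j \<omega>)\<^sup>2 \<partial>P) \<ge> e" by (simp add: not_less)
    then obtain i j where ij: "\<And>N. i N \<ge> N" "\<And>N. j N \<ge> N"
      "\<And>N. (\<integral>\<omega>. (Zs (i N) \<omega> - Zs (j N) \<omega>)\<^sup>2 \<partial>P) \<ge> e" by metis
    have "filterlim i at_top at_top" "filterlim j at_top at_top"
      using ij by (auto intro!: filterlim_at_top_mono[OF filterlim_ident])
    then have "(\<lambda>N. ip (\<lambda>t. \<phi>s (i N) t - \<phi>s (j N) t) (\<lambda>t. \<phi>s (i N) t - \<phi>s (j N) t)) \<longlonglongrightarrow> 0"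
      using lim dom rel[THEN wiener_rel_L_mu]
      by (intro ip_diff_tendsto_0[where \<eta> = \<eta> and \<phi> = \<phi>])
        (auto intro: filterlim_compose[of "\<lambda>k. \<phi>s k _"])
    then have "(\<lambda>N. \<integral>\<omega>. (Zs (i N) \<omega> - Zs (j N) \<omega>)\<^sup>2 \<partial>P) \<longlonglongrightarrow> 0"
      by (simp add: wiener_rel_diff_sq[OF rel rel])
    from LIMSEQ_le_const[OF this, of e] show False using ij(3) \<open>e > 0\<close> by auto
  qed
  from L2_complete[OF wiener_rel_L2[OF rel] this]
  obtain Z where "Z \<in> L2 P" "(\<lambda>n. \<integral>\<omega>. (Zs n \<omega> - Z \<omega>)\<^sup>2 \<partial>P) \<longlonglongrightarrow> 0" by blast
  then show ?thesis using wiener_rel.lim[OF rel \<phi> dom lim] by blast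
qed

lemma wiener_rel_scale: "wiener_rel \<phi> Z \<Longrightarrow> wiener_rel (\<lambda>t. c * \<phi> t) (\<lambda>\<omega>. c * Z \<omega>)"
  using wiener_rel.comb[of \<phi> Z \<phi> Z c 0] by simp

lemma wiener_rel_zero: "wiener_rel (\<lambda>_. 0) (\<lambda>_. 0)"
  using wiener_rel_scale[OF wiener_rel.base[of 0], of 0] T_pos by simp

lemma wiener_rel_add:
  "wiener_rel \<phi> Z \<Longrightarrow> wiener_rel \<psi> Y \<Longrightarrow> wiener_rel (\<lambda>t. \<phi> t + \<psi> t) (\<lambda>\<omega>. Z \<omega> + Y \<omega>)"
  using wiener_rel.comb[of \<phi> Z \<psi> Y 1 1] by simp

text \<open>Dynkin's argument on the half-lines, whose traces on \<open>{0..T}\<close> are empty or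
  intervals \<open>{0..t}\<close>. Complements are differences from the indicator of
  \<open>{0..T}\<close>; disjoint unions are limits of finite sums dominated by 1.\<close>

lemma wiener_rel_indicator:
  assumes "A \<in> sets borel"
  shows "\<exists>Z. wiener_rel (indicator (A \<inter> {0..T})) Z"
proof -
  have "Int_stable (range (\<lambda>a::real. {..a}))"
  proof (rule Int_stableI, safe)
    fix a b :: real
    have "{..a} \<inter> {..b} = {..min a b}" by auto
    then show "{..a} \<inter> {..b} \<in> range (\<lambda>a::real. {..a})" by blast
  qed
  moreover have "range (\<lambda>a::real. {..a}) \<subseteq> Pow UNIV" by simp
  moreover have "A \<in> sigma_sets UNIV (range (\<lambda>a::real. {..a}))"
    using assms by (simp add: borel_eq_atMost)
  ultimately show ?thesis
  proof (induction rule: sigma_sets_induct_disjoint)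
    case (basic A)
    then obtain a where A: "A = {..a}" by auto
    show ?case
    proof (cases "a < 0")
      case True
      then have "A \<inter> {0..T} = {}" using A by auto
      then have "indicator (A \<inter> {0..T}) = (\<lambda>_. 0 :: real)" by (auto simp: fun_eq_iff)
      then show ?thesis using wiener_rel_zero by auto
    next
      case False
      then have "A \<inter> {0..T} = {0..min a T}" using A by auto
      then show ?thesis using wiener_rel.base[of "min a T"] False T_pos by auto
    qed
  next
    case empty
    have "indicator ({} \<inter> {0..T}) = (\<lambda>_. 0 :: real)" by (auto simp: fun_eq_iff)
    then show ?case using wiener_rel_zero by auto
  next
    case (compl A)
    then obtain Z where Z: "wiener_rel (indicator (A \<inter> {0..T})) Z" by auto
    have "indicator ((UNIV - A) \<inter> {0..T}) =
        (\<lambda>t. indicator {0..T} t - indicator (A \<inter> {0..T}) t :: real)"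
      by (auto simp: fun_eq_iff indicator_def)
    then show ?case using wiener_rel_diff[OF wiener_rel.base[of T] Z] T_pos by auto
  next
    case (union A)
    have "\<exists>Z. wiener_rel (indicator ((\<Union>i<k. A i) \<inter> {0..T})) Z" for k
    proof (induction k)
      case 0
      have "indicator ((\<Union>i<0. A i) \<inter> {0..T}) = (\<lambda>_. 0 :: real)" by (auto simp: fun_eq_iff)
      then show ?case using wiener_rel_zero by auto
    next
      case (Suc k)
      obtain Z Y where ZY: "wiener_rel (indicator ((\<Union>i<k. A i) \<inter> {0..T})) Z"
        "wiener_rel (indicator (A k \<inter> {0..T})) Y" using Suc union.IH by blast
      have "A i \<inter> A k = {}" if "i < k" for i
        using union.hyps(1) that unfolding disjoint_family_on_def by (metis UNIV_I less_irrefl)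
      then have "(\<Union>i<k. A i) \<inter> A k = {}" by blast
      then have "indicator ((\<Union>i<Suc k. A i) \<inter> {0..T}) =
          (\<lambda>t. indicator ((\<Union>i<k. A i) \<inter> {0..T}) t + indicator (A k \<inter> {0..T}) t :: real)"
        by (auto simp: fun_eq_iff indicator_def less_Suc_eq)
      then show ?case using wiener_rel_add[OF ZY] by auto
    qed
    then obtain Zs where Zs: "\<And>k. wiener_rel (indicator ((\<Union>i<k. A i) \<inter> {0..T})) (Zs k)" by metis
    have "A i \<in> sets borel" for i using union.hyps(2) by (auto simp: borel_eq_atMost)
    then have U: "(\<Union>i. A i) \<inter> {0..T} \<in> sets borel" by auto
    show ?case
    proof (rule wiener_rel_limit_exists[OF Zs indicator_L_mu[OF U], of "\<lambda>_. 1"])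
      show "(\<lambda>k. indicator ((\<Union>i<k. A i) \<inter> {0..T}) t :: real) \<longlonglongrightarrow> indicator ((\<Union>i. A i) \<inter> {0..T}) t" for t
      proof (cases "t \<in> (\<Union>i. A i)")
        case True
        then obtain i where "t \<in> A i" by auto
        then have "\<forall>\<^sub>F k in sequentially. indicator ((\<Union>i<k. A i) \<inter> {0..T}) t = (indicator ((\<Union>i. A i) \<inter> {0..T}) t :: real)"
          by (intro eventually_mono[OF eventually_gt_at_top[of i]]) (auto simp: indicator_def)
        then show ?thesis by (rule tendsto_eventually)
      qed (auto simp: indicator_def)
    qed (auto intro: const_L_mu simp: indicator_def)
  qed
qed

text \<open>Induction over nonnegative Borel functions, then \<open>\<phi>\<close> as the difference
  of its positive and negative part. Membership in \<open>L_mu\<close> is carried as a premise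
  inside the induction claim, because it descends from a function to the pieces it
  dominates.\<close>

lemma wiener_rel_total:
  assumes "\<phi> \<in> Lm"
  shows "\<exists>Z. wiener_rel \<phi> Z"
proof -
  have nonneg: "u \<in> Lm \<longrightarrow> (\<exists>Z. wiener_rel u Z)"
    if "u \<in> borel_measurable BT" "\<And>t. 0 \<le> u t" for u
    using that
  proof (induction rule: borel_measurable_induct_real)
    case (set A)
    then obtain A' where "A = A' \<inter> {0..T}" "A' \<in> sets borel" by (auto simp: sets_restrict_space)
    then show ?case using wiener_rel_indicator by auto
  next
    case (mult u c)
    show ?case
    \<comment> \<open>For \<open>c = 0\<close> the product lies in the space whatever
      \<open>u\<close> is, so no membership of \<open>u\<close> can be recovered and zero is treated
      separately.\<close>
    proof (cases "c = 0")
      case True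
      then show ?thesis using wiener_rel_zero by auto
    next
      case False
      show ?thesis
      proof
        assume "(\<lambda>t. c * u t) \<in> Lm"
        from L_mu_comb[OF this this, of "1 / c" 0] have "u \<in> Lm" using False by simp
        then show "\<exists>Z. wiener_rel (\<lambda>t. c * u t) Z" using mult wiener_rel_scale by blast
      qed
    qed
  next
    case (add u v)
    show ?case
    proof
      assume uv: "(\<lambda>t. v t + u t) \<in> Lm"
      have "u \<in> Lm" "v \<in> Lm" using add by (auto intro!: L_mu_mono[OF uv])
      then show "\<exists>Z. wiener_rel (\<lambda>t. v t + u t) Z" using add wiener_rel_add by blast
    qed
  next
    case (seq U)
    show ?case
    proof
      assume u: "u \<in> Lm"
      have le: "U i t \<le> u t" if "t \<in> {0..T}" for i t
        using seq.hyps(4)[of t] that \<open>incseq U\<close>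
        by (intro incseq_le) (auto simp: incseq_def le_fun_def space_restrict_space)
      have "U i \<in> Lm" for i
        by (rule L_mu_mono[OF u]) (use seq le in \<open>auto intro: order_trans[OF _ abs_ge_self]\<close>)
      then obtain Zs where Zs: "\<And>i. wiener_rel (U i) (Zs i)" using seq.IH by metis
      show "\<exists>Z. wiener_rel u Z"
        by (rule wiener_rel_limit_exists[of U Zs u u]) (use Zs u seq le in \<open>auto simp: space_restrict_space\<close>)
    qed
  qed
  have [measurable]: "\<phi> \<in> borel_measurable BT" using assms by (rule L_mu_measurable)
  have "(\<lambda>t. max 0 (\<phi> t)) \<in> Lm" "(\<lambda>t. max 0 (- \<phi> t)) \<in> Lm"
    by (auto intro!: L_mu_mono[OF assms])
  then obtain Z Y where "wiener_rel (\<lambda>t. max 0 (\<phi> t)) Z" "wiener_rel (\<lambda>t. max 0 (- \<phi> t)) Y"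
    using nonneg[of "\<lambda>t. max 0 (\<phi> t)"] nonneg[of "\<lambda>t. max 0 (- \<phi> t)"] by auto
  from wiener_rel_diff[OF this] have "wiener_rel (\<lambda>t. max 0 (\<phi> t) - max 0 (- \<phi> t)) (\<lambda>\<omega>. Z \<omega> - Y \<omega>)" .
  moreover have "(\<lambda>t. max 0 (\<phi> t) - max 0 (- \<phi> t)) = \<phi>" by (auto simp: fun_eq_iff max_def)
  ultimately show ?thesis by auto
qed

text \<open>For a signed \<mu> the argument of the square root in \<open>norm_H\<close> might be
  negative a priori; the isometry identifies it with a second moment.\<close>

lemma norm_H_sq:
  assumes "wiener_rel \<phi> Z"
  shows "(norm_H T \<mu> \<phi>)\<^sup>2 = (\<integral>\<omega>. (Z \<omega>)\<^sup>2 \<partial>P)"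
proof -
  have eq: "(\<integral>\<omega>. (Z \<omega>)\<^sup>2 \<partial>P) = ip \<phi> \<phi>"
    using wiener_rel_isometry[OF assms assms] by (simp add: power2_eq_square)
  have "0 \<le> (\<integral>\<omega>. (Z \<omega>)\<^sup>2 \<partial>P)" by simp
  then show ?thesis unfolding norm_H_def eq by simp
qed

text \<open>Choosing one related variable for each integrand suffices: linearity and the values on
  indicators hold up to null sets by uniqueness, and continuity is the isometry applied to
  differences.\<close>

lemma is_wiener_integral_exists: "\<exists>I. is_wiener_integral T P \<mu> I"
proof -
  define I where "I \<phi> = (SOME Z. wiener_rel \<phi> Z)" for \<phi>
  have rel: "wiener_rel \<phi> (I \<phi>)" if "\<phi> \<in> Lm" for \<phi>
    unfolding I_def using wiener_rel_total[OF that] by (rule someI_ex)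
  have "is_wiener_integral T P \<mu> I"
    unfolding is_wiener_integral_def
  proof (intro conjI ballI allI impI)
    show "I \<phi> \<in> L2 P" if "\<phi> \<in> Lm" for \<phi> using rel[OF that] by (rule wiener_rel_L2)
    show "AE \<omega> in P. I (\<lambda>t. a * \<phi> t + b * \<psi> t) \<omega> = a * I \<phi> \<omega> + b * I \<psi> \<omega>"
      if "\<phi> \<in> Lm" "\<psi> \<in> Lm" for \<phi> \<psi> a b
      by (rule wiener_rel_unique[OF rel[OF L_mu_comb[OF that]] wiener_rel.comb[OF rel[OF that(1)] rel[OF that(2)]]])
    show "AE \<omega> in P. I (indicator {0..t}) \<omega> = \<omega> t" if "t \<in> {0..T}" for t
      by (rule wiener_rel_unique[OF rel[OF indicator_L_mu] wiener_rel.base[OF that]]) simp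
    fix \<phi>s \<phi>
    assume *: "(\<forall>n::nat. \<phi>s n \<in> Lm) \<and> \<phi> \<in> Lm \<and> (\<lambda>n. norm_H T \<mu> (\<lambda>t. \<phi>s n t - \<phi> t)) \<longlonglongrightarrow> 0"
    then have "(\<lambda>n. (norm_H T \<mu> (\<lambda>t. \<phi>s n t - \<phi> t))\<^sup>2) \<longlonglongrightarrow> 0\<^sup>2" by (intro tendsto_power) auto
    moreover have "(norm_H T \<mu> (\<lambda>t. \<phi>s n t - \<phi> t))\<^sup>2 = (\<integral>\<omega>. (I (\<phi>s n) \<omega> - I \<phi> \<omega>)\<^sup>2 \<partial>P)" for n
      using * by (intro norm_H_sq wiener_rel_diff rel) auto
    ultimately show "(\<lambda>n. \<integral>\<omega>. (I (\<phi>s n) \<omega> - I \<phi> \<omega>)\<^sup>2 \<partial>P) \<longlonglongrightarrow> 0" by simp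
  qed
  then show ?thesis by blast
qed

section \<open>Properties of the chosen Wiener integral\<close>

abbreviation "WI \<equiv> wiener_integral T P \<mu>"

lemma is_wiener_integral: "is_wiener_integral T P \<mu> WI"
  unfolding wiener_integral_def using is_wiener_integral_exists by (rule someI_ex)

lemma wiener_integral_L2: "\<phi> \<in> Lm \<Longrightarrow> WI \<phi> \<in> L2 P"
  using is_wiener_integral by (simp add: is_wiener_integral_def)

text \<open>\<open>WI\<close> is some map with the characteristic properties, not necessarily the
  one constructed, so agreement is proved along the graph. In the limit case dominated convergence
  gives convergence in \<open>norm_H\<close>; the continuity of \<open>WI\<close> turns it into
  mean-square convergence, and mean-square limits are unique.\<close>

lemma wiener_rel_AE_eq:
  assumes "wiener_rel \<phi> Z"
  shows "AE \<omega> in P. WI \<phi> \<omega> = Z \<omega>"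
  using assms
proof (induction rule: wiener_rel.induct)
  case (base t)
  then show ?case using is_wiener_integral by (simp add: is_wiener_integral_def)
next
  case (comb \<phi> Z \<psi> Y a b)
  then have "AE \<omega> in P. WI (\<lambda>t. a * \<phi> t + b * \<psi> t) \<omega> = a * WI \<phi> \<omega> + b * WI \<psi> \<omega>"
    using is_wiener_integral wiener_rel_L_mu unfolding is_wiener_integral_def by blast
  with comb.IH show ?case by eventually_elim simp
next
  case (lim \<phi>s Zs \<phi> \<eta> Z)
  have \<phi>s: "\<phi>s k \<in> Lm" for k using lim.hyps(1) by (rule wiener_rel_L_mu)
  have "\<bar>\<phi> t\<bar> \<le> \<eta> t" if "t \<in> {0..T}" for t
    using LIMSEQ_le_const2[OF tendsto_rabs[OF lim.hyps(5)[OF that]], of "\<eta> t"] lim.hyps(4)[OF that] by auto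
  then have "(\<lambda>k. ip (\<lambda>t. \<phi>s k t - \<phi> t) (\<lambda>t. \<phi>s k t - \<phi> t)) \<longlonglongrightarrow> 0"
    using lim.hyps \<phi>s by (intro ip_diff_tendsto_0[where \<eta> = \<eta> and \<phi> = \<phi> and \<psi>s = "\<lambda>_. \<phi>"]) auto
  then have "(\<lambda>k. norm_H T \<mu> (\<lambda>t. \<phi>s k t - \<phi> t)) \<longlonglongrightarrow> 0"
    unfolding norm_H_def using tendsto_real_sqrt by fastforce
  then have "(\<lambda>k. \<integral>\<omega>. (WI (\<phi>s k) \<omega> - WI \<phi> \<omega>)\<^sup>2 \<partial>P) \<longlonglongrightarrow> 0"
    using is_wiener_integral \<phi>s lim.hyps(2) unfolding is_wiener_integral_def by blast
  moreover have "(\<integral>\<omega>. (WI (\<phi>s k) \<omega> - WI \<phi> \<omega>)\<^sup>2 \<partial>P) = (\<integral>\<omega>. (Zs k \<omega> - WI \<phi> \<omega>)\<^sup>2 \<partial>P)" for k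
  proof (rule integral_cong_AE)
    show "AE \<omega> in P. (WI (\<phi>s k) \<omega> - WI \<phi> \<omega>)\<^sup>2 = (Zs k \<omega> - WI \<phi> \<omega>)\<^sup>2"
      using lim.IH[of k] by eventually_elim simp
  qed (use L2_diff[OF wiener_integral_L2[OF \<phi>s] wiener_integral_L2[OF lim.hyps(2)]]
      L2_diff[OF wiener_rel_L2[OF lim.hyps(1)] wiener_integral_L2[OF lim.hyps(2)]] in \<open>auto simp: L2_iff\<close>)
  ultimately have "(\<lambda>k. \<integral>\<omega>. (Zs k \<omega> - WI \<phi> \<omega>)\<^sup>2 \<partial>P) \<longlonglongrightarrow> 0" by simp
  then show ?case
    using lim.hyps wiener_integral_L2 by (intro L2_limit_unique[of Zs]) (auto intro: wiener_rel_L2)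
qed

lemma wiener_integral_obtain:
  assumes "\<phi> \<in> Lm"
  obtains Z where "wiener_rel \<phi> Z" "AE \<omega> in P. WI \<phi> \<omega> = Z \<omega>"
  using wiener_rel_total[OF assms] wiener_rel_AE_eq by blast

lemma wiener_integral_isometry:
  assumes "\<phi> \<in> Lm" "\<psi> \<in> Lm"
  shows "(\<integral>\<omega>. WI \<phi> \<omega> * WI \<psi> \<omega> \<partial>P) = ip \<phi> \<psi>"
proof -
  obtain Z Y where ZY: "wiener_rel \<phi> Z" "AE \<omega> in P. WI \<phi> \<omega> = Z \<omega>"
    "wiener_rel \<psi> Y" "AE \<omega> in P. WI \<psi> \<omega> = Y \<omega>"
    using assms by (metis wiener_integral_obtain)
  have "(\<integral>\<omega>. WI \<phi> \<omega> * WI \<psi> \<omega> \<partial>P) = (\<integral>\<omega>. Z \<omega> * Y \<omega> \<partial>P)"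
  proof (rule integral_cong_AE)
    show "AE \<omega> in P. WI \<phi> \<omega> * WI \<psi> \<omega> = Z \<omega> * Y \<omega>" using ZY(2,4) by eventually_elim simp
  qed (use L2_mult_integrable[OF wiener_integral_L2[OF assms(1)] wiener_integral_L2[OF assms(2)]]
      L2_mult_integrable[OF wiener_rel_L2[OF ZY(1)] wiener_rel_L2[OF ZY(3)]] in auto)
  then show ?thesis using wiener_rel_isometry[OF ZY(1,3)] by simp
qed

lemma wiener_rel_mean: "wiener_rel \<phi> Z \<Longrightarrow> (\<integral>\<omega>. Z \<omega> \<partial>P) = 0"
proof (induction rule: wiener_rel.induct)
  case (base t)
  then show ?case by (rule coordinate_mean)
next
  case (comb \<phi> Z \<psi> Y a b)
  then show ?case using L2_integrable[OF wiener_rel_L2] by simp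
next
  case (lim \<phi>s Zs \<phi> \<eta> Z)
  have "(\<lambda>k. \<integral>\<omega>. Zs k \<omega> * 1 \<partial>P) \<longlonglongrightarrow> (\<integral>\<omega>. Z \<omega> * 1 \<partial>P)"
    using lim by (intro L2_tendsto_inner const_L2) (auto intro: wiener_rel_L2)
  then show ?case using lim.IH by (simp add: LIMSEQ_const_iff)
qed

lemma wiener_integral_mean:
  assumes "\<phi> \<in> Lm"
  shows "(\<integral>\<omega>. WI \<phi> \<omega> \<partial>P) = 0"
proof -
  obtain Z where Z: "wiener_rel \<phi> Z" "AE \<omega> in P. WI \<phi> \<omega> = Z \<omega>"
    using assms by (rule wiener_integral_obtain)
  have "(\<integral>\<omega>. WI \<phi> \<omega> \<partial>P) = (\<integral>\<omega>. Z \<omega> \<partial>P)"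
    using Z(2) wiener_integral_L2[OF assms] wiener_rel_L2[OF Z(1)]
    by (intro integral_cong_AE) (auto simp: L2_iff)
  then show ?thesis using wiener_rel_mean[OF Z(1)] by simp
qed

text \<open>
  Being Gaussian is not preserved by sums, but the set of \<open>Y\<close> all of whose translates by
  \<open>span {X\<^sub>t}\<close> are Gaussian absorbs every \<open>Z\<close> in the range of the Wiener integral.
\<close>

definition span_gaussian :: "((real \<Rightarrow> real) \<Rightarrow> real) \<Rightarrow> bool" where
  "span_gaussian Y \<longleftrightarrow> Y \<in> L2 P \<and>
     (\<forall>J c. finite J \<and> J \<subseteq> {0..T} \<longrightarrow> centred_gaussian_cf P (\<lambda>\<omega>. Y \<omega> + (\<Sum>t\<in>J. c t * \<omega> t)))"

text \<open>\<open>Y\<close> and \<open>a\<close> stay arbitrary so that a combination can be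
  absorbed in two rounds: first the second variable into \<open>Y\<close>, then the first variable
  into the result.\<close>

lemma span_gaussian_absorb:
  assumes "wiener_rel \<phi> Z" "span_gaussian Y"
  shows "span_gaussian (\<lambda>\<omega>. a * Z \<omega> + Y \<omega>)"
  using assms
proof (induction arbitrary: Y a rule: wiener_rel.induct)
  case (base t)
  show ?case
    unfolding span_gaussian_def
  proof (intro conjI allI impI)
    have "Y \<in> L2 P" using base by (simp add: span_gaussian_def)
    from L2_linear[OF coordinate_L2[OF base(1)] this, of a 1]
    show "(\<lambda>\<omega>. a * \<omega> t + Y \<omega>) \<in> L2 P" by simp
    fix J c assume J: "finite J \<and> J \<subseteq> {0..T}"
    \<comment> \<open>The new coordinate may already occur in \<open>J\<close>; its coefficient is
      then increased by \<open>a\<close>, otherwise it becomes \<open>a\<close>.\<close>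
    define c' where "c' r = (if r \<in> J then c r else 0) + (if r = t then a else 0)" for r
    have "(\<Sum>r\<in>insert t J. c' r * \<omega> r) = a * \<omega> t + (\<Sum>r\<in>J. c r * \<omega> r)" for \<omega>
    proof -
      have "(\<Sum>r\<in>insert t J. c' r * \<omega> r) =
          (\<Sum>r\<in>insert t J. (if r \<in> J then c r * \<omega> r else 0)) + (\<Sum>r\<in>insert t J. (if r = t then a * \<omega> r else 0))"
        unfolding sum.distrib[symmetric] by (intro sum.cong) (auto simp: c'_def algebra_simps)
      also have "(\<Sum>r\<in>insert t J. (if r \<in> J then c r * \<omega> r else 0)) = (\<Sum>r\<in>J. c r * \<omega> r)"
        using J by (intro sum.mono_neutral_cong_right) auto
      also have "(\<Sum>r\<in>insert t J. (if r = t then a * \<omega> r else 0)) = a * \<omega> t"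
        using J by (subst sum.delta) auto
      finally show ?thesis by simp
    qed
    then have eq: "a * \<omega> t + Y \<omega> + (\<Sum>r\<in>J. c r * \<omega> r) = Y \<omega> + (\<Sum>r\<in>insert t J. c' r * \<omega> r)" for \<omega>
      by simp
    have "finite (insert t J) \<and> insert t J \<subseteq> {0..T}" using J base(1) by simp
    with base(2) have "centred_gaussian_cf P (\<lambda>\<omega>. Y \<omega> + (\<Sum>r\<in>insert t J. c' r * \<omega> r))"
      unfolding span_gaussian_def by blast
    then show "centred_gaussian_cf P (\<lambda>\<omega>. a * \<omega> t + Y \<omega> + (\<Sum>r\<in>J. c r * \<omega> r))"
      unfolding eq .
  qed
next
  case (comb \<phi> Z \<psi> Z' a' b')
  have "span_gaussian (\<lambda>\<omega>. (a * a') * Z \<omega> + ((a * b') * Z' \<omega> + Y \<omega>))"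
    by (intro comb.IH comb.prems)
  then show ?case by (simp add: algebra_simps)
next
  case (lim \<phi>s Zs \<phi> \<eta> Z)
  have Y: "Y \<in> L2 P" using lim.prems by (simp add: span_gaussian_def)
  show ?case
    unfolding span_gaussian_def
  proof (intro conjI allI impI)
    show "(\<lambda>\<omega>. a * Z \<omega> + Y \<omega>) \<in> L2 P" using L2_linear[OF lim.hyps(6) Y, of a 1] by simp
    fix J c assume J: "finite J \<and> J \<subseteq> {0..T}"
    have "(\<lambda>\<omega>. \<Sum>t\<in>J. c t * \<omega> t) \<in> L2 P" using J coordinate_L2 by (intro L2_sum) auto
    from L2_linear[OF Y this, of 1 1] have YS: "(\<lambda>\<omega>. Y \<omega> + (\<Sum>t\<in>J. c t * \<omega> t)) \<in> L2 P" by simp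
    have mem: "(\<lambda>\<omega>. a * V \<omega> + Y \<omega> + (\<Sum>t\<in>J. c t * \<omega> t)) \<in> L2 P" if "V \<in> L2 P" for V
      using L2_linear[OF that YS, of a 1] by (simp add: algebra_simps)
    \<comment> \<open>The added terms cancel in the difference, leaving the given mean-square
      distance scaled by \<open>a\<^sup>2\<close>.\<close>
    have "(\<lambda>k. a\<^sup>2 * (\<integral>\<omega>. (Zs k \<omega> - Z \<omega>)\<^sup>2 \<partial>P)) \<longlonglongrightarrow> 0"
      using lim.hyps(7) by (rule tendsto_mult_right_zero)
    then have "(\<lambda>k. \<integral>\<omega>. ((a * Zs k \<omega> + Y \<omega> + (\<Sum>t\<in>J. c t * \<omega> t)) - (a * Z \<omega> + Y \<omega> + (\<Sum>t\<in>J. c t * \<omega> t)))\<^sup>2 \<partial>P) \<longlonglongrightarrow> 0"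
      by (simp add: right_diff_distrib[symmetric] power_mult_distrib)
    then show "centred_gaussian_cf P (\<lambda>\<omega>. a * Z \<omega> + Y \<omega> + (\<Sum>t\<in>J. c t * \<omega> t))"
      using lim.IH[OF lim.prems, of a] J
      by (intro centred_gaussian_cf_tendsto[OF mem[OF wiener_rel_L2[OF lim.hyps(1)]] mem[OF lim.hyps(6)]])
        (auto simp: span_gaussian_def)
  qed
qed

lemma wiener_rel_cf: "wiener_rel \<phi> Z \<Longrightarrow> centred_gaussian_cf P Z"
proof -
  assume Z: "wiener_rel \<phi> Z"
  have "span_gaussian (\<lambda>_. 0)"
    using coordinate_cf by (auto simp: span_gaussian_def const_L2)
  from span_gaussian_absorb[OF Z this, of 1] show ?thesis
    unfolding span_gaussian_def by (auto dest!: spec[of _ "{}"])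
qed

section \<open>Joint Gaussianity and duality with the Malliavin derivative\<close>

lemma L_mu_sum:
  "(\<And>i. i \<in> J \<Longrightarrow> \<phi> i \<in> Lm) \<Longrightarrow> (\<lambda>t. \<Sum>i\<in>J. c i * \<phi> i t) \<in> Lm"
proof (induction J rule: infinite_finite_induct)
  case (insert i J)
  then show ?case using L_mu_comb[of "\<phi> i" "\<lambda>t. \<Sum>i\<in>J. c i * \<phi> i t" "c i" 1] by simp
qed (auto simp: const_L_mu)

lemma ip_sum_left:
  "(\<And>i. i \<in> J \<Longrightarrow> \<phi> i \<in> Lm) \<Longrightarrow> \<psi> \<in> Lm \<Longrightarrow>
    ip (\<lambda>t. \<Sum>i\<in>J. c i * \<phi> i t) \<psi> = (\<Sum>i\<in>J. c i * ip (\<phi> i) \<psi>)"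
proof (induction J rule: infinite_finite_induct)
  case (insert i J)
  then show ?case
    using ip_comb_left[of "\<phi> i" "\<lambda>t. \<Sum>i\<in>J. c i * \<phi> i t" \<psi> "c i" 1] L_mu_sum[of J \<phi> c] by simp
qed (auto simp: ip_eq)

lemma wiener_rel_sum:
  "(\<And>i. i \<in> J \<Longrightarrow> wiener_rel (\<phi> i) (Z i)) \<Longrightarrow>
    wiener_rel (\<lambda>t. \<Sum>i\<in>J. c i * \<phi> i t) (\<lambda>\<omega>. \<Sum>i\<in>J. c i * Z i \<omega>)"
proof (induction J rule: infinite_finite_induct)
  case (insert i J)
  then show ?case
    using wiener_rel.comb[of "\<phi> i" "Z i" "\<lambda>t. \<Sum>i\<in>J. c i * \<phi> i t" "\<lambda>\<omega>. \<Sum>i\<in>J. c i * Z i \<omega>" "c i" 1] by simp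
qed (auto simp: wiener_rel_zero)

text \<open>A linear combination of Wiener integrals is, up to a null set, the partner in the graph
  of the same combination of integrands, so Gaussianity of single elements of the graph is
  enough.\<close>

lemma wiener_integral_jointly_gaussian:
  fixes n :: nat
  assumes \<phi>: "\<And>i. i < n \<Longrightarrow> \<phi> i \<in> Lm" and h: "h \<in> Lm"
  shows "centred_gaussian_cf P (\<lambda>\<omega>. (\<Sum>i<n. c i * WI (\<phi> i) \<omega>) + s * WI h \<omega>)"
proof -
  have "\<exists>Z. wiener_rel (\<phi> i) Z" if "i < n" for i using wiener_rel_total[OF \<phi>[OF that]] .
  then obtain Z where Z: "\<And>i. i < n \<Longrightarrow> wiener_rel (\<phi> i) (Z i)" by metis
  obtain Y where Y: "wiener_rel h Y" using wiener_rel_total[OF h] by blast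
  have rel: "wiener_rel (\<lambda>t. 1 * (\<Sum>i<n. c i * \<phi> i t) + s * h t) (\<lambda>\<omega>. 1 * (\<Sum>i<n. c i * Z i \<omega>) + s * Y \<omega>)"
    using Z by (intro wiener_rel.comb wiener_rel_sum Y) auto
  have "AE \<omega> in P. \<forall>i\<in>{..<n}. WI (\<phi> i) \<omega> = Z i \<omega>"
    using Z by (intro AE_finite_allI) (auto intro: wiener_rel_AE_eq)
  then have "AE \<omega> in P. (\<Sum>i<n. c i * WI (\<phi> i) \<omega>) + s * WI h \<omega> = 1 * (\<Sum>i<n. c i * Z i \<omega>) + s * Y \<omega>"
    using wiener_rel_AE_eq[OF Y] by eventually_elim simp
  moreover have "(\<lambda>\<omega>. 1 * (\<Sum>i<n. c i * WI (\<phi> i) \<omega>) + s * WI h \<omega>) \<in> L2 P"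
    using \<phi> h by (intro L2_linear L2_sum wiener_integral_L2) auto
  ultimately show ?thesis
    using wiener_rel_cf[OF rel] wiener_rel_L2[OF rel] by (subst centred_gaussian_cf_cong) (auto simp: L2_iff)
qed

lemma malliavin_inner:
  assumes "\<And>i. i < n \<Longrightarrow> \<phi> i \<in> Lm" "h \<in> Lm"
  shows "ip (malliavin_deriv T P \<mu> n f \<phi> \<omega>) h =
    (\<Sum>i<n. partial i f (\<lambda>j. WI (\<phi> j) \<omega>) * ip (\<phi> i) h)"
proof -
  have "malliavin_deriv T P \<mu> n f \<phi> \<omega> = (\<lambda>t. \<Sum>i\<in>{..<n}. partial i f (\<lambda>j. WI (\<phi> j) \<omega>) * \<phi> i t)"
    by (auto simp: malliavin_deriv_def)
  then show ?thesis
    using assms ip_sum_left[of "{..<n}" \<phi> h "\<lambda>i. partial i f (\<lambda>j. WI (\<phi> j) \<omega>)"] by simp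
qed

lemma wiener_integral_is_skorohod_integral:
  assumes h: "h \<in> Lm"
  shows "is_skorohod_integral T P \<mu> (\<lambda>_. h) (WI h)"
  unfolding is_skorohod_integral_def
proof (intro conjI allI impI ballI)
  show "WI h \<in> L2 P" "(\<integral>\<omega>. WI h \<omega> \<partial>P) = 0"
    using h by (auto intro: wiener_integral_L2 wiener_integral_mean)
  fix n :: nat and f \<phi> assume f: "f \<in> Cb_infty n" and "\<forall>i<n. \<phi> i \<in> Lm"
  then have \<phi>: "\<And>i. i < n \<Longrightarrow> \<phi> i \<in> Lm" by auto
  have mi: "ip (malliavin_deriv T P \<mu> n f \<phi> \<omega>) h =
      (\<Sum>i<n. partial i f (\<lambda>j. WI (\<phi> j) \<omega>) * ip (\<phi> i) h)" for \<omega>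
    using \<phi> h by (rule malliavin_inner)
  have p: "integrable P (\<lambda>\<omega>. partial i f (\<lambda>j. WI (\<phi> j) \<omega>))" if i: "i < n" for i
  proof -
    obtain C where C: "\<And>x. \<bar>partial i f x\<bar> \<le> C"
      using Cb_inftyD(5)[OF f i] by (auto simp: bounded_iff)
    have "(\<lambda>\<omega>. partial i f (\<lambda>j. WI (\<phi> j) \<omega>)) \<in> borel_measurable P"
    proof (rule borel_measurable_of_coordinates[OF _ Cb_inftyD(4)[OF f that]])
      show "partial i f x = partial i f y" if "\<forall>j<n. x j = y j" for x y
        by (rule partial_cong[OF Cb_inftyD(1)[OF f] that \<open>i < n\<close>])
      show "WI (\<phi> j) \<in> borel_measurable P" if "j < n" for j
        using wiener_integral_L2[OF \<phi>[OF that]] by (simp add: L2_iff)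
    qed
    then show ?thesis using C by (intro integrable_const_bound[where B = C]) auto
  qed
  show "integrable P (\<lambda>\<omega>. ip (malliavin_deriv T P \<mu> n f \<phi> \<omega>) h)"
    unfolding mi by (intro Bochner_Integration.integrable_sum integrable_mult_left p) simp
  have "(\<integral>\<omega>. cyl_rv T P \<mu> f \<phi> \<omega> * WI h \<omega> \<partial>P) =
      (\<Sum>i<n. (\<integral>\<omega>. partial i f (\<lambda>j. WI (\<phi> j) \<omega>) \<partial>P) * (\<integral>\<omega>. WI (\<phi> i) \<omega> * WI h \<omega> \<partial>P))"
    unfolding cyl_rv_def
    using \<phi> h f by (intro gaussian_integration_by_parts wiener_integral_L2 wiener_integral_jointly_gaussian)
  also have "\<dots> = (\<integral>\<omega>. ip (malliavin_deriv T P \<mu> n f \<phi> \<omega>) h \<partial>P)"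
    unfolding mi using p \<phi> h by (simp add: wiener_integral_isometry)
  finally show "(\<integral>\<omega>. cyl_rv T P \<mu> f \<phi> \<omega> * WI h \<omega> \<partial>P) = (\<integral>\<omega>. ip (malliavin_deriv T P \<mu> n f \<phi> \<omega>) h \<partial>P)" .
qed

section \<open>Uniqueness of the Skorohod integral\<close>

lemma skorohod_integral_unique:
  assumes P: "P = completion W" and sW: "sets W = sets (canonical_algebra T)"
    and Z: "is_skorohod_integral T P \<mu> u Z" and Z': "is_skorohod_integral T P \<mu> u Z'"
  shows "AE \<omega> in P. Z \<omega> = Z' \<omega>"
proof -
  have L2: "Z \<in> L2 P" "Z' \<in> L2 P" using Z Z' by (auto simp: is_skorohod_integral_def)
  have v: "integrable P (\<lambda>\<omega>. Z \<omega> - Z' \<omega>)" using L2 L2_integrable by auto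
  have cos0: "(\<integral>\<omega>. cos ((\<Sum>t\<in>J. c t * \<omega> t) + \<theta>) * (Z \<omega> - Z' \<omega>) \<partial>P) = 0"
    if J: "finite J" "J \<subseteq> {0..T}" for J c \<theta>
  proof (cases "J = {}")
    \<comment> \<open>Cylindrical functionals have at least one argument, so the constant test
      function is covered by the zero-mean clause instead.\<close>
    case True
    then show ?thesis using Z Z' L2 L2_integrable by (simp add: is_skorohod_integral_def)
  next
    case False
    define n where "n = card J"
    have n: "n \<ge> 1" using False J by (simp add: n_def Suc_le_eq card_gt_0_iff)
    obtain e where e: "bij_betw e {..<n} J"
      using ex_bij_betw_nat_finite[OF J(1)] by (auto simp: n_def atLeast0LessThan)
    define f where "f x = cos ((\<Sum>i<n. c (e i) * x i) + \<theta>)" for x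
    have f: "f \<in> Cb_infty n" unfolding f_def[abs_def] by (rule cos_linear_Cb_infty)
    define \<phi> :: "nat \<Rightarrow> real \<Rightarrow> real" where "\<phi> i = indicator {0..e i}" for i
    have \<phi>: "\<forall>i<n. \<phi> i \<in> Lm" by (auto simp: \<phi>_def intro!: indicator_L_mu)
    have eJ: "e i \<in> {0..T}" if "i < n" for i using e J that by (auto simp: bij_betw_def)
    have "AE \<omega> in P. \<forall>i\<in>{..<n}. WI (\<phi> i) \<omega> = \<omega> (e i)"
      unfolding \<phi>_def using eJ by (intro AE_finite_allI wiener_rel_AE_eq wiener_rel.base) auto
    then have AEF: "AE \<omega> in P. cyl_rv T P \<mu> f \<phi> \<omega> = cos ((\<Sum>t\<in>J. c t * \<omega> t) + \<theta>)"
    proof eventually_elim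
      case (elim \<omega>)
      have "(\<Sum>i<n. c (e i) * \<omega> (e i)) = (\<Sum>t\<in>J. c t * \<omega> t)"
        using e by (rule sum.reindex_bij_betw)
      with elim show ?case by (simp add: cyl_rv_def f_def)
    qed
    have Fm: "cyl_rv T P \<mu> f \<phi> \<in> borel_measurable P"
      unfolding cyl_rv_def[abs_def] using \<phi> wiener_integral_L2
      by (intro borel_measurable_of_coordinates[OF Cb_inftyD(1,2)[OF f]]) (auto simp: L2_iff)
    have bd: "\<bar>cyl_rv T P \<mu> f \<phi> \<omega>\<bar> \<le> 1" for \<omega> by (simp add: cyl_rv_def f_def)
    have Sm: "(\<lambda>\<omega>. \<Sum>t\<in>J. c t * \<omega> t) \<in> borel_measurable P"
      using L2_sum[of J "\<lambda>t \<omega>. \<omega> t" P c] J coordinate_L2 by (auto simp: L2_iff subset_eq)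
    have "(\<integral>\<omega>. cyl_rv T P \<mu> f \<phi> \<omega> * Z \<omega> \<partial>P) = (\<integral>\<omega>. cyl_rv T P \<mu> f \<phi> \<omega> * Z' \<omega> \<partial>P)"
    proof -
      have "(\<integral>\<omega>. cyl_rv T P \<mu> f \<phi> \<omega> * V \<omega> \<partial>P) =
          (\<integral>\<omega>. ip (malliavin_deriv T P \<mu> n f \<phi> \<omega>) (u \<omega>) \<partial>P)"
        if "is_skorohod_integral T P \<mu> u V" for V
        using that n f \<phi> unfolding is_skorohod_integral_def by blast
      from this[OF Z] this[OF Z'] show ?thesis by simp
    qed
    then have "(\<integral>\<omega>. cyl_rv T P \<mu> f \<phi> \<omega> * (Z \<omega> - Z' \<omega>) \<partial>P) = 0"
      using integrable_bounded_mult[OF L2_integrable[OF L2(1)] Fm bd]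
        integrable_bounded_mult[OF L2_integrable[OF L2(2)] Fm bd]
      by (simp add: right_diff_distrib)
    moreover have "(\<integral>\<omega>. cyl_rv T P \<mu> f \<phi> \<omega> * (Z \<omega> - Z' \<omega>) \<partial>P) =
        (\<integral>\<omega>. cos ((\<Sum>t\<in>J. c t * \<omega> t) + \<theta>) * (Z \<omega> - Z' \<omega>) \<partial>P)"
    proof (rule integral_cong_AE)
      show "AE \<omega> in P. cyl_rv T P \<mu> f \<phi> \<omega> * (Z \<omega> - Z' \<omega>) = cos ((\<Sum>t\<in>J. c t * \<omega> t) + \<theta>) * (Z \<omega> - Z' \<omega>)"
        using AEF by eventually_elim simp
    qed (use Fm Sm L2 in \<open>auto simp: L2_iff intro!: borel_measurable_times borel_measurable_diff
        measurable_compose[OF _ borel_measurable_cos] borel_measurable_add\<close>)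
    ultimately show ?thesis by simp
  qed
  have spW: "space W = C0 T"
    using sets_eq_imp_space_eq[OF sW] by (simp add: canonical_algebra_def space_measure_of_conv)
  then have spP: "space P = C0 T" by (simp add: P)
  have setsW: "sets W = sigma_sets (space P) {(\<lambda>\<omega>. \<omega> t) -` B \<inter> space P | t B. t \<in> {0..T} \<and> B \<in> sets borel}"
    unfolding sW canonical_algebra_def spP by (rule sets_measure_of) auto
  have zero: "(LINT \<omega>:A|P. Z \<omega> - Z' \<omega>) = 0" if "A \<in> sets W" for A
  proof (rule set_integral_eq_0_of_char[of "{0..T}" "\<lambda>t \<omega>. \<omega> t"])
    show "A \<in> sigma_sets (space P) {(\<lambda>\<omega>. \<omega> t) -` B \<inter> space P | t B. t \<in> {0..T} \<and> B \<in> sets borel}"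
      using that setsW by simp
    fix J c assume J: "finite J" "J \<subseteq> {0..T}"
    show "(\<integral>\<omega>. cos (\<Sum>t\<in>J. c t * \<omega> t) * (Z \<omega> - Z' \<omega>) \<partial>P) = 0" using cos0[OF J, of c 0] by simp
    \<comment> \<open>The phase in \<open>cos0\<close> yields the sine half of the Fourier
      condition.\<close>
    have "cos (x + - (pi / 2)) = sin x" for x :: real by (simp add: cos_diff)
    then show "(\<integral>\<omega>. sin (\<Sum>t\<in>J. c t * \<omega> t) * (Z \<omega> - Z' \<omega>) \<partial>P) = 0"
      using cos0[OF J, of c "- (pi / 2)"] by simp
  qed (use v coordinate_L2 in \<open>auto simp: L2_iff\<close>)
  have "(\<lambda>\<omega>. Z \<omega> - Z' \<omega>) \<in> borel_measurable (completion W)"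
    using borel_measurable_integrable[OF v] unfolding P .
  \<comment> \<open>Vanishing integrals are known over sets of \<open>W\<close> only, while the
    difference is measurable merely for the completion. A \<open>W\<close>-measurable version
    bridges the gap: its integrals over sets of \<open>W\<close> determine it almost
    everywhere.\<close>
  then obtain v' where v'[measurable]: "v' \<in> borel_measurable W" and AEv: "AE \<omega> in W. Z \<omega> - Z' \<omega> = v' \<omega>"
    using completion_ex_borel_measurable_real by blast
  have AEP: "AE \<omega> in P. Z \<omega> - Z' \<omega> = v' \<omega>" unfolding P using AEv by (rule AE_completion)
  have v'P: "v' \<in> borel_measurable P" unfolding P by (rule measurable_completion) (rule v')
  have "integrable P v'" using integrable_cong_AE_imp[OF v v'P] AEP by (auto simp: eq_commute)
  then have iW: "integrable W v'" using integrable_completion[OF v'] unfolding P by simp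
  have "AE \<omega> in W. v' \<omega> = 0"
  proof (rule density_unique_real[OF iW])
    fix A assume A: "A \<in> sets W"
    have "(LINT \<omega>:A|W. v' \<omega>) = (LINT \<omega>:A|P. v' \<omega>)"
      unfolding set_lebesgue_integral_def P using A by (intro integral_completion[symmetric]) auto
    also have "\<dots> = (LINT \<omega>:A|P. Z \<omega> - Z' \<omega>)"
      unfolding set_lebesgue_integral_def
    proof (rule integral_cong_AE)
      have "A \<in> sets P" using A by (simp add: P)
      then show "(\<lambda>\<omega>. indicat_real A \<omega> *\<^sub>R v' \<omega>) \<in> borel_measurable P"
        "(\<lambda>\<omega>. indicat_real A \<omega> *\<^sub>R (Z \<omega> - Z' \<omega>)) \<in> borel_measurable P"
        using v'P v by auto
      show "AE \<omega> in P. indicat_real A \<omega> *\<^sub>R v' \<omega> = indicat_real A \<omega> *\<^sub>R (Z \<omega> - Z' \<omega>)"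
        using AEP by eventually_elim simp
    qed
    finally show "(LINT \<omega>:A|W. v' \<omega>) = (LINT \<omega>:A|W. 0)" using zero[OF A] by (simp add: set_lebesgue_integral_def)
  qed simp
  then have "AE \<omega> in P. v' \<omega> = 0" unfolding P by (rule AE_completion)
  with AEP show ?thesis by eventually_elim simp
qed

end

section \<open>From the covariance measure to the theorem\<close>

lemma covariance_measureI:
  fixes T :: real
    and W P :: "(real \<Rightarrow> real) measure"
    and \<mu> :: "(real \<times> real) set \<Rightarrow> ereal"
  assumes T: "T > 0"
    and W: "prob_space W" and P: "P = completion W"
    and gp: "gaussian_process P {0..T} (\<lambda>t \<omega>. \<omega> t)"
    and mean: "\<forall>t\<in>{0..T}. (\<integral>\<omega>. \<omega> t \<partial>P) = 0"
    and cov: "has_covariance_measure T P \<mu>"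
    and lin: "L_mu_linear T \<mu>"
  shows "covariance_measure P T \<mu>"
proof -
  interpret P: prob_space P
    unfolding P by (rule prob_space.prob_space_completion[OF W])
  have g1: "gaussian_rv P (\<lambda>\<omega>. \<Sum>t\<in>J. c t * \<omega> t)" if "finite J" "J \<subseteq> {0..T}" for J c
    using gp that by (simp add: gaussian_process_def)
  have XL2: "(\<lambda>\<omega>. \<omega> t) \<in> L2 P" if "t \<in> {0..T}" for t
    using P.gaussian_rv_centred_cf(1)[of "\<lambda>\<omega>. \<omega> t"] g1[of "{t}" "\<lambda>_. 1"] mean that by simp
  let ?S = "square_borel T"
  have sq: "space ?S = {0..T} \<times> {0..T}" by (simp add: square_borel_def space_restrict_space)
  have R: "covariance P (\<lambda>\<omega>. \<omega> s) (\<lambda>\<omega>. \<omega> t) = (\<integral>\<omega>. \<omega> s * \<omega> t \<partial>P)" if "s \<in> {0..T}" "t \<in> {0..T}" for s t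
    using mean that by (simp add: covariance_def)
  have corner: "\<mu> ({0..s} \<times> {0..t}) = ereal (\<integral>\<omega>. \<omega> s * \<omega> t \<partial>P)" if "s \<in> {0..T}" "t \<in> {0..T}" for s t
    using cov that R[OF that] by (simp add: has_covariance_measure_def Let_def)
  have sm: "signed_measure ?S \<mu>" "sigma_finite_measure (total_variation ?S \<mu>)"
    using cov by (simp_all add: has_covariance_measure_def Let_def)
  \<comment> \<open>The closed square is itself a corner rectangle, with value
    \<open>E(X\<^sub>T\<^sup>2)\<close>; this finiteness drives the whole decomposition.\<close>
  have fin: "\<bar>\<mu> (space ?S)\<bar> \<noteq> \<infinity>" using corner[of T T] T by (simp add: sq)
  note dec = finite_signed_measure_decomposition[OF sm(1) fin sm(2)]
  show ?thesis
  proof (intro covariance_measure.intro covariance_measure_axioms.intro)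
    show "prob_space P" by (rule P.prob_space_axioms)
    show "T > 0" "finite_measure (pos_variation ?S \<mu>)" "finite_measure (neg_variation ?S \<mu>)"
      "L_mu_linear T \<mu>" by (fact T dec(1) dec(2) lin)+
    show "(\<lambda>\<omega>. \<omega> t) \<in> L2 P" "(\<integral>\<omega>. \<omega> t \<partial>P) = 0" if "t \<in> {0..T}" for t
      using XL2[OF that] mean that by auto
    show "centred_gaussian_cf P (\<lambda>\<omega>. \<Sum>t\<in>J. c t * \<omega> t)" if J: "finite J" "J \<subseteq> {0..T}" for J c
    proof (rule P.gaussian_rv_centred_cf(2)[OF g1[OF J]])
      have "integrable P (\<lambda>\<omega>. c t * \<omega> t)" if "t \<in> J" for t using J that P.L2_integrable[OF XL2] by auto
      then have "(\<integral>\<omega>. (\<Sum>t\<in>J. c t * \<omega> t) \<partial>P) = (\<Sum>t\<in>J. \<integral>\<omega>. c t * \<omega> t \<partial>P)"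
        by (rule Bochner_Integration.integral_sum)
      also have "\<dots> = 0" using J mean by (intro sum.neutral) auto
      finally show "(\<integral>\<omega>. (\<Sum>t\<in>J. c t * \<omega> t) \<partial>P) = 0" .
    qed
    show "inner_H T \<mu> (indicator {0..s}) (indicator {0..t}) = (\<integral>\<omega>. \<omega> s * \<omega> t \<partial>P)"
      if st: "s \<in> {0..T}" "t \<in> {0..T}" for s t
    proof -
      have "{0..s} \<times> {0..t} \<in> sets ?S"
        unfolding square_borel_def using st by (subst sets_restrict_space_iff) (auto intro!: borel_closed closed_Times)
      note D = dec(3)[OF this]
      have "(\<lambda>p. indicator {0..s} (fst p) * indicator {0..t} (snd p)) = indicat_real ({0..s} \<times> {0..t})"
        by (auto simp: fun_eq_iff indicator_def)
      moreover have "{0..s} \<times> {0..t} \<inter> space (pos_variation ?S \<mu>) = {0..s} \<times> {0..t}"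
        "{0..s} \<times> {0..t} \<inter> space (neg_variation ?S \<mu>) = {0..s} \<times> {0..t}"
        using st sets_eq_imp_space_eq[OF sets_pos_variation[of ?S \<mu>]] sets_eq_imp_space_eq[OF sets_neg_variation[of ?S \<mu>]]
        by (auto simp: sq)
      ultimately show ?thesis
        using D corner[OF st] by (simp add: inner_H_def signed_integral_def)
    qed
  qed
qed

theorem proposition6p6:
  fixes T :: real
    and W P :: "(real \<Rightarrow> real) measure"
    and \<mu> :: "(real \<times> real) set \<Rightarrow> ereal"
    and h :: "real \<Rightarrow> real"
  assumes "T > 0"
    and "prob_space W" and "sets W = sets (canonical_algebra T)"
    and "P = completion W"
    and "gaussian_process P {0..T} (\<lambda>t \<omega>. \<omega> t)"
    and "\<forall>t\<in>{0..T}. (\<integral>\<omega>. \<omega> t \<partial>P) = 0"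
    and "full_support T P"
    and "has_covariance_measure T P \<mu>"
    and "L_mu_linear T \<mu>"
    and "h \<in> L_mu T \<mu>"
  shows "(\<lambda>_. h) \<in> Dom_delta T P \<mu> \<and>
         (AE \<omega> in P. skorohod_integral T P \<mu> (\<lambda>_. h) \<omega> = wiener_integral T P \<mu> h \<omega>)"
proof -
  interpret covariance_measure P T \<mu>
    using assms by (intro covariance_measureI[of T W]) auto
  note sk = wiener_integral_is_skorohod_integral[OF \<open>h \<in> L_mu T \<mu>\<close>]
  have "(\<lambda>p. h (snd p)) \<in> borel_measurable (P \<Otimes>\<^sub>M BT)"
    by (rule measurable_compose[OF measurable_snd L_mu_measurable[OF \<open>h \<in> L_mu T \<mu>\<close>]])
  then have "(\<lambda>(\<omega>, t). h t) \<in> borel_measurable (P \<Otimes>\<^sub>M BT)" by (simp add: case_prod_beta')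
  moreover have "(\<integral>\<^sup>+ \<omega>. abs_norm_sq T \<mu> h \<partial>P) < \<infinity>"
    using \<open>h \<in> L_mu T \<mu>\<close> by (simp add: L_mu_def emeasure_space_1)
  ultimately have "(\<lambda>_. h) \<in> Dom_delta T P \<mu>"
    unfolding Dom_delta_def using sk by blast
  \<comment> \<open>The Wiener integral witnesses existence, so the chosen Skorohod integral has the
    defining property as well and uniqueness identifies the two.\<close>
  moreover have "is_skorohod_integral T P \<mu> (\<lambda>_. h) (skorohod_integral T P \<mu> (\<lambda>_. h))"
    unfolding skorohod_integral_def by (rule someI[of _ "WI h"]) (rule sk)
  ultimately show ?thesis
    using skorohod_integral_unique[OF assms(4,3) _ sk] by blast
qed

end
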